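(* Let $K$ be an algebraically closed field of characteristic $p\ge0$ and let $\mathcal{C}\subset\mathbb{P}^2$ be a plane curve of degree $d\ge3$ over $K$. Assume that $p=0$ or $d$ is prime to $p$. Then there exist two outer Galois points $P_1$ and $P_2$ for $\mathcal{C}$ such that $G_{P_1}G_{P_2}=G_{P_1}\times G_{P_2}$, if and only if $\mathcal{C}$ is projectively equivalent to the Fermat curve $X^d+Y^d+Z^d=0$.
   Context: A plane curve $\mathcal{C}\subset\mathbb{P}^2$ is an irreducible projective plane curve over $K$, with function field $K(\mathcal{C})$ and nonsingular model $\hat{\mathcal{C}}$; $(X:Y:Z)$ are homogeneous coordinates on $\mathbb{P}^2$. A point $P\in\mathbb{P}^2$ is a Galois point for $\mathcal{C}$ if the field extension $K(\mathcal{C})/\pi_P^*K(\mathbb{P}^1)$ induced by the projection $\pi_P$ from $P$ is Galois; $G_P$ denotes its Galois group, regarded as a subgroup of $\mathrm{Aut}(\hat{\mathcal{C}})$. A Galois point $P$ is outer if $P\in\mathbb{P}^2\setminus\mathcal{C}$. "Two" Galois points means two different points. The equality $G_{P_1}G_{P_2}=G_{P_1}\times G_{P_2}$ means that the product set $\{\sigma\tau\mid\sigma\in G_{P_1},\tau\in G_{P_2}\}$ in $\mathrm{Aut}(\hat{\mathcal{C}})$ is a subgroup that is the internal direct product of $G_{P_1}$ and $G_{P_2}$. *)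

theory Defs
  imports
    "HOL-Algebra.Finite_Extensions"
    "HOL-Algebra.Bij"
    "HOL-Analysis.Determinants"
    "HOL-Computational_Algebra.Polynomial"
begin

text \<open>
  The ring \<open>K[X,Y,Z]\<close> is the iterated polynomial type \<open>K[X][Y][Z]\<close>, so the coefficient of
  the monomial \<open>X^i Y^j Z^k\<close> is \<open>coeff (coeff (coeff F k) j) i\<close>. A point of the projective plane is
  given by a nonzero coordinate vector of type \<open>'k ^ 3\<close>, up to a nonzero scalar.
\<close>

type_synonym 'k poly3 = "'k poly poly poly"

definition const3 :: "'k::comm_ring_1 \<Rightarrow> 'k poly3" where
  "const3 c = [:[:[:c:]:]:]"

definition X3 :: "'k::comm_ring_1 poly3" where "X3 = [:[:[:0, 1:]:]:]"
definition Y3 :: "'k::comm_ring_1 poly3" where "Y3 = [:[:0, 1:]:]"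
definition Z3 :: "'k::comm_ring_1 poly3" where "Z3 = [:0, 1:]"

text \<open>\<open>eval3 h F x y z\<close> is \<open>F(x,y,z)\<close> with \<open>h\<close> (a ring homomorphism) applied to the coefficients.\<close>

definition eval3 :: "('k::comm_ring_1 \<Rightarrow> 'r::comm_ring_1) \<Rightarrow> 'k poly3 \<Rightarrow> 'r \<Rightarrow> 'r \<Rightarrow> 'r \<Rightarrow> 'r" where
  "eval3 h F x y z =
     poly (map_poly (\<lambda>q. poly (map_poly (\<lambda>r. poly (map_poly h r) x) q) y) F) z"

definition value_at :: "'k::comm_ring_1 poly3 \<Rightarrow> 'k ^ 3 \<Rightarrow> 'k" where
  "value_at F v = eval3 (\<lambda>c. c) F (v $ 1) (v $ 2) (v $ 3)"

text \<open>The zero polynomial is homogeneous of every degree.\<close>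

definition homogeneous3 :: "nat \<Rightarrow> 'k::comm_ring_1 poly3 \<Rightarrow> bool" where
  "homogeneous3 n F \<longleftrightarrow>
     (\<forall>i j k. Polynomial.coeff (Polynomial.coeff (Polynomial.coeff F k) j) i \<noteq> 0 \<longrightarrow> i + j + k = n)"

text \<open>An irreducible plane curve is given by its equation \<open>F = 0\<close>, unique up to a nonzero scalar.\<close>

definition plane_curve :: "nat \<Rightarrow> 'k::field poly3 \<Rightarrow> bool" where
  "plane_curve d F \<longleftrightarrow> homogeneous3 d F \<and> Factorial_Ring.irreducible F"

definition fermat :: "nat \<Rightarrow> 'k::field poly3" where
  "fermat d = X3 ^ d + Y3 ^ d + Z3 ^ d"

definition lin_form :: "'k::comm_ring_1 ^ 3 \<Rightarrow> 'k poly3" where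
  "lin_form a = const3 (a $ 1) * X3 + const3 (a $ 2) * Y3 + const3 (a $ 3) * Z3"

definition proj_equivalent :: "'k::field poly3 \<Rightarrow> 'k poly3 \<Rightarrow> bool" where
  "proj_equivalent F G \<longleftrightarrow>
     (\<exists>(M :: 'k ^ 3 ^ 3) c. invertible M \<and> c \<noteq> 0 \<and>
        eval3 const3 F (lin_form (M $ 1)) (lin_form (M $ 2)) (lin_form (M $ 3)) = const3 c * G)"

definition same_point :: "'k::field ^ 3 \<Rightarrow> 'k ^ 3 \<Rightarrow> bool" where
  "same_point v w \<longleftrightarrow> (\<exists>c. c \<noteq> 0 \<and> w = c *s v)"


text \<open>
  The function field \<open>K(C)\<close> of the curve \<open>F = 0\<close>: fractions \<open>G/H\<close> of forms of equal degree,
  \<open>H\<close> not vanishing identically on the curve, computed modulo \<open>F\<close>.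
\<close>

definition fun_pairs :: "'k::field poly3 \<Rightarrow> ('k poly3 \<times> 'k poly3) set" where
  "fun_pairs F = {(G, H). (\<exists>n. homogeneous3 n G \<and> homogeneous3 n H) \<and> \<not> F dvd H}"

definition fun_rel :: "'k::field poly3 \<Rightarrow> (('k poly3 \<times> 'k poly3) \<times> ('k poly3 \<times> 'k poly3)) set" where
  "fun_rel F = {((G, H), (G', H')).
     (G, H) \<in> fun_pairs F \<and> (G', H') \<in> fun_pairs F \<and> F dvd G * H' - G' * H}"

definition frac :: "'k::field poly3 \<Rightarrow> 'k poly3 \<Rightarrow> 'k poly3 \<Rightarrow> ('k poly3 \<times> 'k poly3) set" where
  "frac F G H = fun_rel F `` {(G, H)}"

definition function_field :: "'k::field poly3 \<Rightarrow> ('k poly3 \<times> 'k poly3) set ring" where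
  "function_field F =
    \<lparr>carrier = fun_pairs F // fun_rel F,
     mult = \<lambda>x y. \<Union>(G, H) \<in> x. \<Union>(G', H') \<in> y. frac F (G * G') (H * H'),
     one = frac F 1 1,
     zero = frac F 0 1,
     add = \<lambda>x y. \<Union>(G, H) \<in> x. \<Union>(G', H') \<in> y. frac F (G * H' + G' * H) (H * H')\<rparr>"

definition constants :: "'k::field poly3 \<Rightarrow> ('k poly3 \<times> 'k poly3) set set" where
  "constants F = range (\<lambda>c. frac F (const3 c) 1)"


definition field_auts :: "('a, 'b) ring_scheme \<Rightarrow> 'a set \<Rightarrow> ('a \<Rightarrow> 'a) set" where
  "field_auts E L = {\<sigma> \<in> Bij (carrier E). \<sigma> \<in> ring_hom E E \<and> (\<forall>x \<in> L. \<sigma> x = x)}"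

text \<open>Galois: algebraic, and the base field is the fixed field of the automorphism group.\<close>

definition galois_extension :: "('a, 'b) ring_scheme \<Rightarrow> 'a set \<Rightarrow> bool" where
  "galois_extension E L \<longleftrightarrow>
     field E \<and> subfield L E \<and>
     (\<forall>x \<in> carrier E. (ring.algebraic E over L) x) \<and>
     {x \<in> carrier E. \<forall>\<sigma> \<in> field_auts E L. \<sigma> x = x} = L"


text \<open>
  The projection from \<open>P\<close> is \<open>v \<mapsto> (L\<^sub>1(v) : L\<^sub>2(v))\<close> for a linear map \<open>L = (L\<^sub>1, L\<^sub>2)\<close> with
  kernel spanned by \<open>P\<close>, and \<open>K(\<P>\<^sup>1)\<close> consists of the fractions \<open>A/B\<close> of binary forms of equal degree.
  Two choices of \<open>L\<close> differ by an invertible \<open>2 \<times> 2\<close> matrix, so all of them yield the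
  same subfield and the existential over \<open>L\<close> in \<open>proj_subfield\<close> is harmless.
\<close>

definition projection_from :: "'k::field ^ 3 \<Rightarrow> 'k ^ 3 ^ 2 \<Rightarrow> bool" where
  "projection_from P L \<longleftrightarrow> {v. L *v v = 0} = range (\<lambda>c. c *s P)"

definition binary_form :: "nat \<Rightarrow> (nat \<Rightarrow> 'k::field) \<Rightarrow> 'k ^ 3 ^ 2 \<Rightarrow> 'k poly3" where
  "binary_form n a L = (\<Sum>i\<le>n. const3 (a i) * lin_form (L $ 1) ^ i * lin_form (L $ 2) ^ (n - i))"

definition proj_subfield :: "'k::field poly3 \<Rightarrow> 'k ^ 3 \<Rightarrow> ('k poly3 \<times> 'k poly3) set set" where
  "proj_subfield F P =
     {frac F (binary_form n a L) (binary_form n b L) | L n a b.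
        projection_from P L \<and> \<not> F dvd binary_form n b L}"

definition galois_point :: "'k::field poly3 \<Rightarrow> 'k ^ 3 \<Rightarrow> bool" where
  "galois_point F P \<longleftrightarrow> P \<noteq> 0 \<and> galois_extension (function_field F) (proj_subfield F P)"

definition outer_galois_point :: "'k::field poly3 \<Rightarrow> 'k ^ 3 \<Rightarrow> bool" where
  "outer_galois_point F P \<longleftrightarrow> galois_point F P \<and> value_at F P \<noteq> 0"

text \<open>
  The automorphism group of the nonsingular model is taken to be the group of
  \<open>K\<close>-automorphisms of the function field: pullback of functions is an anti-isomorphism
  between the two, and subgroups and internal direct products do not depend on the order of composition.
\<close>

definition Aut_model :: "'k::field poly3 \<Rightarrow>
    (('k poly3 \<times> 'k poly3) set \<Rightarrow> ('k poly3 \<times> 'k poly3) set) monoid" where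
  "Aut_model F = (BijGroup (carrier (function_field F)))
     \<lparr>carrier := field_auts (function_field F) (constants F)\<rparr>"

definition galois_group :: "'k::field poly3 \<Rightarrow> 'k ^ 3 \<Rightarrow>
    (('k poly3 \<times> 'k poly3) set \<Rightarrow> ('k poly3 \<times> 'k poly3) set) set" where
  "galois_group F P = field_auts (function_field F) (proj_subfield F P)"

definition internal_direct_product :: "('a, 'b) monoid_scheme \<Rightarrow> 'a set \<Rightarrow> 'a set \<Rightarrow> bool" where
  "internal_direct_product G A B \<longleftrightarrow>
     subgroup A G \<and> subgroup B G \<and> subgroup (A <#>\<^bsub>G\<^esub> B) G \<and>
     (\<lambda>(a, b). a \<otimes>\<^bsub>G\<^esub> b) \<in>
       iso (G\<lparr>carrier := A\<rparr> \<times>\<times> G\<lparr>carrier := B\<rparr>) (G\<lparr>carrier := A <#>\<^bsub>G\<^esub> B\<rparr>)"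

end

theory Submission
  imports Defs "HOL-Computational_Algebra.Polynomial_Factorial" "HOL-Computational_Algebra.Field_as_Ring"
begin

text \<open>
  Let \<open>P\<^sub>1\<close>, \<open>P\<^sub>2\<close> be the two points and let \<open>U\<close>, \<open>V\<close>, \<open>W\<close> be linear coordinates with \<open>V = W = 0\<close> at
  \<open>P\<^sub>1\<close> and \<open>U = W = 0\<close> at \<open>P\<^sub>2\<close>. With \<open>x = U/W\<close> and \<open>y = V/W\<close> the function field is \<open>K(x,y)\<close>, and the
  two projections have the subfields \<open>K(y)\<close> and \<open>K(x)\<close>, with groups \<open>G\<^sub>1\<close> and \<open>G\<^sub>2\<close>. That the points
  are outer means that \<open>F(x,y,1)\<close> has degree \<open>d\<close> in \<open>x\<close> and in \<open>y\<close>, with constant leading coefficients.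

  Suppose that both points are Galois and that the groups commute. For \<open>\<sigma>\<close> in \<open>G\<^sub>1\<close>, the function \<open>\<sigma>(x)\<close> is fixed by \<open>G\<^sub>2\<close>, so it is a rational function
  \<open>a(x)/b(x)\<close>, and \<open>(a/b, y)\<close> is again a zero of the equation of the curve. Comparing degrees in \<open>y\<close>
  gives \<open>F(a, b y, b) = b^d F(x, y, 1)\<close>; since \<open>K[x]\<close> is integrally closed, \<open>b\<close> divides \<open>a\<close>, and so
  \<open>\<sigma>(x) = s(x)\<close> for a polynomial \<open>s\<close> of degree 1 that leaves each coefficient \<open>p\<^sub>j(x)\<close> of \<open>y^j\<close> in \<open>F(x,y,1)\<close>
  invariant (\<open>affine_of_invariant\<close>). Conversely a polynomial \<open>q(x)\<close> invariant under all these \<open>s\<close> lies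
  in the fixed field \<open>K(y)\<close> of \<open>G\<^sub>1\<close>, so it is constant or of degree at least \<open>d\<close>
  (\<open>no_relation_of_small_degree\<close>). Hence \<open>p\<^sub>j\<close> is constant for \<open>j > 0\<close>, and because \<open>d\<close> is nonzero in \<open>K\<close>
  the invariant \<open>p\<^sub>0\<close> has the form \<open>c (x + v)^d + e\<close> (\<open>power_of_invariant\<close>). This gives
  \<open>F = c (U + v W)^d + B(V,W)\<close> (\<open>half_fermat\<close>). By symmetry \<open>F = c' (V + v' W)^d + B'(U,W)\<close>, and both
  together yield \<open>F = c (U + v W)^d + c' (V + v' W)^d + e W^d\<close>, where \<open>e\<close> is not \<open>0\<close> because a sum of two
  \<open>d\<close>-th powers is reducible. Rescaling the coordinates gives the Fermat form.

  For the converse let \<open>F = U^d + V^d + W^d\<close>. For every \<open>d\<close>-th root of unity \<open>\<zeta>\<close> the homology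
  \<open>U \<mapsto> \<zeta> U\<close> induces an automorphism over \<open>K(y)\<close>. If \<open>G/H\<close> is fixed by all of them, then
  it equals \<open>Tr(U^t G) / Tr(U^t H)\<close>, where \<open>Tr\<close> is the sum over the homologies and \<open>t\<close> is chosen such
  that the denominator does not vanish on the curve; modulo \<open>F\<close> such a trace is a form in \<open>V\<close> and
  \<open>W\<close>, so \<open>G/H\<close> lies in \<open>K(y)\<close> (\<open>fixed_field\<close>). As \<open>x\<close> is algebraic over \<open>K(y)\<close>, the extension is
  Galois. Every element of \<open>G\<^sub>1\<close> multiplies \<open>x\<close> by a constant and fixes \<open>y\<close>, and correspondingly for \<open>G\<^sub>2\<close>;
  so the two groups commute and meet trivially.
\<close>

section \<open>Homomorphisms out of the ring of ternary polynomials\<close>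

text \<open>Unital homomorphisms between the commutative rings of two types.\<close>

locale crhom =
  fixes f :: "'a::comm_ring_1 \<Rightarrow> 'b::comm_ring_1"
  assumes hom_one: "f 1 = 1"
    and hom_add: "f (a + b) = f a + f b"
    and hom_mult: "f (a * b) = f a * f b"
begin

lemma hom_zero: "f 0 = 0"
  using hom_add[of 0 0] by simp

lemma hom_uminus: "f (- a) = - f a"
  using hom_add[of a "- a"] hom_zero by (simp add: eq_neg_iff_add_eq_0 add.commute)

lemma hom_diff: "f (a - b) = f a - f b"
  using hom_add[of a "- b"] hom_uminus by simp

lemma hom_power: "f (a ^ n) = f a ^ n"
  by (induction n) (simp_all add: hom_one hom_mult)

lemma hom_sum: "f (sum g A) = (\<Sum>x\<in>A. f (g x))"
  by (induction A rule: infinite_finite_induct) (simp_all add: hom_zero hom_add)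

lemma hom_dvd: "a dvd b \<Longrightarrow> f a dvd f b"
  by (auto simp: dvd_def hom_mult)

lemmas homs = hom_zero hom_one hom_add hom_mult hom_uminus hom_diff hom_power hom_sum

end

lemma crhom_id: "crhom (\<lambda>x. x)"
  by unfold_locales auto

lemma crhom_comp: "crhom f \<Longrightarrow> crhom g \<Longrightarrow> crhom (\<lambda>x. f (g x))"
  by (auto simp: crhom_def)

lemma crhom_coeff_lift: "crhom (\<lambda>c. [:c:])"
  by unfold_locales (auto simp: one_pCons)

lemma crhom_const3: "crhom const3"
  unfolding const3_def by (intro crhom_comp[OF crhom_coeff_lift] crhom_coeff_lift)

lemma crhom_poly_map:
  assumes "crhom h"
  shows "crhom (\<lambda>p. poly (map_poly h p) x)"
proof -
  interpret crhom h by fact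
  have add: "map_poly h (p + q) = map_poly h p + map_poly h q" for p q
    by (rule poly_eqI) (simp add: coeff_map_poly homs)
  have pc: "map_poly h (pCons a p) = pCons (h a) (map_poly h p)" for a p
    by (rule map_poly_pCons) (simp add: homs)
  have sm: "map_poly h (Polynomial.smult a p) = Polynomial.smult (h a) (map_poly h p)" for a p
    by (rule poly_eqI) (simp add: coeff_map_poly homs)
  show ?thesis
  proof
    show "poly (map_poly h 1) x = 1" by (simp add: one_pCons pc homs map_poly_0)
    show "poly (map_poly h (p + q)) x = poly (map_poly h p) x + poly (map_poly h q) x" for p q
      by (simp add: add)
    show "poly (map_poly h (p * q)) x = poly (map_poly h p) x * poly (map_poly h q) x" for p q
      by (induction p) (simp_all add: add pc sm algebra_simps homs)
  qed
qed

lemma crhom_eval3: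
  assumes "crhom h"
  shows "crhom (\<lambda>F. eval3 h F x y z)"
  unfolding eval3_def by (intro crhom_poly_map assms)

lemma eval3_simps:
  assumes "crhom h"
  shows "eval3 h (const3 c) x y z = h c" "eval3 h X3 x y z = x" "eval3 h Y3 x y z = y"
    "eval3 h Z3 x y z = z"
proof -
  have 0: "h 0 = 0" "h 1 = 1" using crhom.homs[OF assms] by auto
  show "eval3 h (const3 c) x y z = h c" "eval3 h X3 x y z = x" "eval3 h Y3 x y z = y"
    "eval3 h Z3 x y z = z"
    by (simp_all add: eval3_def const3_def X3_def Y3_def Z3_def map_poly_pCons 0 map_poly_0
        crhom.hom_one[OF crhom_poly_map[OF assms]]
        crhom.hom_one[OF crhom_poly_map[OF crhom_poly_map[OF assms]]])
qed

lemma poly_hom_ext: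
  assumes "crhom f" "crhom g" and "\<And>a. f [:a:] = g [:a:]" and "f [:0, 1:] = g [:0, 1:]"
  shows "f p = g p"
proof (induction p)
  case 0
  show ?case by (simp add: crhom.hom_zero[OF assms(1)] crhom.hom_zero[OF assms(2)])
next
  case (pCons a p)
  have e: "pCons a p = [:a:] + [:0, 1:] * p" by simp
  show ?case unfolding e
    by (simp only: crhom.homs[OF assms(1)] crhom.homs[OF assms(2)] assms(3,4) pCons.IH)
qed

lemma poly3_hom_ext:
  assumes "crhom f" "crhom g" and "\<And>c. f (const3 c) = g (const3 c)"
    and "f X3 = g X3" "f Y3 = g Y3" "f Z3 = g Z3"
  shows "f F = g F"
proof (rule poly_hom_ext[OF assms(1,2)])
  show "f [:0, 1:] = g [:0, 1:]" using assms(6) by (simp add: Z3_def)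
  fix a
  note L = crhom_coeff_lift
  show "f [:a:] = g [:a:]"
  proof (rule poly_hom_ext[where f = "\<lambda>a. f [:a:]" and g = "\<lambda>a. g [:a:]"])
    show "crhom (\<lambda>a. f [:a:])" "crhom (\<lambda>a. g [:a:])" 
      by (intro crhom_comp[OF _ L] assms)+
    show "f [:[:0, 1:]:] = g [:[:0, 1:]:]" using assms(5) by (simp add: Y3_def)
    fix b
    show "f [:[:b:]:] = g [:[:b:]:]"
    proof (rule poly_hom_ext[where f = "\<lambda>a. f [:[:a:]:]" and g = "\<lambda>a. g [:[:a:]:]"])
      show "crhom (\<lambda>a. f [:[:a:]:])" "crhom (\<lambda>a. g [:[:a:]:])" 
        by (intro crhom_comp[OF assms(1)] crhom_comp[OF assms(2)] crhom_comp[OF L] L)+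
      show "f [:[:[:0, 1:]:]:] = g [:[:[:0, 1:]:]:]" using assms(4) by (simp add: X3_def)
      show "f [:[:[:c:]:]:] = g [:[:[:c:]:]:]" for c using assms(3)[of c] by (simp add: const3_def)
    qed
  qed
qed

text \<open>Substitution of three forms for the variables.\<close>

abbreviation subst3 :: "'k::comm_ring_1 poly3 \<Rightarrow> 'k poly3 \<Rightarrow> 'k poly3 \<Rightarrow> 'k poly3 \<Rightarrow> 'k poly3" where
  "subst3 A B C F \<equiv> eval3 const3 F A B C"

lemma crhom_subst3: "crhom (subst3 A B C)"
  by (rule crhom_eval3[OF crhom_const3])

lemmas subst3_simps = eval3_simps[OF crhom_const3]

lemma hom_subst3:
  assumes "crhom \<psi>" "\<And>c. \<psi> (const3 c) = const3 c"
  shows "\<psi> (subst3 A B C G) = subst3 (\<psi> A) (\<psi> B) (\<psi> C) G"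
  by (rule poly3_hom_ext[of "\<lambda>G. \<psi> (subst3 A B C G)"])
    (simp_all add: crhom_comp[OF assms(1) crhom_subst3] crhom_subst3 subst3_simps assms(2))

section \<open>Homogeneous polynomials\<close>

lemma homogeneous3_add:
  assumes "homogeneous3 n A" "homogeneous3 n B"
  shows "homogeneous3 n (A + B)"
  using assms unfolding homogeneous3_def by (metis add.right_neutral coeff_add)

lemma homogeneous3_uminus: "homogeneous3 n A \<Longrightarrow> homogeneous3 n (- A)"
  unfolding homogeneous3_def by simp

lemma homogeneous3_diff:
  "homogeneous3 n A \<Longrightarrow> homogeneous3 n B \<Longrightarrow> homogeneous3 n (A - B)"
  using homogeneous3_add[of n A "- B"] homogeneous3_uminus[of n B] by simp

lemma homogeneous3_0: "homogeneous3 n 0"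
  by (simp add: homogeneous3_def)

lemma homogeneous3_sum:
  "(\<And>x. x \<in> S \<Longrightarrow> homogeneous3 n (g x)) \<Longrightarrow> homogeneous3 n (sum g S)"
  by (induction S rule: infinite_finite_induct) (auto intro: homogeneous3_add homogeneous3_0)

lemma homogeneous3_const: "homogeneous3 0 (const3 c)"
  by (auto simp: homogeneous3_def const3_def coeff_pCons split: nat.splits)

lemma homogeneous3_vars: "homogeneous3 1 X3" "homogeneous3 1 Y3" "homogeneous3 1 Z3"
  by (auto simp: homogeneous3_def X3_def Y3_def Z3_def one_pCons coeff_pCons split: nat.splits)

lemma homogeneous3_mult:
  assumes "homogeneous3 m A" "homogeneous3 n B"
  shows "homogeneous3 (m + n) (A * B)"
  unfolding homogeneous3_def
proof (intro allI impI)
  fix i j k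
  assume "Polynomial.coeff (Polynomial.coeff (Polynomial.coeff (A * B) k) j) i \<noteq> 0"
  then have "(\<Sum>k'\<le>k. \<Sum>j'\<le>j. \<Sum>i'\<le>i.
     Polynomial.coeff (Polynomial.coeff (Polynomial.coeff A k') j') i' *
     Polynomial.coeff (Polynomial.coeff (Polynomial.coeff B (k - k')) (j - j')) (i - i')) \<noteq> 0"
    by (simp add: coeff_mult coeff_sum)
  then obtain k' j' i' where l: "k' \<le> k" "j' \<le> j" "i' \<le> i" and
    "Polynomial.coeff (Polynomial.coeff (Polynomial.coeff A k') j') i' *
     Polynomial.coeff (Polynomial.coeff (Polynomial.coeff B (k - k')) (j - j')) (i - i') \<noteq> 0"
    by (meson sum.not_neutral_contains_not_neutral atMost_iff)
  then have "Polynomial.coeff (Polynomial.coeff (Polynomial.coeff A k') j') i' \<noteq> 0"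
     "Polynomial.coeff (Polynomial.coeff (Polynomial.coeff B (k - k')) (j - j')) (i - i') \<noteq> 0"
    by auto
  then have "i' + j' + k' = m" "(i - i') + (j - j') + (k - k') = n"
    using assms unfolding homogeneous3_def by blast+
  then show "i + j + k = m + n" using l by linarith
qed

lemma homogeneous3_const_mult: "homogeneous3 n A \<Longrightarrow> homogeneous3 n (const3 c * A)"
  using homogeneous3_mult[OF homogeneous3_const] by force

lemma homogeneous3_power: "homogeneous3 m A \<Longrightarrow> homogeneous3 (m * n) (A ^ n)"
proof (induction n)
  case 0
  then show ?case using homogeneous3_const[of 1] by (simp add: const3_def one_pCons)
next
  case (Suc n)
  then show ?case using homogeneous3_mult[of m A "m * n" "A ^ n"] by simp
qed

lemma homogeneous3_power1: "homogeneous3 1 A \<Longrightarrow> homogeneous3 n (A ^ n)"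
  using homogeneous3_power[of 1 A n] by simp

lemma homogeneous3_lin_form: "homogeneous3 1 (lin_form a)"
  unfolding lin_form_def by (intro homogeneous3_add homogeneous3_const_mult homogeneous3_vars)

lemma homogeneous3_0D:
  assumes "homogeneous3 0 G"
  shows "G = const3 (Polynomial.coeff (Polynomial.coeff (Polynomial.coeff G 0) 0) 0)"
proof (intro poly_eqI)
  fix k j i
  show "Polynomial.coeff (Polynomial.coeff (Polynomial.coeff G k) j) i =
    Polynomial.coeff (Polynomial.coeff (Polynomial.coeff (const3 (Polynomial.coeff (Polynomial.coeff (Polynomial.coeff G 0) 0) 0)) k) j) i"
    using assms[unfolded homogeneous3_def, rule_format, of k j i]
    by (auto simp: const3_def coeff_pCons split: nat.splits)
qed

text \<open>A form of positive degree is a combination of the variables; this gives an induction principle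
  that never looks at coefficients.\<close>

lemma homogeneous3_SucD:
  assumes "homogeneous3 (Suc n) G"
  obtains A B C where "homogeneous3 n A" "homogeneous3 n B" "homogeneous3 n C"
    "G = X3 * A + Y3 * B + Z3 * C"
proof -
  obtain g0 C where G: "G = pCons g0 C" by (cases G)
  obtain g1 B where g0: "g0 = pCons g1 B" by (cases g0)
  obtain g2 A where g1: "g1 = pCons g2 A" by (cases g1)
  have h: "Polynomial.coeff (Polynomial.coeff (Polynomial.coeff G k) j) i \<noteq> 0 \<Longrightarrow> i + j + k = Suc n" for i j k
    using assms unfolding homogeneous3_def by blast
  have "g2 = 0" using h[of 0 0 0] by (auto simp: G g0 g1)
  have "homogeneous3 n C" unfolding homogeneous3_def
    using h[of "Suc k" for k] by (auto simp: G)
  moreover have "homogeneous3 n [:B:]" unfolding homogeneous3_def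
  proof (intro allI impI)
    fix i j k assume "Polynomial.coeff (Polynomial.coeff (Polynomial.coeff [:B:] k) j) i \<noteq> 0"
    then show "i + j + k = n"
      using h[of 0 "Suc j" i] by (auto simp: G g0 coeff_pCons split: nat.splits)
  qed
  moreover have "homogeneous3 n [:[:A:]:]" unfolding homogeneous3_def
  proof (intro allI impI)
    fix i j k assume "Polynomial.coeff (Polynomial.coeff (Polynomial.coeff [:[:A:]:] k) j) i \<noteq> 0"
    then show "i + j + k = n"
      using h[of 0 0 "Suc i"] by (auto simp: G g0 g1 coeff_pCons split: nat.splits)
  qed
  moreover have "G = X3 * [:[:A:]:] + Y3 * [:B:] + Z3 * C"
    by (simp add: G g0 g1 X3_def Y3_def Z3_def \<open>g2 = 0\<close>)
  ultimately show thesis using that by blast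
qed

lemma homogeneous3_induct [consumes 1, case_names const X Y Z add]:
  assumes "homogeneous3 n G"
    and const: "\<And>c. P 0 (const3 c)"
    and X: "\<And>n A. homogeneous3 n A \<Longrightarrow> P n A \<Longrightarrow> P (Suc n) (X3 * A)"
    and Y: "\<And>n A. homogeneous3 n A \<Longrightarrow> P n A \<Longrightarrow> P (Suc n) (Y3 * A)"
    and Z: "\<And>n A. homogeneous3 n A \<Longrightarrow> P n A \<Longrightarrow> P (Suc n) (Z3 * A)"
    and add: "\<And>n A B. homogeneous3 n A \<Longrightarrow> homogeneous3 n B \<Longrightarrow> P n A \<Longrightarrow> P n B \<Longrightarrow> P n (A + B)"
  shows "P n G"
  using assms(1)
proof (induction n arbitrary: G)
  case 0
  then show ?case using homogeneous3_0D const by metis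
next
  case (Suc n)
  obtain A B C where h: "homogeneous3 n A" "homogeneous3 n B" "homogeneous3 n C"
    and G: "G = X3 * A + Y3 * B + Z3 * C" using homogeneous3_SucD[OF Suc.prems] by blast
  have s: "homogeneous3 (Suc n) (V * D)" if "homogeneous3 1 V" "homogeneous3 n D" for V D :: "'a poly3"
    using homogeneous3_mult[OF that] by simp
  show ?case unfolding G
    by (intro add X Y Z Suc.IH h homogeneous3_add s homogeneous3_vars)
qed

lemma homogeneous3_subst3:
  assumes "homogeneous3 n G" "homogeneous3 m A" "homogeneous3 m B" "homogeneous3 m C"
  shows "homogeneous3 (n * m) (subst3 A B C G)"
  using assms(1)
  by (induction rule: homogeneous3_induct)
    (auto simp: subst3_simps crhom.homs[OF crhom_subst3] homogeneous3_const
      intro: homogeneous3_mult homogeneous3_add assms)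

lemma homogeneous3_subst3_1:
  assumes "homogeneous3 n G" "homogeneous3 1 A" "homogeneous3 1 B" "homogeneous3 1 C"
  shows "homogeneous3 n (subst3 A B C G)"
  using homogeneous3_subst3[OF assms] by simp

section \<open>Irreducible ternary polynomials are prime\<close>

text \<open>Gauss's lemma makes iterated polynomial rings factorial over the fields of class \<open>field_gcd\<close>,
  which carry the trivial greatest common divisor of a field. The fraction field of a field, which
  is the field itself, is given this structure, and primality is transported along the
  isomorphism.\<close>

instantiation fract :: (field)
  "{unique_euclidean_ring, normalization_euclidean_semiring, normalization_semidom_multiplicative}"
begin

definition [simp]: "normalize_fract = (normalize_field :: 'a fract \<Rightarrow> _)"
definition [simp]: "unit_factor_fract = (unit_factor_field :: 'a fract \<Rightarrow> _)"
definition [simp]: "modulo_fract = (mod_field :: 'a fract \<Rightarrow> _)"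
definition [simp]: "euclidean_size_fract = (euclidean_size_field :: 'a fract \<Rightarrow> _)"
definition [simp]: "division_segment (x :: 'a fract) = 1"

instance
  by standard (simp_all add: dvd_field_iff field_split_simps split: if_splits)

end

instantiation fract :: (field) euclidean_ring_gcd
begin

definition gcd_fract :: "'a fract \<Rightarrow> 'a fract \<Rightarrow> 'a fract" where
  "gcd_fract = Euclidean_Algorithm.gcd"
definition lcm_fract :: "'a fract \<Rightarrow> 'a fract \<Rightarrow> 'a fract" where
  "lcm_fract = Euclidean_Algorithm.lcm"
definition Gcd_fract :: "'a fract set \<Rightarrow> 'a fract" where
  "Gcd_fract = Euclidean_Algorithm.Gcd"
definition Lcm_fract :: "'a fract set \<Rightarrow> 'a fract" where
  "Lcm_fract = Euclidean_Algorithm.Lcm"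

instance
  by standard (simp_all add: gcd_fract_def lcm_fract_def Gcd_fract_def Lcm_fract_def)

end

instance fract :: (field) field_gcd ..

lemma bij_map_poly:
  assumes "bij f" "f 0 = 0"
  shows "bij (map_poly f)"
proof (rule bijI)
  show "inj (map_poly f)"
  proof (rule injI, rule poly_eqI)
    fix p q n assume "map_poly f p = map_poly f q"
    then have "Polynomial.coeff (map_poly f p) n = Polynomial.coeff (map_poly f q) n" by simp
    then show "Polynomial.coeff p n = Polynomial.coeff q n"
      using assms by (simp add: coeff_map_poly bij_is_inj inj_eq)
  qed
  have "map_poly f (map_poly (inv_into UNIV f) p) = p" for p
  proof (rule poly_eqI)
    fix n
    have "inv_into UNIV f 0 = 0" using assms by (metis bij_is_inj inv_f_f)
    then show "Polynomial.coeff (map_poly f (map_poly (inv_into UNIV f) p)) n = Polynomial.coeff p n"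
      using assms by (simp add: coeff_map_poly bij_is_surj surj_f_inv_f)
  qed
  then show "surj (map_poly f)" by (metis surjI)
qed

lemma crhom_map_poly:
  assumes "crhom f"
  shows "crhom (map_poly f)"
proof -
  interpret crhom f by fact
  have add: "map_poly f (p + q) = map_poly f p + map_poly f q" for p q
    by (rule poly_eqI) (simp add: coeff_map_poly homs)
  show ?thesis
  proof (rule crhom.intro)
    show "map_poly f 1 = 1" by (simp add: homs)
    show "map_poly f (p + q) = map_poly f p + map_poly f q" for p q by (rule add)
    show "map_poly f (p * q) = map_poly f p * map_poly f q" for p q
      by (rule poly_eqI) (simp add: coeff_map_poly coeff_mult homs)
  qed
qed

lemma irreducible_transport:
  assumes f: "crhom f" "bij f" and "Factorial_Ring.irreducible (F :: 'a::idom)"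
  shows "Factorial_Ring.irreducible (f F :: 'b::idom)"
proof -
  interpret crhom f by fact
  define g where "g = inv_into UNIV f"
  have fg: "f (g x) = x" and gf: "g (f y) = y" for x y
    using f(2) by (simp_all add: g_def bij_is_inj bij_is_surj surj_f_inv_f)
  have z: "f x = 0 \<longleftrightarrow> x = 0" for x using gf[of x] gf[of 0] by (auto simp: homs)
  have u: "f x dvd 1 \<longleftrightarrow> x dvd 1" for x
  proof
    assume "f x dvd 1"
    then obtain y where "1 = f x * y" by (auto simp: dvd_def)
    then have "f 1 = f (x * g y)" by (simp add: homs fg)
    then show "x dvd 1" by (metis gf dvd_triv_left)
  next
    assume "x dvd 1" then show "f x dvd 1" using hom_dvd[of x 1] by (simp add: homs)
  qed
  show ?thesis
  proof (rule Factorial_Ring.irreducibleI)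
    show "f F \<noteq> 0" using assms(3) z by auto
    show "\<not> f F dvd 1" using assms(3) u by (auto simp: Factorial_Ring.irreducible_def)
    fix a b assume "f F = a * b"
    then have "F = g a * g b" by (metis fg gf hom_mult)
    then have "g a dvd 1 \<or> g b dvd 1" using assms(3) by (auto simp: Factorial_Ring.irreducible_def)
    then show "a dvd 1 \<or> b dvd 1" by (metis fg u)
  qed
qed

lemma prime_elem_transport:
  assumes f: "crhom f" "bij f" and "prime_elem (f F :: 'b::idom)"
  shows "prime_elem (F :: 'a::idom)"
proof -
  interpret crhom f by fact
  define g where "g = inv_into UNIV f"
  have fg: "f (g x) = x" and gf: "g (f y) = y" for x y
    using f(2) by (simp_all add: g_def bij_is_inj bij_is_surj surj_f_inv_f)
  have d: "x dvd y" if xy: "f x dvd f y" for x y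
  proof -
    obtain c where "f y = f x * c" using xy by (rule dvdE)
    then have "y = x * g c" by (metis fg gf hom_mult)
    then show ?thesis by simp
  qed
  show ?thesis
  proof (rule prime_elemI)
    show "F \<noteq> 0" using assms(3) by (auto simp: prime_elem_def homs)
    show "\<not> F dvd 1" using assms(3) hom_dvd[of F 1] by (auto simp: prime_elem_def homs)
    fix a b assume "F dvd a * b"
    then have "f F dvd f a * f b" using hom_dvd by (metis hom_mult)
    then have "f F dvd f a \<or> f F dvd f b" using assms(3) prime_elem_dvd_multD by blast
    then show "F dvd a \<or> F dvd b" using d by blast
  qed
qed

lemma bij_to_fract: "bij (to_fract :: 'k::field \<Rightarrow> 'k fract)"
proof (rule bijI)
  show "inj (to_fract :: 'k \<Rightarrow> 'k fract)" by (rule injI) simp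
  show "surj (to_fract :: 'k \<Rightarrow> 'k fract)"
  proof
    show "UNIV \<subseteq> range (to_fract :: 'k \<Rightarrow> 'k fract)"
    proof
      fix x :: "'k fract"
      obtain a b where x: "x = Fract a b" "b \<noteq> 0" by (cases x)
      have "Fract a b = Fract (a / b) 1" using x(2) by (simp add: eq_fract)
      then show "x \<in> range to_fract" using x by (auto simp: to_fract_def)
    qed
  qed simp
qed

lemma irreducible_imp_prime_poly3:
  fixes F :: "'k::field poly3"
  assumes "Factorial_Ring.irreducible F"
  shows "prime_elem F"
proof -
  let ?f = "map_poly (map_poly (map_poly (to_fract :: 'k \<Rightarrow> 'k fract)))"
  have h: "crhom ?f"
    by (intro crhom_map_poly crhom.intro) simp_all
  have b: "bij ?f" by (intro bij_map_poly bij_to_fract) simp_all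
  have "prime_elem (?f F)"
    by (rule irreducible_imp_prime_poly) (rule irreducible_transport[OF h b assms])
  then show ?thesis by (rule prime_elem_transport[OF h b])
qed

section \<open>The function field of a prime form\<close>

lemma UN2_eqI:
  fixes g :: "'a \<Rightarrow> 'b \<Rightarrow> 'c \<Rightarrow> 'd \<Rightarrow> 'e set"
  assumes "p \<in> S" "q \<in> T"
    and "\<And>a b c e. (a, b) \<in> S \<Longrightarrow> (c, e) \<in> T \<Longrightarrow> g a b c e = R"
  shows "(\<Union>(a, b)\<in>S. \<Union>(c, e)\<in>T. g a b c e) = R"
proof -
  have "(\<Union>(c, e)\<in>T. g a b c e) = R" if "(a, b) \<in> S" for a b
  proof (rule SUP_eq_const)
    show "T \<noteq> {}" using assms(2) by blast
    show "(case x of (c, e) \<Rightarrow> g a b c e) = R" if "x \<in> T" for x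
      using that \<open>(a, b) \<in> S\<close> assms(3) by (cases x) simp
  qed
  then show ?thesis
  proof (intro SUP_eq_const)
    show "S \<noteq> {}" using assms(1) by blast
    show "(case x of (a, b) \<Rightarrow> \<Union>(c, e)\<in>T. g a b c e) = R"
      if "\<And>a b. (a, b) \<in> S \<Longrightarrow> (\<Union>(c, e)\<in>T. g a b c e) = R" "x \<in> S" for x
      using that by (cases x) simp
  qed
qed

text \<open>For prime \<open>F\<close> the relation \<open>fun_rel F\<close> is an equivalence, and fractions can be computed with on
  representatives.\<close>

locale prime_curve =
  fixes F :: "'k::field poly3"
  assumes prime: "prime_elem F"
begin

abbreviation "E \<equiv> function_field F"
abbreviation "FP \<equiv> fun_pairs F"

lemma dvd_multD: "F dvd a * b \<Longrightarrow> F dvd a \<or> F dvd b"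
  using prime by (rule prime_elem_dvd_multD)

lemma not_dvd_mult: "\<not> F dvd a \<Longrightarrow> \<not> F dvd b \<Longrightarrow> \<not> F dvd a * b"
  using dvd_multD by blast

lemma not_dvd_1: "\<not> F dvd 1"
  using prime by (simp add: prime_elem_def)

lemma not_dvd_const: "c \<noteq> 0 \<Longrightarrow> \<not> F dvd const3 c"
proof
  assume c: "c \<noteq> 0" and "F dvd const3 c"
  then have "F dvd const3 c * const3 (1 / c)" by simp
  also have "const3 c * const3 (1 / c) = 1" using c by (simp add: const3_def one_pCons)
  finally show False using not_dvd_1 by simp
qed

lemma not_dvd_power: "\<not> F dvd a \<Longrightarrow> \<not> F dvd a ^ n"
  using prime by (metis prime_elem_dvd_power)

lemma fun_pairsI: "homogeneous3 n G \<Longrightarrow> homogeneous3 n H \<Longrightarrow> \<not> F dvd H \<Longrightarrow> (G, H) \<in> FP"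
  by (auto simp: fun_pairs_def)

lemma fun_pairsE:
  assumes "(G, H) \<in> FP"
  obtains n where "homogeneous3 n G" "homogeneous3 n H" "\<not> F dvd H"
  using assms by (auto simp: fun_pairs_def)

lemma fun_pairs_mult: "(G, H) \<in> FP \<Longrightarrow> (G', H') \<in> FP \<Longrightarrow> (G * G', H * H') \<in> FP"
  by (auto simp: fun_pairs_def not_dvd_mult intro: homogeneous3_mult)

lemma fun_pairs_add: "(G, H) \<in> FP \<Longrightarrow> (G', H') \<in> FP \<Longrightarrow> (G * H' + G' * H, H * H') \<in> FP"
proof (elim fun_pairsE)
  fix n m assume h: "homogeneous3 n G" "homogeneous3 n H" "\<not> F dvd H"
    "homogeneous3 m G'" "homogeneous3 m H'" "\<not> F dvd H'"
  have "homogeneous3 (n + m) (G' * H)" using homogeneous3_mult[OF h(4) h(2)] by (simp add: add.commute)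
  moreover have "homogeneous3 (n + m) (G * H')" "homogeneous3 (n + m) (H * H')"
    using h by (auto intro: homogeneous3_mult)
  ultimately show ?thesis
    by (intro fun_pairsI[of "n + m"] homogeneous3_add h not_dvd_mult)
qed

lemma fun_pairs_const: "(const3 c, 1) \<in> FP"
proof (rule fun_pairsI[OF homogeneous3_const])
  show "homogeneous3 0 1" using homogeneous3_const[of 1] by (simp add: const3_def one_pCons)
qed (rule not_dvd_1)

lemma const3_simps: "const3 0 = 0" "const3 1 = 1" "const3 (a + b) = const3 a + const3 b"
  "const3 (a * b) = const3 a * const3 b" "const3 (- a) = - const3 a"
  by (simp_all add: const3_def one_pCons)

lemma fun_pairs_0: "(0, 1) \<in> FP" and fun_pairs_1: "(1, 1) \<in> FP"
  using fun_pairs_const[of 0] fun_pairs_const[of 1] by (simp_all add: const3_simps)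

lemma fun_pairs_uminus: "(G, H) \<in> FP \<Longrightarrow> (- G, H) \<in> FP"
  by (auto simp: fun_pairs_def intro: homogeneous3_uminus)

lemma fun_rel_iff: "((G, H), (G', H')) \<in> fun_rel F \<longleftrightarrow>
    (G, H) \<in> FP \<and> (G', H') \<in> FP \<and> F dvd G * H' - G' * H"
  by (simp add: fun_rel_def)

lemma equiv_fun_rel: "equiv FP (fun_rel F)"
proof (rule equivI)
  show "fun_rel F \<subseteq> FP \<times> FP" by (auto simp: fun_rel_def)
  show "refl_on FP (fun_rel F)" by (auto simp: refl_on_def fun_rel_def)
  show "sym (fun_rel F)"
  proof (rule symI)
    fix a b assume ab: "(a, b) \<in> fun_rel F"
    obtain G H G' H' where e: "a = (G, H)" "b = (G', H')" by (cases a, cases b)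
    have "F dvd - (G * H' - G' * H)" using ab unfolding e fun_rel_iff by (simp only: dvd_minus_iff)
    then show "(b, a) \<in> fun_rel F" using ab unfolding e fun_rel_iff by (simp add: algebra_simps)
  qed
  show "trans (fun_rel F)"
  proof (rule transI)
    fix a b c assume abc: "(a, b) \<in> fun_rel F" "(b, c) \<in> fun_rel F"
    obtain G H G' H' G'' H'' where e: "a = (G, H)" "b = (G', H')" "c = (G'', H'')" 
      by (cases a, cases b, cases c)
    have "F dvd (G * H' - G' * H) * H'' + (G' * H'' - G'' * H') * H"
      using abc unfolding e fun_rel_iff by (intro dvd_add dvd_mult2) auto
    then have "F dvd H' * (G * H'' - G'' * H)" by (simp add: algebra_simps)
    then have "F dvd G * H'' - G'' * H"
      using dvd_multD abc unfolding e fun_rel_iff by (auto simp: fun_pairs_def)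
    then show "(a, c) \<in> fun_rel F" using abc unfolding e fun_rel_iff by simp
  qed
qed

lemma frac_eq_iff: "(G, H) \<in> FP \<Longrightarrow> (G', H') \<in> FP \<Longrightarrow>
    frac F G H = frac F G' H' \<longleftrightarrow> F dvd G * H' - G' * H"
  unfolding frac_def using eq_equiv_class_iff[OF equiv_fun_rel] by (simp add: fun_rel_iff)

lemma frac_eqI: "(G, H) \<in> FP \<Longrightarrow> (G', H') \<in> FP \<Longrightarrow> G * H' = G' * H \<Longrightarrow> frac F G H = frac F G' H'"
  by (simp add: frac_eq_iff)

text \<open>A fraction is the set of all pairs that represent it.\<close>

lemma mem_frac: "p \<in> frac F G H \<longleftrightarrow> (G, H) \<in> FP \<and> p \<in> FP \<and> F dvd G * snd p - fst p * H"
  by (cases p) (simp add: frac_def fun_rel_iff)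

lemma frac_closed: "(G, H) \<in> FP \<Longrightarrow> frac F G H \<in> carrier E"
  by (simp add: function_field_def frac_def quotientI)

lemma carrierE:
  assumes "x \<in> carrier E"
  obtains G H where "(G, H) \<in> FP" "x = frac F G H"
  using assms by (auto simp: function_field_def frac_def elim!: quotientE)

lemma mult_frac:
  assumes "(G, H) \<in> FP" "(G', H') \<in> FP"
  shows "frac F G H \<otimes>\<^bsub>E\<^esub> frac F G' H' = frac F (G * G') (H * H')"
proof -
  have "frac F (A * A') (B * B') = frac F (G * G') (H * H')"
    if ab: "(A, B) \<in> frac F G H" "(A', B') \<in> frac F G' H'" for A B A' B'
  proof -
    have m: "(A, B) \<in> FP" "(A', B') \<in> FP" "F dvd G * B - A * H" "F dvd G' * B' - A' * H'"
      using ab by (auto simp: mem_frac)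
    have "F dvd (G * B - A * H) * (G' * B') + A * H * (G' * B' - A' * H')"
      using m by (intro dvd_add dvd_mult dvd_mult2)
    then have "F dvd G * G' * (B * B') - A * A' * (H * H')" by (simp add: algebra_simps)
    then show ?thesis using frac_eq_iff[OF fun_pairs_mult[OF assms] fun_pairs_mult[OF m(1,2)]] by simp
  qed
  note all_eq = this
  have "(G, H) \<in> frac F G H" "(G', H') \<in> frac F G' H'" using assms by (auto simp: mem_frac)
  then have "(\<Union>(A, B)\<in>frac F G H. \<Union>(A', B')\<in>frac F G' H'. frac F (A * A') (B * B')) = frac F (G * G') (H * H')"
    using all_eq by (rule UN2_eqI)
  then show ?thesis unfolding function_field_def by (simp only: ring.simps monoid.simps)
qed

lemma add_frac:
  assumes "(G, H) \<in> FP" "(G', H') \<in> FP"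
  shows "frac F G H \<oplus>\<^bsub>E\<^esub> frac F G' H' = frac F (G * H' + G' * H) (H * H')"
proof -
  have "frac F (A * B' + A' * B) (B * B') = frac F (G * H' + G' * H) (H * H')"
    if ab: "(A, B) \<in> frac F G H" "(A', B') \<in> frac F G' H'" for A B A' B'
  proof -
    have m: "(A, B) \<in> FP" "(A', B') \<in> FP" "F dvd G * B - A * H" "F dvd G' * B' - A' * H'"
      using ab by (auto simp: mem_frac)
    have "F dvd (G * B - A * H) * (H' * B') + (H * B) * (G' * B' - A' * H')"
      using m by (intro dvd_add dvd_mult dvd_mult2)
    then have "F dvd (G * H' + G' * H) * (B * B') - (A * B' + A' * B) * (H * H')" by (simp add: algebra_simps)
    then show ?thesis using frac_eq_iff[OF fun_pairs_add[OF assms] fun_pairs_add[OF m(1,2)]] by simp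
  qed
  note all_eq = this
  have "(G, H) \<in> frac F G H" "(G', H') \<in> frac F G' H'" using assms by (auto simp: mem_frac)
  then have "(\<Union>(A, B)\<in>frac F G H. \<Union>(A', B')\<in>frac F G' H'. frac F (A * B' + A' * B) (B * B')) = frac F (G * H' + G' * H) (H * H')"
    using all_eq by (rule UN2_eqI)
  then show ?thesis unfolding function_field_def by (simp only: ring.simps monoid.simps)
qed

lemma one_frac: "\<one>\<^bsub>E\<^esub> = frac F 1 1" and zero_frac: "\<zero>\<^bsub>E\<^esub> = frac F 0 1"
  by (simp_all add: function_field_def)

lemma frac_eq_0_iff: "(G, H) \<in> FP \<Longrightarrow> frac F G H = \<zero>\<^bsub>E\<^esub> \<longleftrightarrow> F dvd G"
  by (simp add: zero_frac frac_eq_iff fun_pairs_0)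

lemma fun_pairs_inv: "(G, H) \<in> FP \<Longrightarrow> \<not> F dvd G \<Longrightarrow> (H, G) \<in> FP"
  by (auto simp: fun_pairs_def)

lemma field_E: "field E"
proof -
  note cl = frac_closed fun_pairs_mult fun_pairs_add fun_pairs_0 fun_pairs_1 fun_pairs_uminus
  have "cring E"
  proof (rule cringI)
    show "abelian_group E"
    proof (rule abelian_groupI)
      show "x \<oplus>\<^bsub>E\<^esub> y \<in> carrier E" if "x \<in> carrier E" "y \<in> carrier E" for x y
        using that by (elim carrierE) (simp add: add_frac cl)
      show "\<zero>\<^bsub>E\<^esub> \<in> carrier E" by (simp add: zero_frac cl)
      show "x \<oplus>\<^bsub>E\<^esub> y \<oplus>\<^bsub>E\<^esub> z = x \<oplus>\<^bsub>E\<^esub> (y \<oplus>\<^bsub>E\<^esub> z)"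
        if "x \<in> carrier E" "y \<in> carrier E" "z \<in> carrier E" for x y z
        using that by (elim carrierE)
          (simp add: add_frac fun_pairs_add,
            rule arg_cong2[where f = "frac F"], simp_all add: algebra_simps)
      show "x \<oplus>\<^bsub>E\<^esub> y = y \<oplus>\<^bsub>E\<^esub> x" if "x \<in> carrier E" "y \<in> carrier E" for x y
        using that by (elim carrierE) (simp add: add_frac algebra_simps)
      show "\<zero>\<^bsub>E\<^esub> \<oplus>\<^bsub>E\<^esub> x = x" if "x \<in> carrier E" for x
        using that by (elim carrierE) (simp add: add_frac zero_frac cl)
      show "\<exists>y\<in>carrier E. y \<oplus>\<^bsub>E\<^esub> x = \<zero>\<^bsub>E\<^esub>" if x: "x \<in> carrier E" for x
      proof -
        obtain G H where GH: "(G, H) \<in> FP" "x = frac F G H" using x by (rule carrierE)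
        have "frac F (- G) H \<oplus>\<^bsub>E\<^esub> x = \<zero>\<^bsub>E\<^esub>"
          using GH fun_pairs_add[OF fun_pairs_uminus[OF GH(1)] GH(1)]
          by (simp add: add_frac fun_pairs_uminus frac_eq_0_iff)
        then show ?thesis by (rule bexI[OF _ frac_closed[OF fun_pairs_uminus[OF GH(1)]]])
      qed
    qed
    show "comm_monoid E"
    proof (rule comm_monoidI)
      show "x \<otimes>\<^bsub>E\<^esub> y \<in> carrier E" if "x \<in> carrier E" "y \<in> carrier E" for x y
        using that by (elim carrierE) (simp add: mult_frac cl)
      show "\<one>\<^bsub>E\<^esub> \<in> carrier E" by (simp add: one_frac cl)
      show "x \<otimes>\<^bsub>E\<^esub> y \<otimes>\<^bsub>E\<^esub> z = x \<otimes>\<^bsub>E\<^esub> (y \<otimes>\<^bsub>E\<^esub> z)" if "x \<in> carrier E" "y \<in> carrier E" "z \<in> carrier E" for x y z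
        using that by (elim carrierE) (simp add: mult_frac fun_pairs_mult, rule frac_eqI, simp_all add: fun_pairs_mult algebra_simps)
      show "x \<otimes>\<^bsub>E\<^esub> y = y \<otimes>\<^bsub>E\<^esub> x" if "x \<in> carrier E" "y \<in> carrier E" for x y
        using that by (elim carrierE) (simp add: mult_frac fun_pairs_mult, rule frac_eqI, simp_all add: fun_pairs_mult algebra_simps)
      show "\<one>\<^bsub>E\<^esub> \<otimes>\<^bsub>E\<^esub> x = x" if "x \<in> carrier E" for x
        using that by (elim carrierE) (simp add: mult_frac one_frac cl)
    qed
    show "(x \<oplus>\<^bsub>E\<^esub> y) \<otimes>\<^bsub>E\<^esub> z = x \<otimes>\<^bsub>E\<^esub> z \<oplus>\<^bsub>E\<^esub> y \<otimes>\<^bsub>E\<^esub> z"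
      if xyz: "x \<in> carrier E" "y \<in> carrier E" "z \<in> carrier E" for x y z
    proof -
      obtain G H where x: "(G, H) \<in> FP" "x = frac F G H" using xyz(1) by (rule carrierE)
      obtain G' H' where y: "(G', H') \<in> FP" "y = frac F G' H'" using xyz(2) by (rule carrierE)
      obtain A B where z: "(A, B) \<in> FP" "z = frac F A B" using xyz(3) by (rule carrierE)
      have "frac F ((G * H' + G' * H) * A) (H * H' * B) =
          frac F (G * A * (H' * B) + G' * A * (H * B)) (H * B * (H' * B))"
        by (rule frac_eqI) (intro fun_pairs_mult fun_pairs_add x y z, intro fun_pairs_mult fun_pairs_add x y z,
          simp add: algebra_simps)
      then show ?thesis
        by (simp add: x y z add_frac mult_frac fun_pairs_mult fun_pairs_add)
    qed
  qed
  then interpret cring E .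
  show ?thesis
  proof (rule cring_fieldI2)
    show "\<zero>\<^bsub>E\<^esub> \<noteq> \<one>\<^bsub>E\<^esub>"
      using frac_eq_0_iff[OF fun_pairs_1] not_dvd_1 by (metis one_frac)
    fix a assume a: "a \<in> carrier E" "a \<noteq> \<zero>\<^bsub>E\<^esub>"
    obtain G H where GH: "(G, H) \<in> FP" "a = frac F G H" using a(1) by (rule carrierE)
    then have i: "(H, G) \<in> FP" using a(2) by (simp add: frac_eq_0_iff fun_pairs_inv)
    then have "a \<otimes>\<^bsub>E\<^esub> frac F H G = \<one>\<^bsub>E\<^esub>"
      using GH fun_pairs_mult[OF GH(1) i] by (simp add: mult_frac one_frac frac_eq_iff fun_pairs_1)
    then show "\<exists>b\<in>carrier E. a \<otimes>\<^bsub>E\<^esub> b = \<one>\<^bsub>E\<^esub>" by (rule bexI[OF _ frac_closed[OF i]])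
  qed
qed

sublocale E: field "function_field F" by (rule field_E)

lemma inv_frac:
  assumes "(G, H) \<in> FP" "\<not> F dvd G"
  shows "inv\<^bsub>E\<^esub> (frac F G H) = frac F H G"
proof (rule E.comm_inv_char)
  note i = fun_pairs_inv[OF assms]
  show "frac F G H \<otimes>\<^bsub>E\<^esub> frac F H G = \<one>\<^bsub>E\<^esub>"
    using assms(1) i fun_pairs_mult[OF assms(1) i] by (simp add: mult_frac one_frac frac_eq_iff fun_pairs_1)
  show "frac F G H \<in> carrier E" "frac F H G \<in> carrier E"
    using assms(1) i by (simp_all add: frac_closed)
qed

lemma fun_pairs_power: "(G, H) \<in> FP \<Longrightarrow> (G ^ n, H ^ n) \<in> FP"
  by (induction n) (simp_all add: fun_pairs_1 fun_pairs_mult)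

lemma pow_frac:
  assumes "(G, H) \<in> FP"
  shows "frac F G H [^]\<^bsub>E\<^esub> (n::nat) = frac F (G ^ n) (H ^ n)"
proof (induction n)
  case 0
  then show ?case by (simp add: one_frac)
next
  case (Suc n)
  then show ?case
    by (simp add: mult_frac fun_pairs_power assms power_Suc2 del: power_Suc)
qed

lemma uminus_frac:
  assumes "(G, H) \<in> FP"
  shows "\<ominus>\<^bsub>E\<^esub> frac F G H = frac F (- G) H"
proof (rule E.minus_equality)
  show "frac F (- G) H \<oplus>\<^bsub>E\<^esub> frac F G H = \<zero>\<^bsub>E\<^esub>"
    using fun_pairs_add[OF fun_pairs_uminus[OF assms] assms]
    by (simp add: add_frac assms fun_pairs_uminus frac_eq_0_iff)
  show "frac F G H \<in> carrier E" "frac F (- G) H \<in> carrier E"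
    using assms by (simp_all add: frac_closed fun_pairs_uminus)
qed

lemma add_frac_same:
  assumes "(G, H) \<in> FP" "(G', H) \<in> FP" "homogeneous3 n G" "homogeneous3 n G'" "homogeneous3 n H"
  shows "frac F G H \<oplus>\<^bsub>E\<^esub> frac F G' H = frac F (G + G') H"
proof -
  have "(G + G', H) \<in> FP" using assms by (intro fun_pairsI homogeneous3_add) (auto simp: fun_pairs_def)
  then show ?thesis using assms
    by (simp add: add_frac) (rule frac_eqI, simp_all add: fun_pairs_add algebra_simps)
qed

section \<open>Automorphisms of the function field\<close>

lemma field_auts_mono: "L \<subseteq> L' \<Longrightarrow> field_auts E L' \<subseteq> field_auts E L"
  by (auto simp: field_auts_def)

lemma field_auts_hom:
  assumes "\<sigma> \<in> field_auts E L"
  shows "\<And>x. x \<in> carrier E \<Longrightarrow> \<sigma> x \<in> carrier E"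
    "\<And>x y. x \<in> carrier E \<Longrightarrow> y \<in> carrier E \<Longrightarrow> \<sigma> (x \<otimes>\<^bsub>E\<^esub> y) = \<sigma> x \<otimes>\<^bsub>E\<^esub> \<sigma> y"
    "\<And>x y. x \<in> carrier E \<Longrightarrow> y \<in> carrier E \<Longrightarrow> \<sigma> (x \<oplus>\<^bsub>E\<^esub> y) = \<sigma> x \<oplus>\<^bsub>E\<^esub> \<sigma> y"
    "\<sigma> \<one>\<^bsub>E\<^esub> = \<one>\<^bsub>E\<^esub>" "\<sigma> \<zero>\<^bsub>E\<^esub> = \<zero>\<^bsub>E\<^esub>" "\<And>x. x \<in> L \<Longrightarrow> \<sigma> x = x"
    "\<sigma> \<in> extensional (carrier E)" "inj_on \<sigma> (carrier E)"
proof -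
  have h: "\<sigma> \<in> ring_hom E E" and b: "\<sigma> \<in> Bij (carrier E)" using assms by (auto simp: field_auts_def)
  show "\<And>x. x \<in> carrier E \<Longrightarrow> \<sigma> x \<in> carrier E"
    "\<And>x y. x \<in> carrier E \<Longrightarrow> y \<in> carrier E \<Longrightarrow> \<sigma> (x \<otimes>\<^bsub>E\<^esub> y) = \<sigma> x \<otimes>\<^bsub>E\<^esub> \<sigma> y"
    "\<And>x y. x \<in> carrier E \<Longrightarrow> y \<in> carrier E \<Longrightarrow> \<sigma> (x \<oplus>\<^bsub>E\<^esub> y) = \<sigma> x \<oplus>\<^bsub>E\<^esub> \<sigma> y"
    "\<sigma> \<one>\<^bsub>E\<^esub> = \<one>\<^bsub>E\<^esub>" using h by (auto simp: ring_hom_def)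
  show "\<sigma> \<zero>\<^bsub>E\<^esub> = \<zero>\<^bsub>E\<^esub>" using h E.ring_axioms by (metis ring_hom_zero)
  show "\<And>x. x \<in> L \<Longrightarrow> \<sigma> x = x" using assms by (auto simp: field_auts_def)
  show "\<sigma> \<in> extensional (carrier E)" "inj_on \<sigma> (carrier E)"
    using b by (auto simp: Bij_def bij_betw_def)
qed

lemma constants_subset: "constants F \<subseteq> carrier E"
  by (auto simp: constants_def intro: frac_closed fun_pairs_const)

lemma subgroup_field_auts: "L \<subseteq> carrier E \<Longrightarrow> subgroup (field_auts E L) (BijGroup (carrier E))"
proof (rule subgroup.intro)
  assume L: "L \<subseteq> carrier E"
  show "field_auts E L \<subseteq> carrier (BijGroup (carrier E))" by (auto simp: BijGroup_def field_auts_def)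
  show "x \<otimes>\<^bsub>BijGroup (carrier E)\<^esub> y \<in> field_auts E L"
    if xy: "x \<in> field_auts E L" "y \<in> field_auts E L" for x y
  proof -
    note hx = field_auts_hom[OF xy(1)] and hy = field_auts_hom[OF xy(2)]
    have b: "x \<in> Bij (carrier E)" "y \<in> Bij (carrier E)" using xy by (auto simp: field_auts_def)
    have "compose (carrier E) x y \<in> ring_hom E E"
      by (rule ring_hom_memI) (auto simp: compose_def hx hy)
    moreover have "compose (carrier E) x y z = z" if "z \<in> L" for z
      using that L hx(6) hy(6) by (auto simp: compose_def)
    ultimately show ?thesis using b by (simp add: BijGroup_def field_auts_def compose_Bij)
  qed
  show "\<one>\<^bsub>BijGroup (carrier E)\<^esub> \<in> field_auts E L"
    using L by (auto simp: BijGroup_def field_auts_def id_Bij intro!: ring_hom_memI)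
  show "inv\<^bsub>BijGroup (carrier E)\<^esub> x \<in> field_auts E L" if x: "x \<in> field_auts E L" for x
  proof -
    note h = field_auts_hom[OF x]
    have b: "x \<in> Bij (carrier E)" using x by (auto simp: field_auts_def)
    then have bb: "bij_betw x (carrier E) (carrier E)" by (simp add: Bij_def)
    define g where "g = inv_into (carrier E) x"
    have g: "g y \<in> carrier E" "x (g y) = y" if "y \<in> carrier E" for y
      using bij_betwE[OF bij_betw_inv_into[OF bb]] bij_betw_inv_into_right[OF bb that] that
      by (simp_all add: g_def)
    have gx: "g (x y) = y" if "y \<in> carrier E" for y
      using bij_betw_inv_into_left[OF bb that] by (simp add: g_def)
    have "restrict g (carrier E) \<in> ring_hom E E"
    proof (rule ring_hom_memI)
      fix u v assume uv: "u \<in> carrier E" "v \<in> carrier E"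
      show "restrict g (carrier E) (u \<otimes>\<^bsub>E\<^esub> v) = restrict g (carrier E) u \<otimes>\<^bsub>E\<^esub> restrict g (carrier E) v"
        using uv gx[of "g u \<otimes>\<^bsub>E\<^esub> g v"] by (simp add: h g)
      show "restrict g (carrier E) (u \<oplus>\<^bsub>E\<^esub> v) = restrict g (carrier E) u \<oplus>\<^bsub>E\<^esub> restrict g (carrier E) v"
        using uv gx[of "g u \<oplus>\<^bsub>E\<^esub> g v"] by (simp add: h g)
    qed (use g gx[of "\<one>\<^bsub>E\<^esub>"] h in auto)
    moreover have "restrict g (carrier E) y = y" if "y \<in> L" for y
      using that L h(6) gx by (metis restrict_apply' subsetD)
    ultimately show ?thesis using b
      by (simp add: inv_BijGroup field_auts_def restrict_inv_into_Bij flip: g_def)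
        (simp add: g_def restrict_inv_into_Bij)
  qed
qed

lemma group_Aut_model: "group (Aut_model F)"
proof -
  interpret group "BijGroup (carrier E)" by (rule group_BijGroup)
  show ?thesis unfolding Aut_model_def
    using subgroup.subgroup_is_group[OF subgroup_field_auts[OF constants_subset] group_BijGroup] .
qed

lemma subgroup_Aut_model:
  assumes "constants F \<subseteq> L" "L \<subseteq> carrier E"
  shows "subgroup (field_auts E L) (Aut_model F)"
proof -
  interpret group "BijGroup (carrier E)" by (rule group_BijGroup)
  show ?thesis unfolding Aut_model_def
    by (rule subgroup_incl[OF subgroup_field_auts[OF assms(2)] subgroup_field_auts[OF constants_subset]
          field_auts_mono[OF assms(1)]])
qed

lemma mult_Aut_model:
  assumes "\<sigma> \<in> field_auts E L" "\<tau> \<in> field_auts E L'"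
  shows "\<sigma> \<otimes>\<^bsub>Aut_model F\<^esub> \<tau> = compose (carrier E) \<sigma> \<tau>"
  using assms by (simp add: Aut_model_def BijGroup_def field_auts_def)

end

section \<open>Binary forms\<close>

text \<open>The binary form \<open>\<Sum>\<^bsub>i\<le>n\<^esub> c\<^sub>i a^i b^(n-i)\<close>, with its coefficients mapped into the ring by \<open>h\<close>. For
  \<open>b = 1\<close> and \<open>h\<close> the embedding of constants it is the polynomial with coefficients \<open>c\<^sub>i\<close>.\<close>

definition bform :: "('k \<Rightarrow> 'r::comm_ring_1) \<Rightarrow> nat \<Rightarrow> (nat \<Rightarrow> 'k) \<Rightarrow> 'r \<Rightarrow> 'r \<Rightarrow> 'r" where
  "bform h n c a b = (\<Sum>i\<le>n. h (c i) * a ^ i * b ^ (n - i))"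

lemma binary_form_eq: "binary_form n c L = bform const3 n c (lin_form (L $ 1)) (lin_form (L $ 2))"
  by (simp add: binary_form_def bform_def)

lemma hom_bform: "crhom g \<Longrightarrow> g (bform h n c a b) = bform (\<lambda>x. g (h x)) n c (g a) (g b)"
  by (simp add: bform_def crhom.homs)

lemma bform_scale: "bform h n c (t * a) (t * b) = t ^ n * bform h n c a b"
proof -
  have "h (c i) * (t * a) ^ i * (t * b) ^ (n - i) = t ^ n * (h (c i) * a ^ i * b ^ (n - i))"
    if "i \<le> n" for i
  proof -
    have "t ^ n = t ^ i * t ^ (n - i)" using that by (simp flip: power_add)
    then show ?thesis by (simp add: power_mult_distrib ac_simps)
  qed
  then show ?thesis unfolding bform_def sum_distrib_left by (intro sum.cong refl) simp
qed

lemma bform_at_0: "bform h n c a 0 = h (c n) * a ^ n"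
proof -
  have "bform h n c a 0 = (\<Sum>i\<le>n. if i = n then h (c n) * a ^ n else 0)"
    unfolding bform_def by (intro sum.cong) (auto simp: power_0_left)
  then show ?thesis by simp
qed

lemma bform_Suc_left: "h 0 = 0 \<Longrightarrow> bform h (Suc n) (case_nat 0 c) x y = x * bform h n c x y"
  unfolding bform_def sum.atMost_Suc_shift by (simp add: sum_distrib_left ac_simps)

lemma bform_Suc_right:
  assumes "h 0 = 0"
  shows "bform h (Suc n) (\<lambda>i. if i \<le> n then c i else 0) x y = y * bform h n c x y"
proof -
  have "bform h (Suc n) (\<lambda>i. if i \<le> n then c i else 0) x y =
      (\<Sum>i\<le>n. h (c i) * x ^ i * y ^ Suc (n - i))"
    unfolding bform_def by (simp add: assms Suc_diff_le)
  also have "\<dots> = y * bform h n c x y" by (simp add: bform_def sum_distrib_left ac_simps)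
  finally show ?thesis .
qed

lemma homogeneous3_bform:
  assumes "homogeneous3 1 A" "homogeneous3 1 B"
  shows "homogeneous3 n (bform const3 n c A B)"
  unfolding bform_def
proof (rule homogeneous3_sum)
  fix i assume "i \<in> {..n}"
  then show "homogeneous3 n (const3 (c i) * A ^ i * B ^ (n - i))"
    using homogeneous3_mult[OF homogeneous3_const_mult[OF homogeneous3_power1[OF assms(1), of i], of "c i"] homogeneous3_power1[OF assms(2), of "n - i"]]
    by simp
qed

text \<open>The homogeneous component of degree \<open>n\<close> of the subalgebra \<open>K[A,B]\<close>.\<close>

definition bforms :: "nat \<Rightarrow> 'k::comm_ring_1 poly3 \<Rightarrow> 'k poly3 \<Rightarrow> 'k poly3 set" where
  "bforms n A B = range (\<lambda>c. bform const3 n c A B)"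

lemma bforms_homogeneous: "homogeneous3 1 A \<Longrightarrow> homogeneous3 1 B \<Longrightarrow> P \<in> bforms n A B \<Longrightarrow> homogeneous3 n P"
  by (auto simp: bforms_def intro: homogeneous3_bform)

lemma bforms_add: "P \<in> bforms n A B \<Longrightarrow> Q \<in> bforms n A B \<Longrightarrow> P + Q \<in> bforms n A B"
proof -
  assume "P \<in> bforms n A B" "Q \<in> bforms n A B"
  then obtain c c' where "P = bform const3 n c A B" "Q = bform const3 n c' A B" by (auto simp: bforms_def)
  then have "P + Q = bform const3 n (\<lambda>i. c i + c' i) A B"
    by (simp add: bform_def sum.distrib crhom.homs[OF crhom_const3] algebra_simps)
  then show ?thesis by (auto simp: bforms_def)
qed

lemma bforms_const_mult: "P \<in> bforms n A B \<Longrightarrow> const3 k * P \<in> bforms n A B"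
proof -
  assume "P \<in> bforms n A B"
  then obtain c where "P = bform const3 n c A B" by (auto simp: bforms_def)
  then have "const3 k * P = bform const3 n (\<lambda>i. k * c i) A B"
    by (simp add: bform_def sum_distrib_left crhom.homs[OF crhom_const3] algebra_simps)
  then show ?thesis by (auto simp: bforms_def)
qed

lemma bforms_uminus: "P \<in> bforms n A B \<Longrightarrow> - P \<in> bforms n A B"
  using bforms_const_mult[of P n A B "- 1"] by (simp add: crhom.homs[OF crhom_const3])

lemma bforms_monom: "i \<le> n \<Longrightarrow> A ^ i * B ^ (n - i) \<in> bforms n A B"
proof -
  assume "i \<le> n"
  have "bform const3 n (\<lambda>j. if j = i then 1 else 0) A B = (\<Sum>j\<le>n. if j = i then A ^ i * B ^ (n - i) else 0)"
    unfolding bform_def by (intro sum.cong) (auto simp: crhom.homs[OF crhom_const3])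
  then have "A ^ i * B ^ (n - i) = bform const3 n (\<lambda>j. if j = i then 1 else 0) A B"
    using \<open>i \<le> n\<close> by simp
  then show ?thesis by (auto simp: bforms_def)
qed

lemma bforms_0: "0 \<in> bforms n A B"
  using bforms_const_mult[OF bforms_monom[of 0 n A B], of 0] by (simp add: crhom.homs[OF crhom_const3])

lemma bforms_sum: "(\<And>x. x \<in> S \<Longrightarrow> g x \<in> bforms n A B) \<Longrightarrow> sum g S \<in> bforms n A B"
  by (induction S rule: infinite_finite_induct) (auto intro: bforms_add bforms_0)

lemma bforms_mult: "P \<in> bforms n A B \<Longrightarrow> Q \<in> bforms m A B \<Longrightarrow> P * Q \<in> bforms (n + m) A B"
proof -
  assume "P \<in> bforms n A B" "Q \<in> bforms m A B"
  then obtain c c' where PQ: "P = bform const3 n c A B" "Q = bform const3 m c' A B" by (auto simp: bforms_def)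
  have "P * Q = (\<Sum>i\<le>n. \<Sum>j\<le>m. const3 (c i * c' j) * (A ^ (i + j) * B ^ (n + m - (i + j))))"
  proof -
    have "B ^ (n - i) * B ^ (m - j) = B ^ (n + m - (i + j))" if "i \<le> n" "j \<le> m" for i j
      using that by (simp flip: power_add)
    then show ?thesis unfolding PQ bform_def sum_product
      by (intro sum.cong refl) (simp add: crhom.homs[OF crhom_const3] power_add ac_simps)
  qed
  also have "\<dots> \<in> bforms (n + m) A B"
    by (intro bforms_sum bforms_const_mult bforms_monom) auto
  finally show ?thesis .
qed

lemma bforms_const: "const3 k \<in> bforms 0 A B"
  using bforms_const_mult[OF bforms_monom[of 0 0 A B], of k] by simp

lemma bforms_left: "A \<in> bforms 1 A B" and bforms_right: "B \<in> bforms 1 A B"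
  using bforms_monom[of 1 1 A B] bforms_monom[of 0 1 A B] by auto

lemma bforms_power: "P \<in> bforms n A B \<Longrightarrow> P ^ k \<in> bforms (n * k) A B"
proof (induction k)
  case 0
  then show ?case using bforms_const[of 1] by (simp add: crhom.homs[OF crhom_const3])
next
  case (Suc k)
  then show ?case using bforms_mult[of P n A B "P ^ k" "n * k"] by simp
qed

text \<open>A linear change of the two forms.\<close>

lemma bforms_change:
  assumes "C \<in> bforms 1 A B" "D \<in> bforms 1 A B"
  shows "bforms n C D \<subseteq> bforms n A B"
proof -
  have "const3 (c i) * C ^ i * D ^ (n - i) \<in> bforms n A B" if "i \<le> n" for c i
  proof -
    have "C ^ i * D ^ (n - i) \<in> bforms (1 * i + 1 * (n - i)) A B"
      by (intro bforms_mult bforms_power assms)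
    then have "C ^ i * D ^ (n - i) \<in> bforms n A B" using that by simp
    then show ?thesis using bforms_const_mult by (metis mult.assoc)
  qed
  then show ?thesis by (auto simp: bforms_def[of n C D] bform_def intro!: bforms_sum)
qed

lemma coeff_bform: "Polynomial.coeff (bform (\<lambda>c. [:c:]) n c [:0, 1:] 1) i = (if i \<le> n then c i else 0)"
proof -
  have "bform (\<lambda>c. [:c:]) n c [:0, 1:] 1 = (\<Sum>i\<le>n. Polynomial.monom (c i) i)"
    unfolding bform_def by (intro sum.cong refl) (simp add: monom_altdef)
  then show ?thesis by (simp add: coeff_sum)
qed

lemma degree_bform: "Polynomial.degree (bform (\<lambda>c. [:c:]) n c [:0, 1:] 1) \<le> n"
  by (rule degree_le) (simp add: coeff_bform)

lemma bform_eq_0D: "bform (\<lambda>c. [:c:]) n c [:0, 1:] 1 = 0 \<Longrightarrow> i \<le> n \<Longrightarrow> c i = 0"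
  using coeff_bform[of n c i] by simp

lemma bform_eq_pcompose:
  assumes "Polynomial.degree p \<le> n"
  shows "bform (\<lambda>c. [:c:]) n (Polynomial.coeff p) s 1 = pcompose p s"
proof -
  have "pcompose p s = (\<Sum>i\<le>Polynomial.degree p. [:Polynomial.coeff p i:] * s ^ i)"
    by (simp add: pcompose_altdef poly_altdef coeff_map_poly degree_map_poly)
  also have "\<dots> = (\<Sum>i\<le>n. [:Polynomial.coeff p i:] * s ^ i)"
    using assms by (intro sum.mono_neutral_left) (auto simp: coeff_eq_0)
  finally show ?thesis by (simp add: bform_def)
qed

lemma bform_coeff_X:
  "Polynomial.degree p \<le> n \<Longrightarrow> bform (\<lambda>c. [:c:]) n (Polynomial.coeff p) [:0, 1:] 1 = p"
  by (simp add: bform_eq_pcompose)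

lemma bform_as_pcompose:
  "bform (\<lambda>c. [:c:]) n c s 1 = pcompose (bform (\<lambda>c. [:c:]) n c [:0, 1:] 1) s"
proof -
  have "bform (\<lambda>c. [:c:]) n c s 1 =
    bform (\<lambda>c. [:c:]) n (Polynomial.coeff (bform (\<lambda>c. [:c:]) n c [:0, 1:] 1)) s 1"
    unfolding bform_def[of _ _ _ s] by (intro sum.cong) (auto simp: coeff_bform)
  then show ?thesis by (simp add: bform_eq_pcompose degree_bform)
qed

section \<open>Dehomogenization\<close>

text \<open>The form of degree \<open>n\<close> with coefficient \<open>c j i\<close> at \<open>X^i Y^j Z^(n-i-j)\<close>.\<close>

abbreviation (input) coeffs_form :: "nat \<Rightarrow> (nat \<Rightarrow> nat \<Rightarrow> 'k::comm_ring_1) \<Rightarrow> 'k poly3" where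
  "coeffs_form n c \<equiv> (\<Sum>j\<le>n. Y3 ^ j * bform const3 (n - j) (c j) X3 Z3)"

lemma homogeneous3_rep:
  assumes "homogeneous3 n G"
  obtains c where "G = coeffs_form n c"
proof -
  have "\<exists>c. G = coeffs_form n c"
    using assms
  proof (induction rule: homogeneous3_induct)
    case (const k)
    show ?case by (rule exI[of _ "\<lambda>_ _. k"]) (simp add: bform_def)
  next
    case (X n A)
    then obtain c where c: "A = coeffs_form n c" by blast
    have e: "X3 * bform const3 (n - j) (c j) X3 Z3 = bform const3 (Suc n - j) (case_nat 0 (c j)) X3 Z3"
      if "j \<le> n" for j
      using bform_Suc_left[of const3 "n - j" "c j" X3 Z3] that
      by (simp add: Suc_diff_le crhom.homs[OF crhom_const3])
    have "X3 * A = (\<Sum>j\<le>n. Y3 ^ j * (X3 * bform const3 (n - j) (c j) X3 Z3))"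
      by (simp add: c sum_distrib_left ac_simps)
    also have "\<dots> = (\<Sum>j\<le>n. Y3 ^ j * bform const3 (Suc n - j) (case_nat 0 (c j)) X3 Z3)"
      by (intro sum.cong refl) (simp add: e)
    also have "\<dots> = coeffs_form (Suc n) (\<lambda>j. if j \<le> n then case_nat 0 (c j) else (\<lambda>_. 0))"
      by (simp add: bform_def crhom.homs[OF crhom_const3])
    finally show ?case by (rule exI[of "\<lambda>c'. X3 * A = coeffs_form (Suc n) c'"])
  next
    case (Z n A)
    then obtain c where c: "A = coeffs_form n c" by blast
    have e: "Z3 * bform const3 (n - j) (c j) X3 Z3 = bform const3 (Suc n - j) (\<lambda>i. if i \<le> n - j then c j i else 0) X3 Z3"
      if "j \<le> n" for j
      using bform_Suc_right[of const3 "n - j" "c j" X3 Z3] that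
      by (simp add: Suc_diff_le crhom.homs[OF crhom_const3])
    have "Z3 * A = (\<Sum>j\<le>n. Y3 ^ j * (Z3 * bform const3 (n - j) (c j) X3 Z3))"
      by (simp add: c sum_distrib_left ac_simps)
    also have "\<dots> = (\<Sum>j\<le>n. Y3 ^ j * bform const3 (Suc n - j) (\<lambda>i. if i \<le> n - j then c j i else 0) X3 Z3)"
      by (intro sum.cong refl) (simp add: e)
    also have "\<dots> = coeffs_form (Suc n) (\<lambda>j. if j \<le> n then (\<lambda>i. if i \<le> n - j then c j i else 0) else (\<lambda>_. 0))"
      by (simp add: bform_def crhom.homs[OF crhom_const3])
    finally show ?case by (rule exI[of "\<lambda>c'. Z3 * A = coeffs_form (Suc n) c'"])
  next
    case (Y n A)
    then obtain c where c: "A = coeffs_form n c" by blast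
    have "coeffs_form (Suc n) (case_nat (\<lambda>_. 0) c) =
       (\<Sum>j\<le>n. Y3 ^ Suc j * bform const3 (n - j) (c j) X3 Z3)"
      unfolding sum.atMost_Suc_shift by (simp add: bform_def crhom.homs[OF crhom_const3])
    also have "\<dots> = Y3 * A" by (simp add: c sum_distrib_left ac_simps)
    finally have "Y3 * A = coeffs_form (Suc n) (case_nat (\<lambda>_. 0) c)" by (rule sym)
    then show ?case by (rule exI[of "\<lambda>c'. Y3 * A = coeffs_form (Suc n) c'"])
  next
    case (add n A B)
    then obtain c c' where c: "A = coeffs_form n c" "B = coeffs_form n c'" by blast
    have "A + B = coeffs_form n (\<lambda>j i. c j i + c' j i)"
      unfolding c sum.distrib[symmetric]
      by (intro sum.cong refl)
        (simp add: bform_def crhom.homs[OF crhom_const3] distrib_left distrib_right sum.distrib)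
    then show ?case by (rule exI[of "\<lambda>c'. A + B = coeffs_form n c'"])
  qed
  then show thesis using that by blast
qed

text \<open>\<open>G(X,Y,1)\<close> as a polynomial in \<open>Y\<close> over \<open>K[X]\<close>.\<close>

definition dehomY :: "'k::comm_ring_1 poly3 \<Rightarrow> 'k poly poly" where
  "dehomY G = eval3 (\<lambda>c. [:[:c:]:]) G [:[:0, 1:]:] [:0, 1:] 1"

text \<open>\<open>G(X,Y,1)\<close> as a polynomial in \<open>X\<close> over \<open>K[Y]\<close>.\<close>

definition dehomX :: "'k::comm_ring_1 poly3 \<Rightarrow> 'k poly poly" where
  "dehomX G = eval3 (\<lambda>c. [:[:c:]:]) G [:0, 1:] [:[:0, 1:]:] 1"

lemma crhom_lift2: "crhom (\<lambda>c. [:[:c:]:])"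
  by (rule crhom_comp[OF crhom_coeff_lift crhom_coeff_lift])

lemma crhom_dehomY: "crhom dehomY" and crhom_dehomX: "crhom dehomX"
  unfolding dehomY_def dehomX_def by (rule crhom_eval3[OF crhom_lift2])+

lemma dehomY_simps:
  "dehomY (const3 c) = [:[:c:]:]" "dehomY X3 = [:[:0, 1:]:]" "dehomY Y3 = [:0, 1:]" "dehomY Z3 = 1"
  by (simp_all add: dehomY_def eval3_simps[OF crhom_lift2])

lemma dehomX_simps:
  "dehomX (const3 c) = [:[:c:]:]" "dehomX X3 = [:0, 1:]" "dehomX Y3 = [:[:0, 1:]:]" "dehomX Z3 = 1"
  by (simp_all add: dehomX_def eval3_simps[OF crhom_lift2])

lemmas bform_lift = hom_bform[OF crhom_coeff_lift, symmetric]

lemma lift_one: "(1 :: 'k::comm_ring_1 poly poly) = [:1:]"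
  by (simp add: one_pCons)

lemma bform_lift_XZ:
  "bform (\<lambda>c. [:[:c:]:]) n c [:a:] [:b:] = [:bform (\<lambda>c. [:c:]) n c a b:]"
  by (simp add: bform_lift)

lemma dehomY_XZ: "dehomY (bform const3 n c X3 Z3) = [:bform (\<lambda>c. [:c:]) n c [:0, 1:] 1:]"
  by (simp add: hom_bform[OF crhom_dehomY] dehomY_simps bform_lift_XZ[symmetric] lift_one[symmetric])

lemma dehomX_YZ: "dehomX (bform const3 n c Y3 Z3) = [:bform (\<lambda>c. [:c:]) n c [:0, 1:] 1:]"
  by (simp add: hom_bform[OF crhom_dehomX] dehomX_simps bform_lift_XZ[symmetric] lift_one[symmetric])

lemma dehomY_rep:
  "dehomY (coeffs_form n c) =
     bform (\<lambda>p. [:p:]) n (\<lambda>j. bform (\<lambda>c. [:c:]) (n - j) (c j) [:0, 1:] 1) [:0, 1:] 1"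
  unfolding bform_def[of _ n]
  by (simp add: crhom.homs[OF crhom_dehomY] dehomY_simps dehomY_XZ mult.commute)

lemma dehomY_inj:
  assumes "homogeneous3 n G" "dehomY G = 0"
  shows "G = 0"
proof -
  obtain c where G: "G = coeffs_form n c" using assms(1) by (rule homogeneous3_rep)
  have "bform (\<lambda>c. [:c:]) (n - j) (c j) [:0, 1:] 1 = 0" if "j \<le> n" for j
    using bform_eq_0D[OF assms(2)[unfolded G dehomY_rep] that] .
  then have "c j i = 0" if "j \<le> n" "i \<le> n - j" for i j
    using bform_eq_0D[of "n - j" "c j" i] that by blast
  then show ?thesis unfolding G by (simp add: bform_def crhom.homs[OF crhom_const3])
qed

lemma dehomY_eqD:
  assumes "homogeneous3 n G" "homogeneous3 n H" "dehomY G = dehomY H"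
  shows "G = H"
  using dehomY_inj[OF homogeneous3_diff[OF assms(1,2)]] assms(3)
  by (simp add: crhom.homs[OF crhom_dehomY])

lemma degree_dehomX:
  fixes c :: "nat \<Rightarrow> nat \<Rightarrow> 'k::field"
  assumes "c 0 d \<noteq> 0"
  shows "Polynomial.degree (dehomX (coeffs_form d c)) = d"
proof -
  have e: "bform (\<lambda>c. [:[:c:]:]) n a [:0, 1:] 1 = bform (\<lambda>c. [:c:]) n (\<lambda>i. [:a i:]) [:0, 1:] 1"
    for n and a :: "nat \<Rightarrow> 'k" by (simp add: bform_def)
  have D: "dehomX (coeffs_form d c) =
    (\<Sum>j\<le>d. [:[:0, 1:] ^ j:] * bform (\<lambda>c. [:c:]) (d - j) (\<lambda>i. [:c j i:]) [:0, 1:] 1)"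
    unfolding crhom.hom_power[OF crhom_coeff_lift, of "[:0, 1:]"]
    by (simp add: crhom.homs[OF crhom_dehomX] hom_bform[OF crhom_dehomX] dehomX_simps e)
  have co: "Polynomial.coeff (dehomX (coeffs_form d c)) i =
     (\<Sum>j\<le>d. [:0, 1:] ^ j * (if i \<le> d - j then [:c j i:] else 0))" for i
    unfolding D by (simp add: coeff_sum coeff_bform)
  show ?thesis
  proof (rule antisym)
    show "Polynomial.degree (dehomX (coeffs_form d c)) \<le> d"
      by (rule degree_le) (auto simp: co intro!: sum.neutral)
    have "Polynomial.coeff (dehomX (coeffs_form d c)) d = (\<Sum>j\<le>d. if j = 0 then [:c 0 d:] else 0)"
      unfolding co by (intro sum.cong) auto
    then show "d \<le> Polynomial.degree (dehomX (coeffs_form d c))"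
      using assms by (intro le_degree) simp
  qed
qed

section \<open>Rational substitutions that preserve the curve are affine\<close>

text \<open>The ring \<open>K[X]\<close> is integrally closed: each root of the denominator \<open>b\<close> is a root of \<open>a\<close> and cancels.\<close>

lemma dvd_of_integral:
  fixes a b q :: "'k::alg_closed_field poly"
  assumes "n \<ge> 1" "c n \<noteq> 0" "b \<noteq> 0" "bform (\<lambda>c. [:c:]) n c a b = b ^ n * q"
  shows "b dvd a"
  using assms(3,4)
proof (induction "Polynomial.degree b" arbitrary: a b rule: less_induct)
  case less
  show ?case
  proof (cases "Polynomial.degree b = 0")
    case True
    then have "is_unit b" using less.prems(1) by (simp add: is_unit_iff_degree)
    then show ?thesis by (rule unit_imp_dvd)
  next
    case False
    then obtain r where r: "poly b r = 0" using alg_closed_imp_poly_has_root[of b] by auto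
    then obtain b' where b': "b = [:- r, 1:] * b'" by (metis poly_eq_0_iff_dvd dvdE)
    have ev: "crhom (\<lambda>p. poly p r)" by unfold_locales auto
    have "bform (\<lambda>c. c) n c (poly a r) 0 = poly (bform (\<lambda>c. [:c:]) n c a b) r"
      using hom_bform[OF ev, of "\<lambda>c. [:c:]" n c a b] r by simp
    also have "\<dots> = 0" using r assms(1) by (simp add: less.prems(2))
    finally have "poly a r = 0" using assms(1,2) by (simp add: bform_at_0)
    then obtain a' where a': "a = [:- r, 1:] * a'" by (metis poly_eq_0_iff_dvd dvdE)
    have nz: "b' \<noteq> 0" using b' less.prems(1) by auto
    have "[:- r, 1:] ^ n * bform (\<lambda>c. [:c:]) n c a' b' = [:- r, 1:] ^ n * (b' ^ n * q)"
      using less.prems(2) unfolding a' b' bform_scale power_mult_distrib by (simp only: mult.assoc)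
    then have eq: "bform (\<lambda>c. [:c:]) n c a' b' = b' ^ n * q" by simp
    have "Polynomial.degree b = Suc (Polynomial.degree b')"
      unfolding b' using nz by (subst degree_mult_eq) auto
    then have "b' dvd a'" using less.hyps[OF _ nz eq] by simp
    then show ?thesis unfolding a' b' by (rule mult_dvd_mono[OF dvd_refl])
  qed
qed

text \<open>If \<open>X \<mapsto> A/B\<close>, with forms \<open>A\<close> and \<open>B\<close> in \<open>X\<close> and \<open>Z\<close>, preserves a curve that contains neither
  \<open>(1:0:0)\<close> nor \<open>(0:1:0)\<close>, then \<open>A/B\<close> is affine.\<close>

lemma affine_of_invariant:
  fixes c :: "nat \<Rightarrow> nat \<Rightarrow> 'k::alg_closed_field" and d :: nat
  defines "F \<equiv> coeffs_form d c"
  assumes d: "d \<ge> 1" and c: "c 0 d \<noteq> 0" "c d 0 \<noteq> 0"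
    and B: "B = bform const3 n \<beta> X3 Z3" "B \<noteq> 0" and A: "A = bform const3 n \<alpha> X3 Z3"
    and dvd: "F dvd subst3 (A * Z3) (B * Y3) (B * Z3) F"
  obtains s where "Polynomial.degree s = 1"
    "\<And>j. j \<le> d \<Longrightarrow> pcompose (Polynomial.coeff (dehomY F) j) s = Polynomial.coeff (dehomY F) j"
    "A * Z3 = B * bform const3 1 (Polynomial.coeff s) X3 Z3"
proof -
  define p where "p j = bform (\<lambda>c. [:c:]) (d - j) (c j) [:0, 1:] 1" for j
  define a where "a = bform (\<lambda>c. [:c:]) n \<alpha> [:0, 1:] 1"
  define b where "b = bform (\<lambda>c. [:c:]) n \<beta> [:0, 1:] 1"
  have dA: "dehomY A = [:a:]" and dB: "dehomY B = [:b:]" by (simp_all add: A B a_def b_def dehomY_XZ)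
  have "homogeneous3 n B" unfolding B by (intro homogeneous3_bform homogeneous3_vars)
  then have b0: "b \<noteq> 0" using dehomY_inj B(2) dB by (metis pCons_0_0)
  have dF: "dehomY F = bform (\<lambda>p. [:p:]) d p [:0, 1:] 1"
    unfolding F_def dehomY_rep p_def ..
  have coF: "Polynomial.coeff (dehomY F) j = p j" if "j \<le> d" for j using that by (simp add: dF coeff_bform)
  let ?R = "subst3 (A * Z3) (B * Y3) (B * Z3) F"
  define r where "r j = b ^ j * bform (\<lambda>c. [:c:]) (d - j) (c j) a b" for j
  have "?R = (\<Sum>j\<le>d. (B * Y3) ^ j * bform const3 (d - j) (c j) (A * Z3) (B * Z3))"
    unfolding F_def by (simp add: crhom.homs[OF crhom_subst3] hom_bform[OF crhom_subst3] subst3_simps)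
  then have "dehomY ?R = (\<Sum>j\<le>d. ([:b:] * [:0, 1:]) ^ j * [:bform (\<lambda>c. [:c:]) (d - j) (c j) a b:])"
    by (simp add: crhom.homs[OF crhom_dehomY] hom_bform[OF crhom_dehomY] dehomY_simps dA dB bform_lift_XZ)
  also have "\<dots> = bform (\<lambda>p. [:p:]) d r [:0, 1:] 1"
    unfolding bform_def[of _ d r]
  proof (rule sum.cong[OF refl])
    fix j
    show "([:b:] * [:0, 1:]) ^ j * [:bform (\<lambda>c. [:c:]) (d - j) (c j) a b:] = [:r j:] * [:0, 1:] ^ j * 1 ^ (d - j)"
      unfolding r_def power_mult_distrib crhom.homs(7)[OF crhom_coeff_lift, symmetric]
      by (simp add: crhom.homs(4)[OF crhom_coeff_lift, symmetric] mult.commute)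
  qed
  finally have dR: "dehomY ?R = bform (\<lambda>p. [:p:]) d r [:0, 1:] 1" .
  have pd: "p d = [:c d 0:]" by (simp add: p_def bform_def)
  have degF: "Polynomial.degree (dehomY F) = d"
    by (rule antisym) (auto simp: dF degree_bform coeff_bform pd c intro!: le_degree)
  \<comment> \<open>\<open>F\<close> has a constant leading coefficient in \<open>Y\<close>, so the quotient by \<open>F\<close> does not involve \<open>Y\<close>;
     comparing the coefficients of \<open>Y^d\<close> identifies it as \<open>b^d\<close>.\<close>
  obtain q where q: "dehomY ?R = dehomY F * q"
    using crhom.hom_dvd[OF crhom_dehomY dvd] by (rule dvdE)
  have "Polynomial.degree q = 0"
  proof (cases "q = 0")
    case False
    have "Polynomial.degree (dehomY F * q) \<le> d" unfolding q[symmetric] dR by (rule degree_bform)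
    moreover have "dehomY F \<noteq> 0" using degF d by auto
    ultimately show ?thesis using False degF by (simp add: degree_mult_eq)
  qed simp
  then obtain q0 where q0: "q = [:q0:]" by (rule degree_eq_zeroE)
  have rp: "r j = q0 * p j" if "j \<le> d" for j
  proof -
    have "r j = Polynomial.coeff (dehomY ?R) j" using that by (simp add: dR coeff_bform)
    also have "\<dots> = q0 * p j" unfolding q q0 using that by (simp add: coF mult.commute)
    finally show ?thesis .
  qed
  have "r d = b ^ d * [:c d 0:]" by (simp add: r_def bform_def)
  then have "q0 * [:c d 0:] = b ^ d * [:c d 0:]" using rp[of d] by (simp only: pd order_refl)
  then have q0b: "q0 = b ^ d" unfolding mult_cancel_right using c(2) by simp
  \<comment> \<open>The coefficients of \<open>Y^0\<close> show that \<open>a/b\<close> is integral over \<open>K[X]\<close>.\<close>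
  have "bform (\<lambda>c. [:c:]) d (c 0) a b = b ^ d * p 0" using rp[of 0] by (simp add: r_def q0b)
  then have "b dvd a" by (intro dvd_of_integral[OF d _ b0]) (use c in auto)
  then obtain s where s: "a = b * s" by (rule dvdE)
  have "pcompose (p j) s = p j" if "j \<le> d" for j
  proof -
    have "b ^ d * pcompose (p j) s = b ^ j * (b ^ (d - j) * bform (\<lambda>c. [:c:]) (d - j) (c j) s 1)"
      using that by (simp add: p_def bform_as_pcompose[of _ _ s] flip: power_add mult.assoc)
    also have "\<dots> = r j" using bform_scale[of "\<lambda>c. [:c:]" "d - j" "c j" b s 1] by (simp add: r_def s)
    also have "\<dots> = b ^ d * p j" using rp[OF that] by (simp add: q0b)
    finally show ?thesis using b0 by simp
  qed
  note inv = this
  have "Polynomial.degree (p 0) = d"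
  proof (rule antisym)
    show "Polynomial.degree (p 0) \<le> d" using degree_bform[of d "c 0"] by (simp add: p_def)
    show "d \<le> Polynomial.degree (p 0)" using c by (intro le_degree) (simp add: p_def coeff_bform)
  qed
  then have ds: "Polynomial.degree s = 1"
    using arg_cong[OF inv[of 0], of Polynomial.degree] d by (simp add: degree_pcompose)
  show thesis
  proof (rule that[OF ds])
    show "pcompose (Polynomial.coeff (dehomY F) j) s = Polynomial.coeff (dehomY F) j" if "j \<le> d" for j
      using inv that coF by simp
    show "A * Z3 = B * bform const3 1 (Polynomial.coeff s) X3 Z3"
    proof (rule dehomY_eqD[of "n + 1"])
      show "homogeneous3 (n + 1) (A * Z3)" "homogeneous3 (n + 1) (B * bform const3 1 (Polynomial.coeff s) X3 Z3)"
        unfolding A B by (intro homogeneous3_mult homogeneous3_bform homogeneous3_vars)+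
      have "bform (\<lambda>c. [:c:]) 1 (Polynomial.coeff s) [:0, 1:] 1 = s" using ds by (intro bform_coeff_X) simp
      then show "dehomY (A * Z3) = dehomY (B * bform const3 1 (Polynomial.coeff s) X3 Z3)"
        by (simp add: crhom.homs[OF crhom_dehomY] dA dB dehomY_simps dehomY_XZ s mult.commute)
    qed
  qed
qed

text \<open>A nonconstant polynomial \<open>q(x)\<close> of degree less than \<open>d\<close> is not an element \<open>\<alpha>/\<beta>\<close> of \<open>K(y)\<close> in the
  function field: clearing denominators would give a nonzero multiple of \<open>F\<close> of degree less than \<open>d\<close> in
  \<open>X\<close>.\<close>

lemma no_relation_of_small_degree:
  fixes c :: "nat \<Rightarrow> nat \<Rightarrow> 'k::field"
  assumes "c 0 d \<noteq> 0" "0 < m" "m < d" "q m \<noteq> 0" "bform const3 n \<beta> Y3 Z3 \<noteq> 0"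
  shows "\<not> coeffs_form d c dvd bform const3 m q X3 Z3 * bform const3 n \<beta> Y3 Z3
           - bform const3 n \<alpha> Y3 Z3 * Z3 ^ m"
proof
  let ?r = "bform const3 m q X3 Z3 * bform const3 n \<beta> Y3 Z3 - bform const3 n \<alpha> Y3 Z3 * Z3 ^ m"
  assume "coeffs_form d c dvd ?r"
  then have dvd: "dehomX (coeffs_form d c) dvd dehomX ?r" by (rule crhom.hom_dvd[OF crhom_dehomX])
  define a where "a = bform (\<lambda>c. [:c:]) n \<alpha> [:0, 1:] 1"
  define b where "b = bform (\<lambda>c. [:c:]) n \<beta> [:0, 1:] 1"
  have "b \<noteq> 0"
  proof
    assume "b = 0"
    then have "bform const3 n \<beta> Y3 Z3 = 0"
      using bform_eq_0D[of n \<beta>] by (simp add: b_def bform_def crhom.homs[OF crhom_const3])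
    then show False using assms by simp
  qed
  have "dehomX (bform const3 m q X3 Z3) = bform (\<lambda>c. [:c:]) m (\<lambda>i. [:q i:]) [:0, 1:] 1"
    by (simp add: hom_bform[OF crhom_dehomX] dehomX_simps) (simp add: bform_def)
  then have r: "dehomX ?r = bform (\<lambda>c. [:c:]) m (\<lambda>i. [:q i:]) [:0, 1:] 1 * [:b:] - [:a:]"
    by (simp add: crhom.homs[OF crhom_dehomX] dehomX_simps dehomX_YZ a_def b_def)
  have co: "Polynomial.coeff (dehomX ?r) i = (if i \<le> m then [:q i:] else 0) * b - (if i = 0 then a else 0)" for i
    unfolding r by (simp add: coeff_bform coeff_pCons mult.commute split: nat.splits)
  have "Polynomial.coeff (dehomX ?r) m \<noteq> 0" using assms \<open>b \<noteq> 0\<close> by (simp add: co)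
  then have nz: "dehomX ?r \<noteq> 0" by auto
  have "Polynomial.degree (dehomX ?r) \<le> m" by (rule degree_le) (use assms in \<open>auto simp: co\<close>)
  moreover have "d \<le> Polynomial.degree (dehomX ?r)"
    using dvd_imp_degree_le[OF dvd nz] degree_dehomX[of c d, OF assms(1)] by simp
  ultimately show False using assms by simp
qed

text \<open>Suppose that all invariants of degree less than \<open>d\<close> of a set of affine substitutions are
  constant. From an invariant \<open>p\<close> of degree \<open>d\<close> subtract the multiple \<open>c (T + v)^d\<close> of a \<open>d\<close>-th power that matches
  its two leading coefficients; this needs that \<open>d\<close> is nonzero in the field. The difference has
  degree at most \<open>d - 2\<close> and turns out to be invariant, hence is constant.\<close>

lemma power_of_invariant:
  fixes p :: "'k::field poly"
  assumes d: "d \<ge> 2" "of_nat d \<noteq> (0::'k)" and p: "Polynomial.degree p = d"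
    and deg1: "\<And>s. s \<in> \<Gamma> \<Longrightarrow> Polynomial.degree s = 1"
    and inv: "\<And>s. s \<in> \<Gamma> \<Longrightarrow> pcompose p s = p"
    and small: "\<And>q. (\<And>s. s \<in> \<Gamma> \<Longrightarrow> pcompose q s = q) \<Longrightarrow> Polynomial.degree q < d \<Longrightarrow> Polynomial.degree q = 0"
  obtains c v e where "c \<noteq> 0" "p = Polynomial.smult c ([:v, 1:] ^ d) + [:e:]"
proof -
  define c where "c = Polynomial.coeff p d"
  define v where "v = Polynomial.coeff p (d - 1) / (of_nat d * c)"
  define l where "l = [:v, 1:] ^ d"
  define q where "q = p - Polynomial.smult c l"
  have c0: "c \<noteq> 0" using p d by (auto simp: c_def)
  have low: "Polynomial.degree t < d - 1" if "Polynomial.degree t \<le> d" "Polynomial.coeff t d = 0" "Polynomial.coeff t (d - 1) = 0" for t :: "'k poly"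
  proof -
    have "Polynomial.coeff t i = 0" if "i > d - 2" for i
    proof -
      consider "i = d - 1" | "i = d" | "i > d" using \<open>i > d - 2\<close> by linarith
      then show ?thesis using \<open>Polynomial.degree t \<le> d\<close> \<open>Polynomial.coeff t d = 0\<close> \<open>Polynomial.coeff t (d - 1) = 0\<close>
        by cases (auto simp: coeff_eq_0)
    qed
    then have "Polynomial.degree t \<le> d - 2" by (intro degree_le) auto
    then show ?thesis using d by simp
  qed
  have ld: "Polynomial.degree l = d" by (simp add: l_def degree_linear_power)
  have lc: "Polynomial.coeff ([:x, y:] ^ d) d = y ^ d" "Polynomial.coeff ([:x, y:] ^ d) (d - 1) = of_nat d * y ^ (d - 1) * x"
    for x y :: 'k
    using d binomial_symmetric[of 1 d] by (simp_all add: coeff_linear_poly_power)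
  have q: "Polynomial.degree q < d - 1"
  proof (rule low)
    show "Polynomial.degree q \<le> d" unfolding q_def using p ld by (intro degree_diff_le) auto
    show "Polynomial.coeff q d = 0" by (simp add: q_def l_def lc c_def)
    show "Polynomial.coeff q (d - 1) = 0" using c0 d(2) lc(2)[of v 1] by (simp add: q_def l_def) (simp add: v_def)
  qed
  have "pcompose q s = q" if s: "s \<in> \<Gamma>" for s
  proof -
    obtain \<beta> \<alpha> where sab: "s = [:\<beta>, \<alpha>:]" "\<alpha> \<noteq> 0"
      using deg1[OF s] by (cases s, rename_tac b s', case_tac s') (auto split: if_splits)
    have pch: "crhom (\<lambda>t. pcompose t s)"
      by unfold_locales (simp_all add: pcompose_add pcompose_mult pcompose_1)
    have ls: "pcompose l s = [:v + \<beta>, \<alpha>:] ^ d"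
      unfolding l_def crhom.hom_power[OF pch] by (simp add: sab pcompose_pCons)
    have diff: "Polynomial.smult c (pcompose l s - l) = q - pcompose q s"
      using inv[OF s] by (simp add: q_def pcompose_diff pcompose_smult smult_diff_right)
    have dq: "Polynomial.degree (q - pcompose q s) < d - 1"
      by (rule degree_diff_less) (use q deg1[OF s] in \<open>simp_all add: degree_pcompose\<close>)
    have "Polynomial.coeff (Polynomial.smult c (pcompose l s - l)) i = 0" if "i \<ge> d - 1" for i
      unfolding diff using dq that by (intro coeff_eq_0) simp
    then have co: "Polynomial.coeff (pcompose l s) i = Polynomial.coeff l i" if "i \<ge> d - 1" for i
      using that c0 by (simp add: algebra_simps)
    \<comment> \<open>\<open>q\<close> is too small to affect the two leading coefficients, which force \<open>s\<close> to fix \<open>T = - v\<close>.\<close>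
    have a1: "\<alpha> ^ d = 1" using co[of d] unfolding ls unfolding l_def lc by simp
    have a2: "\<alpha> ^ (d - 1) * (v + \<beta>) = v" using co[of "d - 1"] d(2) unfolding ls unfolding l_def lc by simp
    have "\<alpha> * v = \<alpha> * \<alpha> ^ (d - 1) * (v + \<beta>)" using a2 by (simp add: mult.assoc)
    also have "\<alpha> * \<alpha> ^ (d - 1) = 1" using a1 d by (simp flip: power_Suc)
    finally have "[:v + \<beta>, \<alpha>:] = Polynomial.smult \<alpha> [:v, 1:]" by simp
    then have "pcompose l s = l" unfolding ls unfolding l_def by (simp only: smult_power a1 smult_1_left)
    then show ?thesis using diff by simp
  qed
  then have "Polynomial.degree q = 0" using q by (intro small) auto
  then obtain e where "q = [:e:]" by (rule degree_eq_zeroE)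
  then have "p = Polynomial.smult c ([:v, 1:] ^ d) + [:e:]" by (simp add: q_def l_def algebra_simps)
  then show thesis using that c0 by blast
qed

section \<open>Frames\<close>

text \<open>Linear forms \<open>U\<close>, \<open>V\<close>, \<open>W\<close> that are homogeneous coordinates of the plane, together with
  the change of variables \<open>\<phi>\<close> that turns them into \<open>X\<close>, \<open>Y\<close>, \<open>Z\<close>.\<close>

locale frame =
  fixes U V W :: "'k::field poly3" and \<phi> :: "'k poly3 \<Rightarrow> 'k poly3"
  assumes phi_hom: "crhom \<phi>"
    and phi_const: "\<phi> (const3 c) = const3 c"
    and phi_homogeneous: "homogeneous3 n G \<Longrightarrow> homogeneous3 n (\<phi> G)"
    and phi_U: "\<phi> U = X3" and phi_V: "\<phi> V = Y3" and phi_W: "\<phi> W = Z3"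
    and subst_phi: "subst3 U V W (\<phi> G) = G"
    and homogeneous_UVW: "homogeneous3 1 U" "homogeneous3 1 V" "homogeneous3 1 W"
begin

lemma phi_subst: "\<phi> (subst3 A B C G) = subst3 (\<phi> A) (\<phi> B) (\<phi> C) G"
  by (rule hom_subst3[OF phi_hom phi_const])

lemma subst3_XYZ: "subst3 X3 Y3 Z3 G = G"
  by (rule poly3_hom_ext[OF crhom_subst3 crhom_id]) (simp_all add: subst3_simps)

lemma phi_subst_UVW: "\<phi> (subst3 U V W G) = G"
  by (simp add: phi_subst phi_U phi_V phi_W subst3_XYZ)

lemma phi_dvd_iff: "\<phi> A dvd \<phi> B \<longleftrightarrow> A dvd B"
proof
  assume "\<phi> A dvd \<phi> B"
  then have "subst3 U V W (\<phi> A) dvd subst3 U V W (\<phi> B)" by (rule crhom.hom_dvd[OF crhom_subst3])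
  then show "A dvd B" by (simp add: subst_phi)
qed (rule crhom.hom_dvd[OF phi_hom])

lemma phi_inj: "\<phi> A = \<phi> B \<Longrightarrow> A = B"
  by (metis subst_phi)

lemma phi_bform: "\<phi> (bform const3 n c A B) = bform const3 n c (\<phi> A) (\<phi> B)"
  by (simp add: hom_bform[OF phi_hom] phi_const)

lemma frame_swap: "frame V U W (\<lambda>G. subst3 Y3 X3 Z3 (\<phi> G))"
proof
  show "subst3 V U W (subst3 Y3 X3 Z3 (\<phi> G)) = G" for G
  proof -
    have "subst3 V U W (subst3 Y3 X3 Z3 H) = subst3 U V W H" for H
      by (rule poly3_hom_ext[of "\<lambda>H. subst3 V U W (subst3 Y3 X3 Z3 H)"])
        (simp_all add: crhom_comp[OF crhom_subst3 crhom_subst3] crhom_subst3 subst3_simps)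
    then show ?thesis by (simp add: subst_phi)
  qed
  show "homogeneous3 n (subst3 Y3 X3 Z3 (\<phi> G))" if "homogeneous3 n G" for n G
    by (intro homogeneous3_subst3_1 homogeneous3_vars phi_homogeneous that)
  show "homogeneous3 1 V" "homogeneous3 1 U" "homogeneous3 1 W" by (rule homogeneous_UVW)+
qed (simp_all add: crhom.homs[OF crhom_subst3] crhom.homs[OF phi_hom] phi_const subst3_simps
      phi_U phi_V phi_W)

end

text \<open>The subfield \<open>K(A/B)\<close> of the function field, for linear forms \<open>A\<close> and \<open>B\<close>.\<close>

definition bfrac :: "'k::field poly3 \<Rightarrow> 'k poly3 \<Rightarrow> 'k poly3 \<Rightarrow> ('k poly3 \<times> 'k poly3) set set" where
  "bfrac F A B = {frac F P Q | n P Q. P \<in> bforms n A B \<and> Q \<in> bforms n A B \<and> \<not> F dvd Q}"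

lemma bfracI: "P \<in> bforms n A B \<Longrightarrow> Q \<in> bforms n A B \<Longrightarrow> \<not> F dvd Q \<Longrightarrow> frac F P Q \<in> bfrac F A B"
  by (auto simp: bfrac_def)

text \<open>A prime form of degree \<open>d\<close> in a frame, such that the curve contains neither of the points
  with \<open>V = W = 0\<close> and with \<open>U = W = 0\<close>.\<close>

locale outer_frame = prime_curve F + frame U V W \<phi>
  for F U V W :: "'k::field poly3" and \<phi> :: "'k poly3 \<Rightarrow> 'k poly3" +
  fixes d :: nat
  assumes homogeneous_F: "homogeneous3 d F"
    and d_pos: "d > 0"
    and outer_U: "eval3 (\<lambda>c. c) (\<phi> F) 1 0 0 \<noteq> 0"
    and outer_V: "eval3 (\<lambda>c. c) (\<phi> F) 0 1 0 \<noteq> 0"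
begin

lemma outer_frame_swap: "outer_frame F V U W (\<lambda>G. subst3 Y3 X3 Z3 (\<phi> G)) d"
proof -
  interpret s: frame V U W "\<lambda>G. subst3 Y3 X3 Z3 (\<phi> G)" by (rule frame_swap)
  have "eval3 (\<lambda>c. c) (subst3 Y3 X3 Z3 H) a b e = eval3 (\<lambda>c. c) H b a e" for H :: "'k poly3" and a b e
    by (rule poly3_hom_ext[of "\<lambda>H. eval3 (\<lambda>c. c) (subst3 Y3 X3 Z3 H) a b e"])
      (simp_all add: crhom_comp[OF crhom_eval3[OF crhom_id] crhom_subst3] crhom_eval3[OF crhom_id]
        eval3_simps[OF crhom_id] subst3_simps)
  then show ?thesis
    by unfold_locales (simp_all add: homogeneous_F d_pos outer_U outer_V)
qed

lemma phi_F_rep: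
  obtains c where "\<phi> F = coeffs_form d c" "c 0 d \<noteq> 0" "c d 0 \<noteq> 0"
proof -
  obtain c where c: "\<phi> F = coeffs_form d c"
    using phi_homogeneous[OF homogeneous_F] by (rule homogeneous3_rep)
  have e: "eval3 (\<lambda>c. c) (\<phi> F) a b 0 = (\<Sum>j\<le>d. b ^ j * (c j (d - j) * a ^ (d - j)))" for a b :: 'k
    unfolding c by (simp add: crhom.homs[OF crhom_eval3[OF crhom_id]]
      hom_bform[OF crhom_eval3[OF crhom_id]] eval3_simps[OF crhom_id] bform_at_0)
  have "eval3 (\<lambda>c. c) (\<phi> F) 1 0 0 = (\<Sum>j\<le>d. if j = 0 then c 0 d else 0)"
    unfolding e by (intro sum.cong) auto
  then have 1: "c 0 d \<noteq> 0" using outer_U by simp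
  have "eval3 (\<lambda>c. c) (\<phi> F) 0 1 0 = (\<Sum>j\<le>d. if j = d then c d 0 else 0)"
    unfolding e by (intro sum.cong) (auto simp: power_0_left)
  then have 2: "c d 0 \<noteq> 0" using outer_V by simp
  show thesis using that c 1 2 .
qed

lemma not_dvd_VW: "\<not> F dvd V" "\<not> F dvd W"
proof -
  obtain c where c: "\<phi> F = coeffs_form d c" "c 0 d \<noteq> 0" by (rule phi_F_rep)
  have deg: "Polynomial.degree (dehomX (\<phi> F)) = d" unfolding c(1) by (rule degree_dehomX) (rule c(2))
  have *: "\<not> F dvd G" if "Polynomial.degree (dehomX (\<phi> G)) = 0" "dehomX (\<phi> G) \<noteq> 0" for G
  proof
    assume "F dvd G"
    then have "dehomX (\<phi> F) dvd dehomX (\<phi> G)"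
      by (intro crhom.hom_dvd[OF crhom_dehomX] crhom.hom_dvd[OF phi_hom])
    then show False using dvd_imp_degree_le[OF _ that(2)] that(1) deg d_pos by force
  qed
  show "\<not> F dvd V" "\<not> F dvd W"
    by (rule *; simp add: phi_V phi_W dehomX_simps)+
qed

lemma fun_pairs_subst:
  assumes "homogeneous3 n G" "homogeneous3 m A" "homogeneous3 m B" "homogeneous3 m C" "\<not> F dvd C"
  shows "(subst3 A B C G, C ^ n) \<in> FP"
proof (rule fun_pairsI)
  show "homogeneous3 (n * m) (subst3 A B C G)" by (rule homogeneous3_subst3[OF assms(1-4)])
  show "homogeneous3 (n * m) (C ^ n)" using homogeneous3_power[OF assms(4), of n] by (simp add: mult.commute)
  show "\<not> F dvd C ^ n" by (rule not_dvd_power[OF assms(5)])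
qed

text \<open>An automorphism over \<open>K\<close> is determined by its values \<open>A/C\<close> at \<open>U/W\<close> and \<open>B/C\<close> at \<open>V/W\<close>.\<close>

lemma aut_subst:
  assumes s: "\<sigma> \<in> field_auts E L" and L: "constants F \<subseteq> L"
    and sx: "\<sigma> (frac F U W) = frac F A C" and sy: "\<sigma> (frac F V W) = frac F B C"
    and h: "homogeneous3 m A" "homogeneous3 m B" "homogeneous3 m C" and C: "\<not> F dvd C"
    and G: "homogeneous3 n G"
  shows "\<sigma> (frac F (subst3 U V W G) (W ^ n)) = frac F (subst3 A B C G) (C ^ n)"
proof -
  note a = field_auts_hom[OF s]
  note p1 = fun_pairs_subst[OF _ homogeneous_UVW not_dvd_VW(2)]
  note p2 = fun_pairs_subst[OF _ h C]
  have pU: "(U, W) \<in> FP" "(V, W) \<in> FP" "(W, W) \<in> FP"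
    using homogeneous_UVW not_dvd_VW by (auto intro: fun_pairsI)
  have pA: "(A, C) \<in> FP" "(B, C) \<in> FP" "(C, C) \<in> FP"
    using h C by (auto intro: fun_pairsI)
  have mul: "\<sigma> (frac F (P * Q) (W * W ^ n)) = frac F (P' * Q') (C * C ^ n)"
    if "\<sigma> (frac F P W) = frac F P' C" "\<sigma> (frac F Q (W ^ n)) = frac F Q' (C ^ n)"
      "(P, W) \<in> FP" "(P', C) \<in> FP" "(Q, W ^ n) \<in> FP" "(Q', C ^ n) \<in> FP" for P Q P' Q' n
    using that a(2)[of "frac F P W" "frac F Q (W ^ n)"] by (simp add: mult_frac frac_closed)
  have one: "frac F W W = \<one>\<^bsub>E\<^esub>" "frac F C C = \<one>\<^bsub>E\<^esub>"
    using pU pA by (auto simp: one_frac frac_eq_iff fun_pairs_1)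
  show ?thesis using G
  proof (induction rule: homogeneous3_induct)
    case (const c)
    have "frac F (const3 c) 1 \<in> L" using L by (auto simp: constants_def)
    then show ?case using a(6) by (simp add: subst3_simps)
  next
    case (X n G)
    then show ?case by (simp add: crhom.homs[OF crhom_subst3] subst3_simps mul sx pU pA p1 p2)
  next
    case (Y n G)
    then show ?case by (simp add: crhom.homs[OF crhom_subst3] subst3_simps mul sy pU pA p1 p2)
  next
    case (Z n G)
    then show ?case by (simp add: crhom.homs[OF crhom_subst3] subst3_simps mul one a(4) pU pA p1 p2)
  next
    case (add n G H)
    let ?G = "subst3 U V W G" and ?H = "subst3 U V W H"
    have e: "frac F (?G + ?H) (W ^ n) = frac F ?G (W ^ n) \<oplus>\<^bsub>E\<^esub> frac F ?H (W ^ n)"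
      using add.hyps homogeneous_UVW
      by (intro add_frac_same[symmetric, of _ _ _ n] p1 homogeneous3_subst3_1 homogeneous3_power1)
    have e': "frac F (subst3 A B C G + subst3 A B C H) (C ^ n) =
       frac F (subst3 A B C G) (C ^ n) \<oplus>\<^bsub>E\<^esub> frac F (subst3 A B C H) (C ^ n)"
      using add.hyps h homogeneous3_power[OF h(3), of n]
      by (intro add_frac_same[symmetric, of _ _ _ "n * m"] p2 homogeneous3_subst3)
        (simp_all add: mult.commute)
    show ?case using add
      by (simp add: crhom.homs[OF crhom_subst3] e e' a(3) frac_closed p1)
  qed
qed

lemma bforms_VW_homogeneous: "P \<in> bforms n V W \<Longrightarrow> homogeneous3 n P"
  by (rule bforms_homogeneous[OF homogeneous_UVW(2,3)])

lemma constants_subset_bfrac: "constants F \<subseteq> bfrac F A B"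
proof
  fix x assume "x \<in> constants F"
  then obtain c where x: "x = frac F (const3 c) 1" by (auto simp: constants_def)
  have "1 \<in> bforms 0 A B" using bforms_const[of 1 A B] by (simp add: const3_simps)
  then show "x \<in> bfrac F A B" unfolding x by (rule bfracI[OF bforms_const _ not_dvd_1])
qed

end

section \<open>Two commuting Galois groups force the Fermat form\<close>

text \<open>One of two symmetric halves. Because the groups commute, every automorphism over \<open>K(V/W)\<close> is
  affine in \<open>x = U/W\<close>. The coefficients \<open>p j\<close> of the powers of \<open>V/W\<close> in the equation are invariants of these affine
  substitutions, and nonconstant invariants of degree less than \<open>d\<close> do not exist.\<close>

lemma half_fermat:
  fixes F U V W :: "'k::alg_closed_field poly3"
  assumes "outer_frame F U V W \<phi> d"
  defines "E \<equiv> function_field F"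
  assumes d: "d \<ge> 2" "of_nat d \<noteq> (0::'k)"
    and fix1: "{x \<in> carrier E. \<forall>\<sigma>\<in>field_auts E (bfrac F V W). \<sigma> x = x} = bfrac F V W"
    and fix2: "{x \<in> carrier E. \<forall>\<sigma>\<in>field_auts E (bfrac F U W). \<sigma> x = x} = bfrac F U W"
    and comm: "\<And>\<sigma> \<tau> x. \<sigma> \<in> field_auts E (bfrac F V W) \<Longrightarrow> \<tau> \<in> field_auts E (bfrac F U W) \<Longrightarrow>
       x \<in> carrier E \<Longrightarrow> \<sigma> (\<tau> x) = \<tau> (\<sigma> x)"
  obtains c v b where "c \<noteq> 0" "F = const3 c * (U + const3 v * W) ^ d + bform const3 d b V W"
proof -
  interpret outer_frame F U V W \<phi> d by fact
  let ?G1 = "field_auts E (bfrac F V W)" and ?G2 = "field_auts E (bfrac F U W)"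
  obtain c where c: "\<phi> F = coeffs_form d c" "c 0 d \<noteq> 0" "c d 0 \<noteq> 0" by (rule phi_F_rep)
  define p where "p = Polynomial.coeff (dehomY (\<phi> F))"
  have p: "p j = (if j \<le> d then bform (\<lambda>c. [:c:]) (d - j) (c j) [:0, 1:] 1 else 0)" for j
    unfolding p_def c(1) dehomY_rep coeff_bform ..
  have pU: "(U, W) \<in> FP" "(V, W) \<in> FP"
    using homogeneous_UVW not_dvd_VW by (auto intro: fun_pairsI)
  define lin where "lin s = bform const3 1 (Polynomial.coeff s) U W" for s
  have hlin: "homogeneous3 1 (lin s)" for s unfolding lin_def by (intro homogeneous3_bform homogeneous_UVW)
  have y_fixed: "\<sigma> (frac F V W) = frac F V W" if "\<sigma> \<in> ?G1" for \<sigma>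
    using field_auts_hom(6)[OF that[unfolded E_def]]
    by (simp add: bfracI[OF bforms_left bforms_right not_dvd_VW(2)])
  define \<Gamma> where "\<Gamma> = {s. Polynomial.degree s = 1 \<and> (\<forall>j\<le>d. pcompose (p j) s = p j)}"
  have affine: "\<exists>s\<in>\<Gamma>. \<sigma> (frac F U W) = frac F (lin s) W" if \<sigma>: "\<sigma> \<in> ?G1" for \<sigma>
  proof -
    \<comment> \<open>\<open>\<sigma>(U/W)\<close> is fixed by the second group, so it is a quotient of forms in \<open>U\<close> and \<open>W\<close>.\<close>
    have x2: "frac F U W \<in> bfrac F U W" by (rule bfracI[OF bforms_left bforms_right not_dvd_VW(2)])
    have "\<sigma> (frac F U W) \<in> carrier E"
      using field_auts_hom(1)[OF \<sigma>[unfolded E_def]] frac_closed[OF pU(1)] by (simp add: E_def)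
    moreover have "\<tau> (\<sigma> (frac F U W)) = \<sigma> (frac F U W)" if "\<tau> \<in> ?G2" for \<tau>
      using comm[OF \<sigma> that, of "frac F U W"] field_auts_hom(6)[OF that[unfolded E_def] x2]
        frac_closed[OF pU(1)] by (simp add: E_def)
    ultimately have "\<sigma> (frac F U W) \<in> bfrac F U W" using fix2 by blast
    then obtain n \<alpha> \<beta> where "\<sigma> (frac F U W) = frac F (bform const3 n \<alpha> U W) (bform const3 n \<beta> U W)"
      "\<not> F dvd bform const3 n \<beta> U W"
      by (auto simp: bfrac_def bforms_def)
    moreover define A B where "A = bform const3 n \<alpha> U W" "B = bform const3 n \<beta> U W"
    ultimately have AB: "\<sigma> (frac F U W) = frac F A B" "\<not> F dvd B" by auto
    have hAB: "homogeneous3 n A" "homogeneous3 n B"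
      unfolding A_B_def by (intro homogeneous3_bform homogeneous_UVW)+
    have pAB: "(A, B) \<in> FP" by (rule fun_pairsI[OF hAB AB(2)])
    have h: "homogeneous3 (n + 1) (A * W)" "homogeneous3 (n + 1) (B * V)" "homogeneous3 (n + 1) (B * W)"
      by (intro homogeneous3_mult hAB homogeneous_UVW)+
    have nBW: "\<not> F dvd B * W" by (rule not_dvd_mult[OF AB(2) not_dvd_VW(2)])
    have "\<sigma> (frac F U W) = frac F (A * W) (B * W)"
      unfolding AB(1) by (rule frac_eqI[OF pAB fun_pairsI[OF h(1,3) nBW]]) simp
    moreover have "\<sigma> (frac F V W) = frac F (B * V) (B * W)"
      unfolding y_fixed[OF \<sigma>] by (rule frac_eqI[OF pU(2) fun_pairsI[OF h(2,3) nBW]]) simp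
    ultimately have "\<sigma> (frac F (subst3 U V W (\<phi> F)) (W ^ d)) =
        frac F (subst3 (A * W) (B * V) (B * W) (\<phi> F)) ((B * W) ^ d)"
      by (intro aut_subst[OF \<sigma>[unfolded E_def] constants_subset_bfrac _ _ h nBW]
          phi_homogeneous homogeneous_F)
    moreover have "frac F (subst3 U V W (\<phi> F)) (W ^ d) = \<zero>\<^bsub>function_field F\<^esub>"
      using fun_pairs_subst[OF phi_homogeneous[OF homogeneous_F] homogeneous_UVW not_dvd_VW(2)]
      by (simp add: frac_eq_0_iff subst_phi)
    ultimately have "frac F (subst3 (A * W) (B * V) (B * W) (\<phi> F)) ((B * W) ^ d) = \<zero>\<^bsub>function_field F\<^esub>"
      using field_auts_hom(5)[OF \<sigma>[unfolded E_def]] by simp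
    then have "F dvd subst3 (A * W) (B * V) (B * W) (\<phi> F)"
      using frac_eq_0_iff[OF fun_pairs_subst[OF phi_homogeneous[OF homogeneous_F] h nBW]] by blast
    then have "\<phi> F dvd subst3 (\<phi> A * Z3) (\<phi> B * Y3) (\<phi> B * Z3) (\<phi> F)"
      using phi_dvd_iff[of F "subst3 (A * W) (B * V) (B * W) (\<phi> F)"]
      by (simp add: phi_subst crhom.homs[OF phi_hom] phi_V phi_W)
    moreover have phiAB: "\<phi> A = bform const3 n \<alpha> X3 Z3" "\<phi> B = bform const3 n \<beta> X3 Z3"
      by (simp_all add: A_B_def phi_bform phi_U phi_W)
    moreover have "\<phi> B \<noteq> 0"
      using AB(2) phi_inj[of B 0] by (auto simp: crhom.homs[OF phi_hom])
    ultimately obtain s where s: "Polynomial.degree s = 1"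
      "\<And>j. j \<le> d \<Longrightarrow> pcompose (p j) s = p j"
      "\<phi> A * Z3 = \<phi> B * bform const3 1 (Polynomial.coeff s) X3 Z3"
      using affine_of_invariant[of d c "\<phi> B" n \<beta> "\<phi> A" \<alpha>] d c unfolding p_def by (metis One_nat_def Suc_leD numeral_2_eq_2)
    have "\<phi> (A * W) = \<phi> (lin s * B)"
      using s(3) by (simp add: crhom.homs[OF phi_hom] phi_W lin_def phi_bform phi_U mult.commute)
    then have "A * W = lin s * B" by (rule phi_inj)
    then have "\<sigma> (frac F U W) = frac F (lin s) W"
      unfolding AB(1)
      by (rule frac_eqI[OF pAB fun_pairsI[OF hlin homogeneous_UVW(3) not_dvd_VW(2)]])
    then show ?thesis using s by (auto simp: \<Gamma>_def)
  qed
  have small: "Polynomial.degree q = 0"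
    if inv: "\<And>s. s \<in> \<Gamma> \<Longrightarrow> pcompose q s = q" and q: "Polynomial.degree q < d" for q
  proof (rule ccontr)
    define m where "m = Polynomial.degree q"
    assume "Polynomial.degree q \<noteq> 0"
    then have m: "0 < m" "m < d" "Polynomial.coeff q m \<noteq> 0" using q by (auto simp: m_def)
    define Q where "Q = bform const3 m (Polynomial.coeff q) X3 Z3"
    have hQ: "homogeneous3 m Q" unfolding Q_def by (intro homogeneous3_bform homogeneous3_vars)
    have QUW: "subst3 U V W Q = bform const3 m (Polynomial.coeff q) U W"
      by (simp add: Q_def hom_bform[OF crhom_subst3] subst3_simps)
    let ?e = "frac F (bform const3 m (Polynomial.coeff q) U W) (W ^ m)"
    have pe: "(bform const3 m (Polynomial.coeff q) U W, W ^ m) \<in> FP"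
      using fun_pairs_subst[OF hQ homogeneous_UVW not_dvd_VW(2)] by (simp add: QUW)
    have "\<sigma> ?e = ?e" if \<sigma>: "\<sigma> \<in> ?G1" for \<sigma>
    proof -
      obtain s where s: "s \<in> \<Gamma>" "\<sigma> (frac F U W) = frac F (lin s) W" using affine[OF \<sigma>] by blast
      have "\<sigma> ?e = frac F (subst3 (lin s) V W Q) (W ^ m)"
        using aut_subst[OF \<sigma>[unfolded E_def] constants_subset_bfrac s(2) y_fixed[OF \<sigma>] hlin
            homogeneous_UVW(2,3) not_dvd_VW(2) hQ]
        by (simp add: QUW)
      moreover have "subst3 (lin s) V W Q = subst3 U V W Q"
      proof (rule phi_inj, rule dehomY_eqD)
        show "homogeneous3 m (\<phi> (subst3 (lin s) V W Q))" "homogeneous3 m (\<phi> (subst3 U V W Q))"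
          by (intro phi_homogeneous homogeneous3_subst3_1 hQ hlin homogeneous_UVW)+
        have "bform (\<lambda>c. [:c:]) 1 (Polynomial.coeff s) [:0, 1:] 1 = s"
          using s(1) by (intro bform_coeff_X) (simp add: \<Gamma>_def)
        then have "dehomY (\<phi> (subst3 (lin s) V W Q)) = [:pcompose q s:]"
          by (simp add: phi_subst Q_def hom_bform[OF crhom_subst3] subst3_simps lin_def phi_bform phi_U
              phi_W hom_bform[OF crhom_dehomY] dehomY_simps lift_one bform_lift_XZ bform_eq_pcompose m_def)
        also have "\<dots> = dehomY (\<phi> (subst3 U V W Q))"
          by (simp add: phi_subst_UVW Q_def dehomY_XZ bform_coeff_X m_def inv[OF s(1)])
        finally show "dehomY (\<phi> (subst3 (lin s) V W Q)) = dehomY (\<phi> (subst3 U V W Q))" .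
      qed
      ultimately show ?thesis by (simp add: QUW)
    qed
    then have "?e \<in> {x \<in> carrier E. \<forall>\<sigma>\<in>?G1. \<sigma> x = x}" using frac_closed[OF pe] by (simp add: E_def)
    then have "?e \<in> bfrac F V W" by (simp only: fix1)
    then obtain n P R where PR: "?e = frac F P R" "P \<in> bforms n V W" "R \<in> bforms n V W" "\<not> F dvd R"
      by (auto simp: bfrac_def)
    have "F dvd bform const3 m (Polynomial.coeff q) U W * R - P * W ^ m"
      using PR(1) frac_eq_iff[OF pe fun_pairsI[OF bforms_VW_homogeneous[OF PR(2)] bforms_VW_homogeneous[OF PR(3)] PR(4)]]
      by simp
    moreover obtain \<alpha> \<beta> where ab: "P = bform const3 n \<alpha> V W" "R = bform const3 n \<beta> V W"
      using PR(2,3) by (auto simp: bforms_def)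
    ultimately have "\<phi> F dvd bform const3 m (Polynomial.coeff q) X3 Z3 * bform const3 n \<beta> Y3 Z3
        - bform const3 n \<alpha> Y3 Z3 * Z3 ^ m"
      using phi_dvd_iff[of F] crhom.hom_dvd[OF phi_hom, of F]
      by (metis (no_types, lifting) crhom.hom_diff crhom.hom_mult crhom.hom_power phi_U phi_V phi_W phi_bform phi_hom)
    moreover have "bform const3 n \<beta> Y3 Z3 \<noteq> 0"
    proof
      assume "bform const3 n \<beta> Y3 Z3 = 0"
      then have "\<phi> R = \<phi> 0" by (simp add: ab phi_bform phi_V phi_W crhom.homs[OF phi_hom])
      then show False using phi_inj PR(4) by blast
    qed
    ultimately show False using no_relation_of_small_degree[of c d m "Polynomial.coeff q" n \<beta> \<alpha>] c m by simp
  qed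
  have p0: "Polynomial.degree (p 0) = d"
  proof (rule antisym)
    show "Polynomial.degree (p 0) \<le> d" using degree_bform[of d "c 0"] by (simp add: p)
    show "d \<le> Polynomial.degree (p 0)" using c by (intro le_degree) (simp add: p coeff_bform)
  qed
  obtain k v e where k: "k \<noteq> 0" "p 0 = Polynomial.smult k ([:v, 1:] ^ d) + [:e:]"
    by (rule power_of_invariant[OF d p0, of \<Gamma>]) (auto simp: \<Gamma>_def intro: small)
  have pj: "p j = [:Polynomial.coeff (p j) 0:]" if "j > 0" for j
  proof (cases "j \<le> d")
    case True
    have "Polynomial.degree (p j) = 0"
    proof (rule small)
      show "pcompose (p j) s = p j" if "s \<in> \<Gamma>" for s using that True by (simp add: \<Gamma>_def)
      have "Polynomial.degree (p j) \<le> d - j" using True by (simp add: p degree_bform)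
      then show "Polynomial.degree (p j) < d" using that True by linarith
    qed
    then show ?thesis by (metis degree_eq_zeroE coeff_pCons_0)
  qed (simp add: p)
  define b where "b j = (if j = 0 then e else Polynomial.coeff (p j) 0)" for j
  have "\<phi> F = const3 k * (X3 + const3 v * Z3) ^ d + bform const3 d b Y3 Z3"
  proof (rule dehomY_eqD)
    show "homogeneous3 d (\<phi> F)" by (rule phi_homogeneous[OF homogeneous_F])
    show "homogeneous3 d (const3 k * (X3 + const3 v * Z3) ^ d + bform const3 d b Y3 Z3)"
      by (intro homogeneous3_add homogeneous3_const_mult homogeneous3_power1 homogeneous3_bform homogeneous3_vars)
    have 1: "dehomY (bform const3 d b Y3 Z3) = bform (\<lambda>c. [:c:]) d (\<lambda>j. [:b j:]) [:0, 1:] 1"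
      by (simp add: hom_bform[OF crhom_dehomY] dehomY_simps) (simp add: bform_def)
    have 2: "dehomY (const3 k * (X3 + const3 v * Z3) ^ d) = [:Polynomial.smult k ([:v, 1:] ^ d):]"
    proof -
      have "dehomY (const3 k * (X3 + const3 v * Z3) ^ d) = [:[:k:]:] * [:[:v, 1:]:] ^ d"
        by (simp add: crhom.homs[OF crhom_dehomY] dehomY_simps)
      also have "\<dots> = [:Polynomial.smult k ([:v, 1:] ^ d):]"
        unfolding crhom.hom_power[OF crhom_coeff_lift, symmetric] by simp
      finally show ?thesis .
    qed
    show "dehomY (\<phi> F) = dehomY (const3 k * (X3 + const3 v * Z3) ^ d + bform const3 d b Y3 Z3)"
    proof (rule poly_eqI)
      fix j
      have "p j = (if j = 0 then Polynomial.smult k ([:v, 1:] ^ d) else 0) + (if j \<le> d then [:b j:] else 0)"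
        using pj[of j] k(2) p[of j] by (auto simp: b_def)
      then show "Polynomial.coeff (dehomY (\<phi> F)) j =
        Polynomial.coeff (dehomY (const3 k * (X3 + const3 v * Z3) ^ d + bform const3 d b Y3 Z3)) j"
        by (simp add: crhom.hom_add[OF crhom_dehomY] 1 2 coeff_bform coeff_pCons p_def split: nat.splits)
    qed
  qed
  then have "subst3 U V W (\<phi> F) = subst3 U V W (const3 k * (X3 + const3 v * Z3) ^ d + bform const3 d b Y3 Z3)"
    by simp
  then have "F = const3 k * (U + const3 v * W) ^ d + bform const3 d b V W"
    by (simp add: subst_phi crhom.homs[OF crhom_subst3] hom_bform[OF crhom_subst3] subst3_simps)
  then show thesis using that k(1) by blast
qed

section \<open>Frames from invertible matrices\<close>

lemma subst3_lin_form:
  fixes M :: "'k::field ^ 3 ^ 3"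
  shows "subst3 (lin_form (M $ 1)) (lin_form (M $ 2)) (lin_form (M $ 3)) (lin_form a) = lin_form (a v* M)"
proof -
  have "subst3 (lin_form (M $ 1)) (lin_form (M $ 2)) (lin_form (M $ 3)) (lin_form a) =
    const3 (a $ 1) * lin_form (M $ 1) + const3 (a $ 2) * lin_form (M $ 2) + const3 (a $ 3) * lin_form (M $ 3)"
    by (simp add: lin_form_def[of a] crhom.homs[OF crhom_subst3] subst3_simps)
  also have "\<dots> = lin_form (a v* M)"
    by (simp add: lin_form_def vector_matrix_mult_def sum_3 crhom.homs[OF crhom_const3] algebra_simps)
  finally show ?thesis .
qed

lemma row_matrix_mult: "(N :: 'k::field ^ 3 ^ 3) $ i v* M = (N ** M) $ i"
  by (simp add: vec_eq_iff vector_matrix_mult_def matrix_matrix_mult_def mult.commute)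

lemma lin_form_mat_1:
  "lin_form ((mat 1 :: 'k::field ^ 3 ^ 3) $ 1) = X3"
  "lin_form ((mat 1 :: 'k::field ^ 3 ^ 3) $ 2) = Y3"
  "lin_form ((mat 1 :: 'k::field ^ 3 ^ 3) $ 3) = Z3"
  by (simp_all add: lin_form_def mat_def crhom.homs[OF crhom_const3])

lemma frame_of_matrix:
  fixes M N :: "'k::field ^ 3 ^ 3"
  assumes "N ** M = mat 1" "M ** N = mat 1"
  shows "frame (lin_form (N $ 1)) (lin_form (N $ 2)) (lin_form (N $ 3))
    (subst3 (lin_form (M $ 1)) (lin_form (M $ 2)) (lin_form (M $ 3)))"
proof
  let ?\<phi> = "subst3 (lin_form (M $ 1)) (lin_form (M $ 2)) (lin_form (M $ 3))"
  let ?\<psi> = "subst3 (lin_form (N $ 1)) (lin_form (N $ 2)) (lin_form (N $ 3))"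
  show "?\<phi> (lin_form (N $ 1)) = X3" "?\<phi> (lin_form (N $ 2)) = Y3" "?\<phi> (lin_form (N $ 3)) = Z3"
    by (simp_all add: subst3_lin_form row_matrix_mult assms lin_form_mat_1)
  show "?\<psi> (?\<phi> G) = G" for G
    by (rule poly3_hom_ext[of "\<lambda>G. ?\<psi> (?\<phi> G)" "\<lambda>G. G"])
      (simp_all add: crhom_comp[OF crhom_subst3 crhom_subst3] crhom_id subst3_simps subst3_lin_form
        row_matrix_mult assms lin_form_mat_1)
  show "homogeneous3 n (?\<phi> G)" if "homogeneous3 n G" for n G
    by (intro homogeneous3_subst3_1 homogeneous3_lin_form that)
qed (simp_all add: crhom.homs[OF crhom_subst3] subst3_simps homogeneous3_lin_form[unfolded One_nat_def])

lemma eval3_subst3: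
  "eval3 (\<lambda>c. c) (subst3 A B C G) x y z =
   eval3 (\<lambda>c. c) G (eval3 (\<lambda>c. c) A x y z) (eval3 (\<lambda>c. c) B x y z) (eval3 (\<lambda>c. c) C x y z)"
  by (rule poly3_hom_ext[of "\<lambda>G. eval3 (\<lambda>c. c) (subst3 A B C G) x y z"])
    (simp_all add: crhom_comp[OF crhom_eval3[OF crhom_id] crhom_subst3] crhom_eval3[OF crhom_id]
      eval3_simps[OF crhom_id] subst3_simps)

lemma eval3_lin_form: "eval3 (\<lambda>c. c) (lin_form a) x y z = a $ 1 * x + a $ 2 * y + a $ 3 * z"
  by (simp add: lin_form_def crhom.homs[OF crhom_eval3[OF crhom_id]] eval3_simps[OF crhom_id])

lemma value_at_columns:
  "eval3 (\<lambda>c. c) (subst3 (lin_form (M $ 1)) (lin_form (M $ 2)) (lin_form (M $ 3)) F) 1 0 0 =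
     value_at F (column 1 M)"
  "eval3 (\<lambda>c. c) (subst3 (lin_form (M $ 1)) (lin_form (M $ 2)) (lin_form (M $ 3)) F) 0 1 0 =
     value_at F (column 2 M)"
  by (simp_all add: eval3_subst3 eval3_lin_form value_at_def column_def)

lemma lin_form_add: "lin_form (a + b) = lin_form a + lin_form b"
  and lin_form_scale: "lin_form (k *s a) = const3 k * lin_form a"
  by (simp_all add: lin_form_def crhom.homs[OF crhom_const3] algebra_simps)

lemma UNIV_perm:
  fixes i j k :: 3
  assumes "i \<noteq> j" "i \<noteq> k" "j \<noteq> k"
  shows "UNIV = {i, j, k}"
proof -
  have "card {i, j, k} = CARD(3)" using assms by simp
  then show ?thesis by (metis card_subset_eq finite subset_UNIV)
qed

text \<open>The projection from a coordinate point: any linear map with this kernel is given by two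
  combinations of the other two coordinates.\<close>

lemma proj_subfield_column:
  fixes M N :: "'k::field ^ 3 ^ 3"
  assumes NM: "N ** M = mat 1" "M ** N = mat 1" and d: "i \<noteq> j" "i \<noteq> k" "j \<noteq> k"
  shows "proj_subfield F (column i M) = bfrac F (lin_form (N $ j)) (lin_form (N $ k))"
proof -
  have S: "sum f UNIV = f i + f j + f k" for f :: "3 \<Rightarrow> 'k"
    using d by (simp add: UNIV_perm[OF d] add.assoc)
  have NMv: "N *v (M *v v) = v" "M *v (N *v v) = v" for v
    by (simp_all add: matrix_vector_mul_assoc NM)
  show ?thesis
  proof (intro equalityI subsetI)
    fix x assume "x \<in> proj_subfield F (column i M)"
    then obtain L n a b where L: "x = frac F (binary_form n a L) (binary_form n b L)"
      "projection_from (column i M) L" "\<not> F dvd binary_form n b L"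
      by (auto simp: proj_subfield_def)
    have mem: "lin_form (L $ r) \<in> bforms 1 (lin_form (N $ j)) (lin_form (N $ k))" for r
    proof -
      have "column i M \<in> range (\<lambda>c. c *s column i M)" by (rule range_eqI[of _ _ 1]) simp
      then have "L *v column i M = 0" using L(2) unfolding projection_from_def by blast
      then have 0: "(L ** M) $ r $ i = 0"
        by (simp add: vec_eq_iff matrix_vector_mult_def matrix_matrix_mult_def column_def)
      have "L $ r = ((L ** M) ** N) $ r" by (simp add: matrix_mul_assoc[symmetric] NM)
      also have "\<dots> = (L ** M) $ r $ j *s N $ j + (L ** M) $ r $ k *s N $ k"
        by (simp add: vec_eq_iff matrix_matrix_mult_def[of "L ** M" N] S 0)
      finally have "lin_form (L $ r) = const3 ((L ** M) $ r $ j) * lin_form (N $ j) +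
          const3 ((L ** M) $ r $ k) * lin_form (N $ k)"
        by (simp add: lin_form_add lin_form_scale)
      then show ?thesis
        by (simp only:) (intro bforms_add bforms_const_mult bforms_left bforms_right)
    qed
    have "binary_form n c L \<in> bforms n (lin_form (N $ j)) (lin_form (N $ k))" for c
      using bforms_change[OF mem mem, of n 1 2] by (auto simp: binary_form_eq bforms_def)
    then show "x \<in> bfrac F (lin_form (N $ j)) (lin_form (N $ k))"
      unfolding L(1) using L(3) by (intro bfracI)
  next
    fix x assume "x \<in> bfrac F (lin_form (N $ j)) (lin_form (N $ k))"
    then obtain n a b where x: "x = frac F (bform const3 n a (lin_form (N $ j)) (lin_form (N $ k)))
        (bform const3 n b (lin_form (N $ j)) (lin_form (N $ k)))"
      "\<not> F dvd bform const3 n b (lin_form (N $ j)) (lin_form (N $ k))"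
      by (auto simp: bfrac_def bforms_def)
    define L :: "'k ^ 3 ^ 2" where "L = (\<chi> r. if r = 1 then N $ j else N $ k)"
    have L: "L $ 1 = N $ j" "L $ 2 = N $ k" by (simp_all add: L_def)
    have eq0: "L *v v = 0 \<longleftrightarrow> (N *v v) $ j = 0 \<and> (N *v v) $ k = 0" for v
    proof -
      have "(L *v v) $ 1 = (N *v v) $ j" "(L *v v) $ 2 = (N *v v) $ k"
        by (simp_all add: matrix_vector_mult_def L)
      then show ?thesis by (simp only: vec_eq_iff[of "L *v v"] forall_2 zero_index)
    qed
    have col: "M *v (c *s axis i 1) = c *s column i M" for c
      by (simp add: vec_eq_iff matrix_vector_mult_def column_def axis_def mult.commute
          if_distrib[where f = "\<lambda>x. _ * x"] cong: if_cong)
    have "projection_from (column i M) L"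
      unfolding projection_from_def
    proof (intro equalityI subsetI)
      fix v assume "v \<in> {v. L *v v = 0}"
      then have v: "(N *v v) $ j = 0" "(N *v v) $ k = 0" by (simp_all add: eq0)
      have "(N *v v) $ r = ((N *v v) $ i *s axis i 1) $ r" for r
        using v UNIV_perm[OF d] d by (cases "r = i"; cases "r = j") (auto simp: axis_def)
      then have "N *v v = (N *v v) $ i *s axis i 1" by (rule vec_eq_iff[THEN iffD2, OF allI])
      then have "v = M *v ((N *v v) $ i *s axis i 1)" using NMv(2)[of v] by simp
      then show "v \<in> range (\<lambda>c. c *s column i M)" by (auto simp: col)
    next
      fix v assume "v \<in> range (\<lambda>c. c *s column i M)"
      then obtain c where "v = M *v (c *s axis i 1)" by (auto simp: col)
      then have "N *v v = c *s axis i 1" by (simp add: NMv)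
      then show "v \<in> {v. L *v v = 0}" using d by (simp add: eq0 axis_def)
    qed
    then show "x \<in> proj_subfield F (column i M)"
      unfolding proj_subfield_def mem_Collect_eq
      by (intro exI[of _ L] exI[of _ n] exI[of _ a] exI[of _ b]) (simp add: binary_form_eq L x)
  qed
qed

text \<open>Replacing the coordinates \<open>U\<close>, \<open>V\<close>, \<open>W\<close> by \<open>s (U + v W)\<close>, \<open>t (V + w W)\<close>, \<open>r W\<close>.\<close>

lemma rescaled_frame:
  fixes M N :: "'k::field ^ 3 ^ 3"
  assumes NM: "N ** M = mat 1" "M ** N = mat 1" and nz: "s \<noteq> 0" "t \<noteq> 0" "r \<noteq> 0"
  obtains N' M' :: "'k ^ 3 ^ 3" where "N' ** M' = mat 1" "M' ** N' = mat 1"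
    "lin_form (N' $ 1) = const3 s * (lin_form (N $ 1) + const3 v * lin_form (N $ 3))"
    "lin_form (N' $ 2) = const3 t * (lin_form (N $ 2) + const3 w * lin_form (N $ 3))"
    "lin_form (N' $ 3) = const3 r * lin_form (N $ 3)"
proof -
  define D :: "'k ^ 3 ^ 3" where "D = vector [vector [s, 0, s * v], vector [0, t, t * w], vector [0, 0, r]]"
  have "det D = s * t * r" by (simp add: det_3 D_def)
  then have "invertible D" using nz by (simp add: invertible_det_nz)
  moreover have "invertible N" using NM by (auto simp: invertible_def)
  ultimately have "invertible (D ** N)" by (rule invertible_mult)
  then obtain M' where M': "D ** N ** M' = mat 1" "M' ** (D ** N) = mat 1" by (auto simp: invertible_def)
  have row: "(D ** N) $ i = D $ i $ 1 *s N $ 1 + D $ i $ 2 *s N $ 2 + D $ i $ 3 *s N $ 3" for i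
    by (simp add: vec_eq_iff matrix_matrix_mult_def sum_3)
  have lin: "lin_form ((D ** N) $ i) = const3 (D $ i $ 1) * lin_form (N $ 1) +
      const3 (D $ i $ 2) * lin_form (N $ 2) + const3 (D $ i $ 3) * lin_form (N $ 3)" for i
    by (simp add: row lin_form_add lin_form_scale)
  show thesis
    by (rule that[OF M'], unfold lin) (simp_all add: D_def crhom.homs[OF crhom_const3] algebra_simps)
qed

text \<open>Projective equivalence to the Fermat curve means being a sum of \<open>d\<close>-th powers of
  homogeneous coordinates.\<close>

lemma proj_equivalent_fermat_iff:
  fixes F :: "'k::alg_closed_field poly3"
  assumes "d > 0"
  shows "proj_equivalent F (fermat d) \<longleftrightarrow>
    (\<exists>N M :: 'k ^ 3 ^ 3. N ** M = mat 1 \<and> M ** N = mat 1 \<and>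
       F = lin_form (N $ 1) ^ d + lin_form (N $ 2) ^ d + lin_form (N $ 3) ^ d)"
proof
  assume "proj_equivalent F (fermat d)"
  then obtain M :: "'k ^ 3 ^ 3" and c where M: "invertible M" "c \<noteq> 0"
    "subst3 (lin_form (M $ 1)) (lin_form (M $ 2)) (lin_form (M $ 3)) F = const3 c * fermat d"
    by (auto simp: proj_equivalent_def)
  then obtain N where NM: "N ** M = mat 1" "M ** N = mat 1" by (auto simp: invertible_def)
  interpret frame "lin_form (N $ 1)" "lin_form (N $ 2)" "lin_form (N $ 3)"
    "subst3 (lin_form (M $ 1)) (lin_form (M $ 2)) (lin_form (M $ 3))"
    by (rule frame_of_matrix[OF NM])
  obtain s where s: "s ^ d = c" using nth_root_exists[OF assms] by blast
  then have "s \<noteq> 0" using M(2) assms by (auto simp: power_0_left)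
  obtain N' M' :: "'k ^ 3 ^ 3" where N': "N' ** M' = mat 1" "M' ** N' = mat 1"
    "lin_form (N' $ 1) = const3 s * (lin_form (N $ 1) + const3 0 * lin_form (N $ 3))"
    "lin_form (N' $ 2) = const3 s * (lin_form (N $ 2) + const3 0 * lin_form (N $ 3))"
    "lin_form (N' $ 3) = const3 s * lin_form (N $ 3)"
    by (rule rescaled_frame[OF NM \<open>s \<noteq> 0\<close> \<open>s \<noteq> 0\<close> \<open>s \<noteq> 0\<close>])
  have "F = subst3 (lin_form (N $ 1)) (lin_form (N $ 2)) (lin_form (N $ 3)) (const3 c * fermat d)"
    by (simp only: M(3)[symmetric] subst_phi)
  also have "\<dots> = lin_form (N' $ 1) ^ d + lin_form (N' $ 2) ^ d + lin_form (N' $ 3) ^ d"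
    by (simp add: fermat_def crhom.homs[OF crhom_subst3] subst3_simps N' power_mult_distrib s[symmetric]
        crhom.homs[OF crhom_const3] algebra_simps)
  finally show "\<exists>N M :: 'k ^ 3 ^ 3. N ** M = mat 1 \<and> M ** N = mat 1 \<and>
       F = lin_form (N $ 1) ^ d + lin_form (N $ 2) ^ d + lin_form (N $ 3) ^ d" using N' by blast
next
  assume "\<exists>N M :: 'k ^ 3 ^ 3. N ** M = mat 1 \<and> M ** N = mat 1 \<and>
       F = lin_form (N $ 1) ^ d + lin_form (N $ 2) ^ d + lin_form (N $ 3) ^ d"
  then obtain N M :: "'k ^ 3 ^ 3" where NM: "N ** M = mat 1" "M ** N = mat 1"
    and F: "F = lin_form (N $ 1) ^ d + lin_form (N $ 2) ^ d + lin_form (N $ 3) ^ d" by blast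
  interpret frame "lin_form (N $ 1)" "lin_form (N $ 2)" "lin_form (N $ 3)"
    "subst3 (lin_form (M $ 1)) (lin_form (M $ 2)) (lin_form (M $ 3))"
    by (rule frame_of_matrix[OF NM])
  have "subst3 (lin_form (M $ 1)) (lin_form (M $ 2)) (lin_form (M $ 3)) F = const3 1 * fermat d"
    by (simp add: F crhom.homs[OF phi_hom] phi_U phi_V phi_W fermat_def crhom.homs[OF crhom_const3])
  then show "proj_equivalent F (fermat d)"
    using NM unfolding proj_equivalent_def invertible_def by (intro exI[of _ M] exI[of _ 1]) auto
qed

text \<open>A sum \<open>a A^d + b B^d\<close> is a difference of two \<open>d\<close>-th powers, and both of its factors vanish at the origin.\<close>

lemma not_irreducible_two_powers:
  fixes A B :: "'k::alg_closed_field poly3"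
  assumes d: "d \<ge> 2" and h: "eval3 (\<lambda>c. c) A 0 0 0 = 0" "eval3 (\<lambda>c. c) B 0 0 0 = 0"
  shows "\<not> Factorial_Ring.irreducible (const3 a * A ^ d + const3 b * B ^ d)"
proof
  assume irr: "Factorial_Ring.irreducible (const3 a * A ^ d + const3 b * B ^ d)"
  have "d > 0" using d by simp
  obtain s where s: "s ^ d = a" using nth_root_exists[OF \<open>d > 0\<close>] by blast
  obtain t where t: "t ^ d = - b" using nth_root_exists[OF \<open>d > 0\<close>] by blast
  define x where "x = const3 s * A"
  define y where "y = const3 t * B"
  let ?S = "\<Sum>i<d. y ^ (d - Suc i) * x ^ i"
  have "b = - (t ^ d)" using t by simp
  then have "const3 a * A ^ d + const3 b * B ^ d = x ^ d - y ^ d"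
    by (simp add: x_def y_def power_mult_distrib crhom.homs[OF crhom_const3] s[symmetric])
  also have "\<dots> = (x - y) * ?S" by (rule power_diff_sumr2)
  finally have "is_unit (x - y) \<or> is_unit ?S"
    using irr by (auto dest: Factorial_Ring.irreducibleD)
  moreover have ev: "crhom (\<lambda>G. eval3 (\<lambda>c::'k. c) G 0 0 0)" by (rule crhom_eval3[OF crhom_id])
  have xy: "eval3 (\<lambda>c. c) x 0 0 0 = 0" "eval3 (\<lambda>c. c) y 0 0 0 = 0"
    by (simp_all add: x_def y_def crhom.homs[OF ev] h)
  have "eval3 (\<lambda>c. c) (x - y) 0 0 0 = 0" by (simp add: crhom.homs[OF ev] xy)
  moreover have "eval3 (\<lambda>c. c) ?S 0 0 0 = 0"
    unfolding crhom.homs[OF ev] xy using d by (intro sum.neutral) (auto simp: power_0_left)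
  ultimately show False
    using crhom.hom_dvd[OF ev, of "x - y" 1] crhom.hom_dvd[OF ev, of ?S 1] by (auto simp: crhom.homs[OF ev])
qed

lemma extend_to_basis:
  fixes P Q :: "'k::field ^ 3"
  assumes "P \<noteq> 0" "Q \<noteq> 0" "\<not> same_point P Q"
  obtains N M :: "'k ^ 3 ^ 3" where "N ** M = mat 1" "M ** N = mat 1" "column 1 M = P" "column 2 M = Q"
proof -
  define A :: "'k ^ 3 \<Rightarrow> 'k ^ 3 ^ 3" where "A R = transpose (vector [P, Q, R])" for R
  have "\<exists>R. det (A R) \<noteq> 0"
  proof (rule ccontr)
    assume "\<nexists>R. det (A R) \<noteq> 0"
    then have 0: "det (vector [P, Q, R] :: 'k ^ 3 ^ 3) = 0" for R by (simp add: A_def det_transpose)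
    have m: "P $ 2 * Q $ 3 = P $ 3 * Q $ 2" "P $ 1 * Q $ 3 = P $ 3 * Q $ 1" "P $ 1 * Q $ 2 = P $ 2 * Q $ 1"
      using 0[of "vector [1, 0, 0]"] 0[of "vector [0, 1, 0]"] 0[of "vector [0, 0, 1]"]
      by (simp_all add: det_3 algebra_simps)
    obtain i where i: "P $ i \<noteq> 0" using assms(1) by (auto simp: vec_eq_iff)
    have ij: "P $ i * Q $ j = P $ j * Q $ i" for j
      using m exhaust_3[of i] exhaust_3[of j] by (auto simp: mult.commute)
    have Q: "Q = (Q $ i / P $ i) *s P" using ij i by (simp add: vec_eq_iff field_simps)
    then have "Q $ i / P $ i \<noteq> 0" using assms(2) by (metis vector_smult_lzero)
    then show False using Q assms(3) unfolding same_point_def by blast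
  qed
  then obtain R where "invertible (A R)" by (auto simp: invertible_det_nz)
  then obtain N where "A R ** N = mat 1" "N ** A R = mat 1" by (auto simp: invertible_def)
  moreover have "column 1 (A R) = P" "column 2 (A R) = Q"
    by (simp_all add: A_def column_def transpose_def vec_eq_iff)
  ultimately show thesis using that by blast
qed

text \<open>The isomorphism maps \<open>(1, b) (a, 1) = (a, b)\<close> both to \<open>b a\<close> and to \<open>a b\<close>.\<close>

lemma internal_direct_product_commute:
  assumes "group G" "internal_direct_product G A B" "a \<in> A" "b \<in> B"
  shows "a \<otimes>\<^bsub>G\<^esub> b = b \<otimes>\<^bsub>G\<^esub> a"
proof -
  interpret group G by fact
  have sub: "subgroup A G" "subgroup B G" and
    iso: "(\<lambda>(a, b). a \<otimes>\<^bsub>G\<^esub> b) \<in> hom (G\<lparr>carrier := A\<rparr> \<times>\<times> G\<lparr>carrier := B\<rparr>) (G\<lparr>carrier := A <#>\<^bsub>G\<^esub> B\<rparr>)"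
    using assms(2) by (auto simp: internal_direct_product_def iso_def)
  have ab: "a \<in> carrier G" "b \<in> carrier G" "\<one>\<^bsub>G\<^esub> \<in> A" "\<one>\<^bsub>G\<^esub> \<in> B"
    using sub assms(3,4) by (auto intro: subgroup.mem_carrier subgroup.one_closed)
  have "(\<lambda>(a, b). a \<otimes>\<^bsub>G\<^esub> b) ((\<one>\<^bsub>G\<^esub>, b) \<otimes>\<^bsub>G\<lparr>carrier := A\<rparr> \<times>\<times> G\<lparr>carrier := B\<rparr>\<^esub> (a, \<one>\<^bsub>G\<^esub>)) =
     (\<lambda>(a, b). a \<otimes>\<^bsub>G\<^esub> b) (\<one>\<^bsub>G\<^esub>, b) \<otimes>\<^bsub>G\<^esub> (\<lambda>(a, b). a \<otimes>\<^bsub>G\<^esub> b) (a, \<one>\<^bsub>G\<^esub>)"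
    using hom_mult[OF iso, of "(\<one>\<^bsub>G\<^esub>, b)" "(a, \<one>\<^bsub>G\<^esub>)"] ab assms(3,4) by simp
  then show ?thesis using ab by simp
qed

lemma fermat_of_galois_points:
  fixes F :: "'k::alg_closed_field poly3"
  assumes d: "d \<ge> 2" "of_nat d \<noteq> (0::'k)" and F: "plane_curve d F"
    and P: "outer_galois_point F P1" "outer_galois_point F P2" "\<not> same_point P1 P2"
    and dp: "internal_direct_product (Aut_model F) (galois_group F P1) (galois_group F P2)"
  shows "proj_equivalent F (fermat d)"
proof -
  have irr: "Factorial_Ring.irreducible F" and hF: "homogeneous3 d F" using F by (auto simp: plane_curve_def)
  have g: "galois_point F P1" "galois_point F P2" and val: "value_at F P1 \<noteq> 0" "value_at F P2 \<noteq> 0"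
    using P by (auto simp: outer_galois_point_def)
  then have nz: "P1 \<noteq> 0" "P2 \<noteq> 0" by (auto simp: galois_point_def)
  obtain N M :: "'k ^ 3 ^ 3" where NM: "N ** M = mat 1" "M ** N = mat 1"
    and col: "column 1 M = P1" "column 2 M = P2"
    using extend_to_basis[OF nz P(3)] .
  define U V W where UVW: "U = lin_form (N $ 1)" "V = lin_form (N $ 2)" "W = lin_form (N $ 3)"
  define \<phi> where "\<phi> = subst3 (lin_form (M $ 1)) (lin_form (M $ 2)) (lin_form (M $ 3))"
  interpret prime_curve F by unfold_locales (rule irreducible_imp_prime_poly3[OF irr])
  interpret frame U V W \<phi> unfolding UVW \<phi>_def by (rule frame_of_matrix[OF NM])
  interpret outer_frame F U V W \<phi> d
    by unfold_locales (use hF d val in \<open>auto simp: \<phi>_def value_at_columns col\<close>)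
  have ps: "proj_subfield F P1 = bfrac F V W" "proj_subfield F P2 = bfrac F U W"
    using proj_subfield_column[OF NM, of 1 2 3 F] proj_subfield_column[OF NM, of 2 1 3 F]
    by (simp_all add: col UVW)
  have fix12: "{x \<in> carrier E. \<forall>\<sigma>\<in>field_auts E (bfrac F V W). \<sigma> x = x} = bfrac F V W"
    "{x \<in> carrier E. \<forall>\<sigma>\<in>field_auts E (bfrac F U W). \<sigma> x = x} = bfrac F U W"
    using g unfolding galois_point_def galois_extension_def ps by blast+
  have comm: "\<sigma> (\<tau> x) = \<tau> (\<sigma> x)"
    if st: "\<sigma> \<in> field_auts E (bfrac F V W)" "\<tau> \<in> field_auts E (bfrac F U W)" and x: "x \<in> carrier E" for \<sigma> \<tau> x
  proof -
    have "\<sigma> \<otimes>\<^bsub>Aut_model F\<^esub> \<tau> = \<tau> \<otimes>\<^bsub>Aut_model F\<^esub> \<sigma>"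
      using internal_direct_product_commute[OF group_Aut_model dp] st by (simp add: galois_group_def ps)
    then have "compose (carrier E) \<sigma> \<tau> x = compose (carrier E) \<tau> \<sigma> x"
      using mult_Aut_model[OF st] mult_Aut_model[OF st(2,1)] by simp
    then show ?thesis using x by (simp add: compose_def)
  qed
  obtain c v b where 1: "c \<noteq> 0" "F = const3 c * (U + const3 v * W) ^ d + bform const3 d b V W"
    by (rule half_fermat[OF outer_frame_axioms d fix12]) (rule comm, assumption+)
  obtain c' v' b' where 2: "c' \<noteq> 0" "F = const3 c' * (V + const3 v' * W) ^ d + bform const3 d b' U W"
    by (rule half_fermat[OF outer_frame_swap d fix12(2,1)]) (rule comm[symmetric], assumption+)
  define e where "e = bform (\<lambda>c. c) d b' (- v) 1"
  \<comment> \<open>Substituting \<open>- v W\<close> for \<open>U\<close> in both expressions of \<open>F\<close> determines the form in \<open>V\<close> and \<open>W\<close>.\<close>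
  define \<psi> where "\<psi> G = subst3 (- const3 v * W) V W (\<phi> G)" for G
  have psi: "crhom \<psi>" unfolding \<psi>_def by (rule crhom_comp[OF crhom_subst3 phi_hom])
  have psi_s: "\<psi> U = - const3 v * W" "\<psi> V = V" "\<psi> W = W" "\<psi> (const3 k) = const3 k" for k
    by (simp_all add: \<psi>_def phi_U phi_V phi_W phi_const subst3_simps)
  have psi_b: "\<psi> (bform const3 d k A B) = bform const3 d k (\<psi> A) (\<psi> B)" for k A B
    by (simp add: hom_bform[OF psi] psi_s)
  have "\<psi> F = bform const3 d b V W"
    using d by (subst 1(2)) (simp add: crhom.homs[OF psi] psi_s psi_b power_0_left)
  moreover have "\<psi> F = const3 c' * (V + const3 v' * W) ^ d + bform const3 d b' (- const3 v * W) W"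
    by (subst 2(2)) (simp add: crhom.homs[OF psi] psi_s psi_b)
  moreover have "bform const3 d b' (- const3 v * W) W = const3 e * W ^ d"
    using bform_scale[of const3 d b' W "const3 (- v)" 1] hom_bform[OF crhom_const3, of "\<lambda>c. c" d b' "- v" 1]
    by (simp add: e_def mult.commute crhom.homs[OF crhom_const3])
  ultimately have F_eq: "F = const3 c * (U + const3 v * W) ^ d + const3 c' * (V + const3 v' * W) ^ d + const3 e * W ^ d"
    using 1(2) by simp
  have ev0: "eval3 (\<lambda>c. c) (U + const3 v * W) 0 0 0 = 0" "eval3 (\<lambda>c. c) (V + const3 v' * W) 0 0 0 = 0"
    by (simp_all add: UVW crhom.homs[OF crhom_eval3[OF crhom_id]] eval3_lin_form)
  have "e \<noteq> 0"
    using not_irreducible_two_powers[OF d(1) ev0, of c c'] irr F_eq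
    by (auto simp: crhom.homs[OF crhom_const3])
  have "d > 0" using d by simp
  obtain s where s: "s ^ d = c" using nth_root_exists[OF \<open>d > 0\<close>] by blast
  obtain t where t: "t ^ d = c'" using nth_root_exists[OF \<open>d > 0\<close>] by blast
  obtain r where r: "r ^ d = e" using nth_root_exists[OF \<open>d > 0\<close>] by blast
  have "s \<noteq> 0" "t \<noteq> 0" "r \<noteq> 0" using s t r 1(1) 2(1) \<open>e \<noteq> 0\<close> \<open>d > 0\<close> by (auto simp: power_0_left)
  then obtain N' M' :: "'k ^ 3 ^ 3" where N': "N' ** M' = mat 1" "M' ** N' = mat 1"
    "lin_form (N' $ 1) = const3 s * (U + const3 v * W)"
    "lin_form (N' $ 2) = const3 t * (V + const3 v' * W)"
    "lin_form (N' $ 3) = const3 r * W"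
    unfolding UVW using rescaled_frame[OF NM, of s t r v v'] by metis
  have "F = lin_form (N' $ 1) ^ d + lin_form (N' $ 2) ^ d + lin_form (N' $ 3) ^ d"
    unfolding F_eq N' by (simp add: power_mult_distrib s[symmetric] t[symmetric] r[symmetric] crhom.homs[OF crhom_const3])
  then show ?thesis unfolding proj_equivalent_fermat_iff[OF \<open>d > 0\<close>] using N'(1,2) by blast
qed

section \<open>Roots of unity\<close>

text \<open>The set of \<open>d\<close>-th roots of unity.\<close>

abbreviation roots1 :: "nat \<Rightarrow> 'k::comm_ring_1 set" where
  "roots1 d \<equiv> {\<zeta>. \<zeta> ^ d = 1}"

lemma finite_roots1:
  assumes "d > 0"
  shows "finite (roots1 d :: 'k::field set)"
proof -
  have "Polynomial.coeff (Polynomial.monom (1::'k) d - 1) d \<noteq> 0" using assms by (simp add: coeff_1)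
  then have "Polynomial.monom (1::'k) d - 1 \<noteq> 0" by (metis coeff_0)
  then have "finite {\<zeta>. poly (Polynomial.monom (1::'k) d - 1) \<zeta> = 0}" by (rule poly_roots_finite)
  then show ?thesis by (simp add: poly_monom)
qed

text \<open>If \<open>\<zeta>^i = 1\<close> held for all \<open>d\<close>-th roots of unity \<open>\<zeta>\<close>, then with \<open>g = gcd i d\<close> and \<open>d = g k\<close>, a root
  \<open>\<zeta>\<close> of \<open>1 + T^g + ... + T^{g (k - 1)}\<close> would satisfy \<open>\<zeta>^g = 1\<close>, and so \<open>k\<close> would vanish in the field.\<close>

lemma exists_root1_power_ne_1:
  assumes d: "of_nat d \<noteq> (0::'k::alg_closed_field)" and i: "\<not> d dvd i"
  shows "\<exists>\<zeta>::'k. \<zeta> ^ d = 1 \<and> \<zeta> ^ i \<noteq> 1"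
proof (rule ccontr)
  assume "\<not> ?thesis"
  then have all: "\<zeta> ^ i = 1" if "\<zeta> ^ d = 1" for \<zeta> :: 'k using that by blast
  define g where "g = gcd i d"
  obtain k where k: "d = g * k" unfolding g_def by (metis dvdE gcd_dvd2)
  have "d > 0" using d by (cases d) auto
  have "i \<noteq> 0" using i by (cases i) auto
  then have "g > 0" by (simp add: g_def)
  have "k \<noteq> 1"
  proof
    assume "k = 1"
    then have "g = d" using k by simp
    then have "d dvd i" using gcd_dvd1[of i d] by (simp only: g_def)
    then show False using i by simp
  qed
  then have k1: "k > 1" using \<open>d > 0\<close> k by (cases k) auto
  have g1: "\<zeta> ^ g = 1" if z: "\<zeta> ^ d = 1" for \<zeta> :: 'k
  proof -
    obtain x y where "i * x = d * y + g" unfolding g_def using bezout_nat[OF \<open>i \<noteq> 0\<close>] by blast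
    then have "(\<zeta> ^ i) ^ x = (\<zeta> ^ d) ^ y * \<zeta> ^ g" by (metis power_add power_mult)
    then show ?thesis using all[OF z] z by simp
  qed
  obtain y :: 'k where y: "(\<Sum>j\<le>k - 1. 1 * y ^ j) = 0"
    using alg_closed[of "k - 1" "\<lambda>_. 1 :: 'k"] k1 by auto
  then have y': "(\<Sum>j<k. y ^ j) = 0" using k1 by (simp add: lessThan_Suc_atMost[symmetric])
  obtain z where z: "z ^ g = y" using nth_root_exists[OF \<open>g > 0\<close>] by blast
  have "z ^ d - 1 = 0"
    using power_diff_1_eq[of y k] y' by (simp add: k power_mult z)
  then have "y = 1" using g1[of z] z by simp
  then have "of_nat k = (0::'k)" using y' by simp
  then show False using d k by simp
qed

lemma sum_roots1_power:
  assumes d: "of_nat d \<noteq> (0::'k::alg_closed_field)" and i: "\<not> d dvd i"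
  shows "(\<Sum>\<zeta>\<in>roots1 d. \<zeta> ^ i) = (0::'k)"
proof -
  obtain \<xi> :: 'k where x: "\<xi> ^ d = 1" "\<xi> ^ i \<noteq> 1"
    using exists_root1_power_ne_1[OF d i] by blast
  have "d > 0" using d by (cases d) auto
  then have "\<xi> \<noteq> 0" using x(1) by (auto simp: power_0_left)
  have "(\<Sum>\<zeta>\<in>roots1 d. \<zeta> ^ i) = (\<Sum>\<zeta>\<in>roots1 d. (\<xi> * \<zeta>) ^ i)"
    by (rule sum.reindex_bij_witness[of _ "\<lambda>\<zeta>. \<xi> * \<zeta>" "\<lambda>\<zeta>. \<zeta> / \<xi>"])
      (use x \<open>\<xi> \<noteq> 0\<close> in \<open>auto simp: power_mult_distrib power_divide\<close>)
  also have "\<dots> = \<xi> ^ i * (\<Sum>\<zeta>\<in>roots1 d. \<zeta> ^ i)" by (simp add: power_mult_distrib sum_distrib_left)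
  finally show ?thesis using x(2) by (metis mult_cancel_right1)
qed

lemma sum_powers_root1:
  assumes "\<zeta> ^ d = (1::'k::field)"
  shows "(\<Sum>t<d. \<zeta> ^ t) = (if \<zeta> = 1 then of_nat d else 0)"
  using power_diff_1_eq[of \<zeta> d] assms by auto

section \<open>Subfields and induced automorphisms of the function field\<close>

context prime_curve
begin

lemma bfrac_closed:
  assumes "homogeneous3 1 A" "homogeneous3 1 B"
  shows "bfrac F A B \<subseteq> carrier E"
  by (auto simp: bfrac_def intro!: frac_closed intro: fun_pairsI bforms_homogeneous[OF assms])

lemma subfield_bfrac:
  assumes h: "homogeneous3 1 A" "homogeneous3 1 B"
  shows "subfield (bfrac F A B) E"
proof (rule E.subfieldI')
  have fp: "(P, Q) \<in> FP" if "P \<in> bforms n A B" "Q \<in> bforms n A B" "\<not> F dvd Q" for n P Q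
    using that bforms_homogeneous[OF h] by (auto intro: fun_pairsI)
  have elim: thesis if "x \<in> bfrac F A B"
    "\<And>n P Q. x = frac F P Q \<Longrightarrow> P \<in> bforms n A B \<Longrightarrow> Q \<in> bforms n A B \<Longrightarrow> \<not> F dvd Q \<Longrightarrow> (P, Q) \<in> FP \<Longrightarrow> thesis"
    for x thesis using that fp by (auto simp: bfrac_def)
  show "subring (bfrac F A B) E"
  proof (rule E.subringI)
    show "bfrac F A B \<subseteq> carrier E" by (rule bfrac_closed[OF h])
    show "\<one>\<^bsub>E\<^esub> \<in> bfrac F A B"
      using bfracI[OF bforms_const[of 1 A B] bforms_const[of 1 A B]] not_dvd_1
      by (simp add: one_frac const3_simps)
    show "\<ominus>\<^bsub>E\<^esub> x \<in> bfrac F A B" if mem: "x \<in> bfrac F A B" for x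
    proof -
      obtain n P Q where x: "x = frac F P Q" "P \<in> bforms n A B" "Q \<in> bforms n A B" "\<not> F dvd Q" "(P, Q) \<in> FP"
        using mem by (rule elim)
      show ?thesis unfolding x(1) uminus_frac[OF x(5)] by (rule bfracI[OF bforms_uminus[OF x(2)] x(3,4)])
    qed
    show "x \<otimes>\<^bsub>E\<^esub> y \<in> bfrac F A B" if xy: "x \<in> bfrac F A B" "y \<in> bfrac F A B" for x y
    proof -
      obtain n P Q where x: "x = frac F P Q" "P \<in> bforms n A B" "Q \<in> bforms n A B" "\<not> F dvd Q" "(P, Q) \<in> FP"
        using xy(1) by (rule elim)
      obtain m P' Q' where y: "y = frac F P' Q'" "P' \<in> bforms m A B" "Q' \<in> bforms m A B" "\<not> F dvd Q'" "(P', Q') \<in> FP"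
        using xy(2) by (rule elim)
      show ?thesis unfolding x(1) y(1) mult_frac[OF x(5) y(5)]
        by (intro bfracI[of _ "n + m"] bforms_mult not_dvd_mult x y)
    qed
    show "x \<oplus>\<^bsub>E\<^esub> y \<in> bfrac F A B" if xy: "x \<in> bfrac F A B" "y \<in> bfrac F A B" for x y
    proof -
      obtain n P Q where x: "x = frac F P Q" "P \<in> bforms n A B" "Q \<in> bforms n A B" "\<not> F dvd Q" "(P, Q) \<in> FP"
        using xy(1) by (rule elim)
      obtain m P' Q' where y: "y = frac F P' Q'" "P' \<in> bforms m A B" "Q' \<in> bforms m A B" "\<not> F dvd Q'" "(P', Q') \<in> FP"
        using xy(2) by (rule elim)
      have PQ: "P' * Q \<in> bforms (n + m) A B" using bforms_mult[OF y(2) x(3)] by (simp add: add.commute)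
      show ?thesis unfolding x(1) y(1) add_frac[OF x(5) y(5)]
        by (rule bfracI[OF bforms_add[OF bforms_mult[OF x(2) y(3)] PQ] bforms_mult[OF x(3) y(3)]
              not_dvd_mult[OF x(4) y(4)]])
    qed
  qed
  show "inv\<^bsub>E\<^esub> x \<in> bfrac F A B" if x: "x \<in> bfrac F A B - {\<zero>\<^bsub>E\<^esub>}" for x
  proof -
    obtain n P Q where P: "x = frac F P Q" "P \<in> bforms n A B" "Q \<in> bforms n A B" "\<not> F dvd Q" "(P, Q) \<in> FP"
      using x elim by blast
    have "\<not> F dvd P" using x P(1) frac_eq_0_iff[OF P(5)] by blast
    then show ?thesis unfolding P(1) using P by (simp add: inv_frac bfracI)
  qed
qed

text \<open>The map induced on fractions by a transformation of forms. It is computed on all representatives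
  of the fraction at once, and is undefined outside the function field, as membership in \<open>Bij\<close>
  requires.\<close>

definition induced :: "('k poly3 \<Rightarrow> 'k poly3) \<Rightarrow> ('k poly3 \<times> 'k poly3) set \<Rightarrow> ('k poly3 \<times> 'k poly3) set" where
  "induced \<psi> = (\<lambda>x\<in>carrier E. \<Union>(G, H)\<in>x. frac F (\<psi> G) (\<psi> H))"

lemma induced_frac:
  assumes psi: "crhom \<psi>" "\<And>n G. homogeneous3 n G \<Longrightarrow> homogeneous3 n (\<psi> G)" "\<And>G. F dvd \<psi> G \<longleftrightarrow> F dvd G"
    and GH: "(G, H) \<in> FP"
  shows "induced \<psi> (frac F G H) = frac F (\<psi> G) (\<psi> H)" "(\<psi> G, \<psi> H) \<in> FP"
proof -
  have fp: "(\<psi> G, \<psi> H) \<in> FP" if "(G, H) \<in> FP" for G H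
    using that psi(2,3) by (auto simp: fun_pairs_def)
  then show "(\<psi> G, \<psi> H) \<in> FP" using GH by blast
  have "(\<Union>(A, B)\<in>frac F G H. frac F (\<psi> A) (\<psi> B)) = frac F (\<psi> G) (\<psi> H)"
  proof (rule SUP_eq_const)
    have "(G, H) \<in> frac F G H" using GH by (simp add: mem_frac)
    then show "frac F G H \<noteq> {}" by blast
    fix x assume x: "x \<in> frac F G H"
    obtain A B where AB: "x = (A, B)" by (cases x)
    have m: "(A, B) \<in> FP" "F dvd G * B - A * H" using x by (simp_all add: AB mem_frac)
    then have "F dvd \<psi> (G * B - A * H)" by (simp add: psi(3))
    then have "frac F (\<psi> G) (\<psi> H) = frac F (\<psi> A) (\<psi> B)"
      by (simp add: frac_eq_iff fp GH m crhom.homs[OF psi(1)])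
    then show "(case x of (A, B) \<Rightarrow> frac F (\<psi> A) (\<psi> B)) = frac F (\<psi> G) (\<psi> H)" by (simp add: AB)
  qed
  then show "induced \<psi> (frac F G H) = frac F (\<psi> G) (\<psi> H)"
    by (simp add: induced_def frac_closed[OF GH])
qed

lemma induced_aut:
  assumes psi: "crhom \<psi>" "\<And>n G. homogeneous3 n G \<Longrightarrow> homogeneous3 n (\<psi> G)" "\<psi> F = F"
    and psi': "crhom \<psi>'" "\<And>n G. homogeneous3 n G \<Longrightarrow> homogeneous3 n (\<psi>' G)" "\<psi>' F = F"
    and inv: "\<And>G. \<psi> (\<psi>' G) = G" "\<And>G. \<psi>' (\<psi> G) = G"
    and L: "\<And>x. x \<in> L \<Longrightarrow> induced \<psi> x = x"
  shows "induced \<psi> \<in> field_auts E L"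
proof -
  have d: "F dvd \<psi> G \<longleftrightarrow> F dvd G" "F dvd \<psi>' G \<longleftrightarrow> F dvd G" for G
    using crhom.hom_dvd[OF psi(1), of F G] crhom.hom_dvd[OF psi'(1), of F "\<psi> G"]
      crhom.hom_dvd[OF psi'(1), of F G] crhom.hom_dvd[OF psi(1), of F "\<psi>' G"]
    unfolding psi(3) psi'(3) inv by blast+
  note i = induced_frac[OF psi(1,2) d(1)] and i' = induced_frac[OF psi'(1,2) d(2)]
  have cl: "induced \<psi> x \<in> carrier E" "induced \<psi>' x \<in> carrier E"
    "induced \<psi>' (induced \<psi> x) = x" "induced \<psi> (induced \<psi>' x) = x" if "x \<in> carrier E" for x
    using that by (elim carrierE; simp add: i i' inv frac_closed)+
  have "bij_betw (induced \<psi>) (carrier E) (carrier E)"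
    by (rule bij_betw_byWitness[where f' = "induced \<psi>'"]) (auto simp only: cl image_subset_iff)
  then have "induced \<psi> \<in> Bij (carrier E)" by (simp add: Bij_def induced_def)
  moreover have "induced \<psi> \<in> ring_hom E E"
  proof (rule ring_hom_memI)
    show "induced \<psi> \<one>\<^bsub>E\<^esub> = \<one>\<^bsub>E\<^esub>" by (simp add: one_frac i fun_pairs_1 crhom.homs[OF psi(1)])
    fix x y assume xy: "x \<in> carrier E" "y \<in> carrier E"
    obtain G H where x: "(G, H) \<in> FP" "x = frac F G H" using xy(1) by (rule carrierE)
    obtain G' H' where y: "(G', H') \<in> FP" "y = frac F G' H'" using xy(2) by (rule carrierE)
    show "induced \<psi> (x \<otimes>\<^bsub>E\<^esub> y) = induced \<psi> x \<otimes>\<^bsub>E\<^esub> induced \<psi> y"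
      by (simp add: x y mult_frac i fun_pairs_mult crhom.homs[OF psi(1)])
    show "induced \<psi> (x \<oplus>\<^bsub>E\<^esub> y) = induced \<psi> x \<oplus>\<^bsub>E\<^esub> induced \<psi> y"
      by (simp add: x y add_frac i fun_pairs_add crhom.homs[OF psi(1)])
  qed (rule cl)
  ultimately show ?thesis using L by (simp add: field_auts_def)
qed

text \<open>The set on which two endomorphisms of the function field agree is a subfield.\<close>

lemma subfield_equalizer:
  assumes s: "\<And>x. x \<in> carrier E \<Longrightarrow> s x \<in> carrier E"
    "\<And>x y. x \<in> carrier E \<Longrightarrow> y \<in> carrier E \<Longrightarrow> s (x \<otimes>\<^bsub>E\<^esub> y) = s x \<otimes>\<^bsub>E\<^esub> s y"
    "\<And>x y. x \<in> carrier E \<Longrightarrow> y \<in> carrier E \<Longrightarrow> s (x \<oplus>\<^bsub>E\<^esub> y) = s x \<oplus>\<^bsub>E\<^esub> s y" "s \<one>\<^bsub>E\<^esub> = \<one>\<^bsub>E\<^esub>"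
    and t: "\<And>x. x \<in> carrier E \<Longrightarrow> t x \<in> carrier E"
    "\<And>x y. x \<in> carrier E \<Longrightarrow> y \<in> carrier E \<Longrightarrow> t (x \<otimes>\<^bsub>E\<^esub> y) = t x \<otimes>\<^bsub>E\<^esub> t y"
    "\<And>x y. x \<in> carrier E \<Longrightarrow> y \<in> carrier E \<Longrightarrow> t (x \<oplus>\<^bsub>E\<^esub> y) = t x \<oplus>\<^bsub>E\<^esub> t y" "t \<one>\<^bsub>E\<^esub> = \<one>\<^bsub>E\<^esub>"
  shows "subfield {x \<in> carrier E. s x = t x} E"
proof (rule E.subfieldI')
  have hs: "s \<in> ring_hom E E" and ht: "t \<in> ring_hom E E"
    using s t by (auto intro!: ring_hom_memI)
  interpret s: ring_hom_ring E E s by (rule ring_hom_ringI2[OF E.ring_axioms E.ring_axioms hs])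
  interpret t: ring_hom_ring E E t by (rule ring_hom_ringI2[OF E.ring_axioms E.ring_axioms ht])
  show "subring {x \<in> carrier E. s x = t x} E"
  proof (rule E.subringI)
    show "{x \<in> carrier E. s x = t x} \<subseteq> carrier E" by blast
  qed (simp_all add: s t)
  fix x assume x: "x \<in> {x \<in> carrier E. s x = t x} - {\<zero>\<^bsub>E\<^esub>}"
  then have xc: "x \<in> carrier E" "inv\<^bsub>E\<^esub> x \<in> carrier E" "x \<otimes>\<^bsub>E\<^esub> inv\<^bsub>E\<^esub> x = \<one>\<^bsub>E\<^esub>" using E.field_Units by auto
  have one: "s x \<otimes>\<^bsub>E\<^esub> s (inv\<^bsub>E\<^esub> x) = \<one>\<^bsub>E\<^esub>" "t x \<otimes>\<^bsub>E\<^esub> t (inv\<^bsub>E\<^esub> x) = \<one>\<^bsub>E\<^esub>"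
    using s(2)[OF xc(1,2)] t(2)[OF xc(1,2)] xc(3) s(4) t(4) by simp_all
  have "inv\<^bsub>E\<^esub> (s x) = s (inv\<^bsub>E\<^esub> x)" "inv\<^bsub>E\<^esub> (t x) = t (inv\<^bsub>E\<^esub> x)"
    by (rule E.comm_inv_char[OF s(1)[OF xc(1)] s(1)[OF xc(2)] one(1)],
        rule E.comm_inv_char[OF t(1)[OF xc(1)] t(1)[OF xc(2)] one(2)])
  moreover have "s x = t x" using x by blast
  ultimately show "inv\<^bsub>E\<^esub> x \<in> {x \<in> carrier E. s x = t x}" using xc(2) by simp
qed

end

context outer_frame
begin

text \<open>The function field is generated over \<open>K\<close> by \<open>U/W\<close> and \<open>V/W\<close>.\<close>

lemma generated_by_UV:
  assumes S: "subfield S E" and c: "constants F \<subseteq> S" and uv: "frac F U W \<in> S" "frac F V W \<in> S"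
  shows "carrier E \<subseteq> S"
proof
  note sub = subringE[OF subfieldE(1)[OF S]]
  note p1 = fun_pairs_subst[OF _ homogeneous_UVW not_dvd_VW(2)]
  have pU: "(U, W) \<in> FP" "(V, W) \<in> FP" "(W, W) \<in> FP"
    using homogeneous_UVW not_dvd_VW by (auto intro: fun_pairsI)
  have one: "frac F W W = \<one>\<^bsub>E\<^esub>"
    using pU by (simp add: one_frac frac_eq_iff fun_pairs_1)
  have mul: "frac F (P * Q) (W * W ^ n) \<in> S"
    if "frac F P W \<in> S" "frac F Q (W ^ n) \<in> S" "(P, W) \<in> FP" "(Q, W ^ n) \<in> FP" for P Q n
    using sub(6)[OF that(1,2)] that by (simp add: mult_frac)
  have int: "frac F (subst3 U V W G) (W ^ n) \<in> S" if "homogeneous3 n G" for n G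
    using that
  proof (induction rule: homogeneous3_induct)
    case (const k)
    then show ?case using c by (auto simp: constants_def subst3_simps)
  next
    case (X n G)
    then show ?case by (simp add: crhom.homs[OF crhom_subst3] subst3_simps mul uv pU p1)
  next
    case (Y n G)
    then show ?case by (simp add: crhom.homs[OF crhom_subst3] subst3_simps mul uv pU p1)
  next
    case (Z n G)
    then show ?case by (simp add: crhom.homs[OF crhom_subst3] subst3_simps mul one sub(3) pU p1)
  next
    case (add n G H)
    have "frac F (subst3 U V W G + subst3 U V W H) (W ^ n) =
        frac F (subst3 U V W G) (W ^ n) \<oplus>\<^bsub>E\<^esub> frac F (subst3 U V W H) (W ^ n)"
      using add.hyps homogeneous_UVW
      by (intro add_frac_same[symmetric, of _ _ _ n] p1 homogeneous3_subst3_1 homogeneous3_power1)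
    then show ?case using add sub(7) by (simp add: crhom.homs[OF crhom_subst3])
  qed
  fix x assume "x \<in> carrier E"
  then obtain G H where GH: "(G, H) \<in> FP" "x = frac F G H" by (rule carrierE)
  obtain n where n: "homogeneous3 n G" "homogeneous3 n H" "\<not> F dvd H" using GH(1) by (rule fun_pairsE)
  have W: "homogeneous3 n (W ^ n)" "\<not> F dvd W ^ n"
    by (intro homogeneous3_power1 homogeneous_UVW not_dvd_power not_dvd_VW)+
  have G: "frac F G (W ^ n) \<in> S" "frac F H (W ^ n) \<in> S"
    using int[OF phi_homogeneous[OF n(1)]] int[OF phi_homogeneous[OF n(2)]] by (simp_all add: subst_phi)
  have p: "(G, W ^ n) \<in> FP" "(H, W ^ n) \<in> FP" "(W ^ n, H) \<in> FP" using n W by (auto intro: fun_pairsI)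
  have "frac F H (W ^ n) \<noteq> \<zero>\<^bsub>E\<^esub>" using n(3) by (simp add: frac_eq_0_iff p)
  then have "inv\<^bsub>E\<^esub> (frac F H (W ^ n)) \<in> S"
    using E.subfield_m_inv(1)[OF S] G(2) by blast
  then have "frac F G (W ^ n) \<otimes>\<^bsub>E\<^esub> frac F (W ^ n) H \<in> S"
    using sub(6)[OF G(1)] inv_frac[OF p(2) n(3)] by simp
  moreover have "frac F G (W ^ n) \<otimes>\<^bsub>E\<^esub> frac F (W ^ n) H = x"
    unfolding mult_frac[OF p(1,3)] GH(2) by (rule frac_eqI[OF fun_pairs_mult[OF p(1,3)] GH(1)]) (simp add: ac_simps)
  ultimately show "x \<in> S" by simp
qed

end

section \<open>The Galois points of the Fermat curve\<close>

text \<open>The homogenization of a nonzero polynomial over \<open>K\<close> in one variable is a product of linear factors, so a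
  prime form dividing it divides one of them.\<close>

lemma (in prime_curve) dvd_linear_factor:
  fixes p :: "'k poly"
  assumes alg: "\<And>p :: 'k poly. Polynomial.degree p > 0 \<Longrightarrow> \<exists>a. poly p a = 0"
    and "p \<noteq> 0" "F dvd bform const3 (Polynomial.degree p) (Polynomial.coeff p) x y"
  shows "\<exists>a. poly p a = 0 \<and> F dvd x - const3 a * y"
  using assms(2,3)
proof (induction "Polynomial.degree p" arbitrary: p)
  case 0
  then obtain a where p: "p = [:a:]" by (metis degree_eq_zeroE)
  then have "a \<noteq> 0" using 0 by auto
  then show ?case using 0 not_dvd_const[of a] by (simp add: p bform_def)
next
  case (Suc n)
  obtain a where a: "poly p a = 0" using alg[of p] Suc.hyps(2) by auto
  then obtain q where q: "p = [:- a, 1:] * q" by (metis poly_eq_0_iff_dvd dvdE)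
  have q0: "q \<noteq> 0" using q Suc.prems by auto
  have dq: "Polynomial.degree q = n"
    using Suc.hyps(2) q0 unfolding q by (subst (asm) degree_mult_eq) auto
  note C = crhom.homs[OF crhom_const3]
  have co: "Polynomial.coeff p i = case_nat 0 (Polynomial.coeff q) i - a * (if i \<le> n then Polynomial.coeff q i else 0)" for i
    by (cases i) (auto simp: q coeff_pCons dq coeff_eq_0 split: nat.splits)
  have "bform const3 (Suc n) (Polynomial.coeff p) x y =
     bform const3 (Suc n) (case_nat 0 (Polynomial.coeff q)) x y -
     const3 a * bform const3 (Suc n) (\<lambda>i. if i \<le> n then Polynomial.coeff q i else 0) x y"
    unfolding bform_def co sum_distrib_left sum_subtractf[symmetric]
    by (intro sum.cong refl) (simp add: C algebra_simps)
  also have "\<dots> = (x - const3 a * y) * bform const3 n (Polynomial.coeff q) x y"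
    unfolding bform_Suc_left[of const3, OF C(1)] bform_Suc_right[of const3, OF C(1)] by (simp add: algebra_simps)
  finally have "F dvd (x - const3 a * y) * bform const3 n (Polynomial.coeff q) x y"
    using Suc.prems(2) by (simp flip: Suc.hyps(2))
  then consider "F dvd x - const3 a * y" | "F dvd bform const3 n (Polynomial.coeff q) x y"
    using dvd_multD by blast
  then show ?case
  proof cases
    case 1
    then show ?thesis using a by blast
  next
    case 2
    then obtain b where "poly q b = 0" "F dvd x - const3 b * y" using Suc.hyps(1)[of q] dq q0 by auto
    then show ?thesis by (auto simp: q)
  qed
qed

text \<open>A frame in which \<open>F\<close> is the Fermat form, whose degree is nonzero in \<open>K\<close>.\<close>

locale fermat_frame = outer_frame F U V W \<phi> d
  for F U V W :: "'k::alg_closed_field poly3" and \<phi> :: "'k poly3 \<Rightarrow> 'k poly3" and d :: nat +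
  assumes fermat_eq: "F = U ^ d + V ^ d + W ^ d"
    and d_nonzero: "of_nat d \<noteq> (0::'k)"
begin

lemma fermat_frame_swap: "fermat_frame F V U W (\<lambda>G. subst3 Y3 X3 Z3 (\<phi> G)) d"
proof -
  interpret s: outer_frame F V U W "\<lambda>G. subst3 Y3 X3 Z3 (\<phi> G)" d by (rule outer_frame_swap)
  show ?thesis by unfold_locales (simp_all add: fermat_eq d_nonzero)
qed

lemma not_dvd_U: "\<not> F dvd U"
  by (rule outer_frame.not_dvd_VW(1)[OF outer_frame_swap])

lemma fun_pairs_UVW: "(U, W) \<in> FP" "(V, W) \<in> FP" "(U, U) \<in> FP"
  using homogeneous_UVW not_dvd_VW not_dvd_U by (auto intro: fun_pairsI)

text \<open>The homology \<open>U \<mapsto> \<zeta> U\<close>.\<close>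

definition rot :: "'k \<Rightarrow> 'k poly3 \<Rightarrow> 'k poly3" where
  "rot \<zeta> G = subst3 (const3 \<zeta> * U) V W (\<phi> G)"

lemma crhom_rot: "crhom (rot \<zeta>)"
  unfolding rot_def by (rule crhom_comp[OF crhom_subst3 phi_hom])

lemma rot_simps: "rot \<zeta> (const3 c) = const3 c" "rot \<zeta> U = const3 \<zeta> * U" "rot \<zeta> V = V" "rot \<zeta> W = W"
  by (simp_all add: rot_def phi_const phi_U phi_V phi_W subst3_simps)

lemma rot_homogeneous: "homogeneous3 n G \<Longrightarrow> homogeneous3 n (rot \<zeta> G)"
  unfolding rot_def
  by (intro homogeneous3_subst3_1 phi_homogeneous homogeneous3_const_mult homogeneous_UVW)

lemma rot_rot: "rot \<zeta> (rot \<xi> G) = rot (\<zeta> * \<xi>) G"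
proof -
  have "rot \<zeta> (rot \<xi> G) = subst3 (const3 \<xi> * (const3 \<zeta> * U)) V W (\<phi> G)"
    unfolding rot_def[of \<xi>] by (simp add: hom_subst3[OF crhom_rot] rot_simps crhom.homs[OF crhom_rot])
  then show ?thesis by (simp add: rot_def crhom.homs[OF crhom_const3] ac_simps)
qed

lemma rot_1: "rot 1 G = G"
  by (simp add: rot_def crhom.homs[OF crhom_const3] subst_phi)

lemma rot_F: "\<zeta> ^ d = 1 \<Longrightarrow> rot \<zeta> F = F"
  by (simp add: fermat_eq crhom.homs[OF crhom_rot] rot_simps power_mult_distrib
      crhom.hom_power[OF crhom_const3, symmetric] const3_simps)

lemma rot_bforms: "P \<in> bforms n V W \<Longrightarrow> rot \<zeta> P = P"
  by (auto simp: bforms_def hom_bform[OF crhom_rot] rot_simps)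

lemma rot_dvd:
  assumes "\<zeta> ^ d = 1"
  shows "F dvd rot \<zeta> G \<longleftrightarrow> F dvd G"
proof -
  have z: "\<zeta> \<noteq> 0" using assms d_pos by (auto simp: power_0_left)
  have "F dvd rot \<xi> H" if "F dvd H" "\<xi> ^ d = 1" for \<xi> H
    using crhom.hom_dvd[OF crhom_rot[of \<xi>] that(1)] by (simp add: rot_F[OF that(2)])
  from this[of G \<zeta>] this[of "rot \<zeta> G" "1 / \<zeta>"] show ?thesis
    using assms z by (auto simp: rot_rot rot_1 power_divide)
qed

lemma induced_rot:
  assumes "\<zeta> ^ d = 1" "(G, H) \<in> FP"
  shows "induced (rot \<zeta>) (frac F G H) = frac F (rot \<zeta> G) (rot \<zeta> H)" "(rot \<zeta> G, rot \<zeta> H) \<in> FP"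
  by (rule induced_frac[OF crhom_rot rot_homogeneous rot_dvd[OF assms(1)] assms(2)], assumption)+

lemma rot_aut:
  assumes "\<zeta> ^ d = 1"
  shows "induced (rot \<zeta>) \<in> field_auts E (bfrac F V W)"
proof -
  have z: "\<zeta> \<noteq> 0" using assms d_pos by (auto simp: power_0_left)
  show ?thesis
  proof (rule induced_aut[where \<psi>' = "rot (1 / \<zeta>)"])
    show "rot \<zeta> F = F" "rot (1 / \<zeta>) F = F" using assms by (simp_all add: rot_F power_divide)
    show "rot \<zeta> (rot (1 / \<zeta>) G) = G" "rot (1 / \<zeta>) (rot \<zeta> G) = G" for G
      using z by (simp_all add: rot_rot rot_1)
    fix x assume "x \<in> bfrac F V W"
    then obtain n P Q where x: "x = frac F P Q" "P \<in> bforms n V W" "Q \<in> bforms n V W" "\<not> F dvd Q"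
      by (auto simp: bfrac_def)
    have "(P, Q) \<in> FP" by (rule fun_pairsI[OF bforms_VW_homogeneous[OF x(2)] bforms_VW_homogeneous[OF x(3)] x(4)])
    then show "induced (rot \<zeta>) x = x" by (simp add: x(1) induced_rot[OF assms] rot_bforms[OF x(2)] rot_bforms[OF x(3)])
  qed (rule crhom_rot rot_homogeneous; assumption?)+
qed

text \<open>The sum over all homologies \<open>U \<mapsto> \<zeta> U\<close> with \<open>\<zeta>^d = 1\<close>.\<close>

definition rot_trace :: "'k poly3 \<Rightarrow> 'k poly3" where
  "rot_trace G = (\<Sum>\<zeta>\<in>roots1 d. rot \<zeta> G)"

text \<open>Modulo \<open>F\<close>, the trace of a form is a form in \<open>V\<close> and \<open>W\<close>: only the monomials whose exponent
  of \<open>U\<close> is divisible by \<open>d\<close> can have a nonzero trace, and \<open>U^d\<close> is congruent to \<open>- (V^d + W^d)\<close>.\<close>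

lemma trace_mod:
  assumes "homogeneous3 n G"
  shows "\<exists>Q\<in>bforms (n + i) V W. F dvd rot_trace (U ^ i * subst3 U V W G) - Q"
  using assms
proof (induction arbitrary: i rule: homogeneous3_induct)
  case (const c)
  have t: "rot_trace (U ^ i * subst3 U V W (const3 c)) = const3 (c * (\<Sum>\<zeta>\<in>roots1 d. \<zeta> ^ i)) * U ^ i"
    by (simp add: rot_trace_def subst3_simps crhom.homs[OF crhom_rot] rot_simps power_mult_distrib
        crhom.homs[OF crhom_const3] sum_distrib_left sum_distrib_right ac_simps)
  show ?case
  proof (cases "d dvd i")
    case False
    then show ?thesis unfolding t sum_roots1_power[OF d_nonzero False]
      by (intro bexI[OF _ bforms_0]) (simp add: crhom.homs[OF crhom_const3])
  next
    case True
    then obtain m where i: "i = d * m" by (rule dvdE)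
    define k where "k = c * (\<Sum>\<zeta>\<in>roots1 d. \<zeta> ^ i)"
    let ?R = "- (V ^ d + W ^ d)"
    have R: "?R \<in> bforms d V W"
      using bforms_power[OF bforms_left[of V W], of d] bforms_power[OF bforms_right[of W V], of d]
      by (intro bforms_uminus bforms_add) simp_all
    then have "const3 k * ?R ^ m \<in> bforms (0 + i) V W"
      unfolding i using bforms_power[of ?R d V W m] by (simp add: bforms_const_mult)
    moreover have "F dvd const3 k * U ^ i - const3 k * ?R ^ m"
    proof -
      have "F dvd (U ^ d) ^ m - ?R ^ m"
        unfolding power_diff_sumr2[of "U ^ d" m ?R] by (rule dvd_mult2) (simp add: fermat_eq algebra_simps)
      then show ?thesis by (simp add: i power_mult flip: right_diff_distrib)
    qed
    ultimately show ?thesis unfolding t k_def by blast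
  qed
next
  case (X n G)
  have "U ^ i * subst3 U V W (X3 * G) = U ^ Suc i * subst3 U V W G"
    by (simp add: crhom.homs[OF crhom_subst3] subst3_simps ac_simps)
  then show ?case using X.IH[of "Suc i"] by (simp only: add_Suc add_Suc_right)
next
  case (Y n G)
  obtain Q where Q: "Q \<in> bforms (n + i) V W" "F dvd rot_trace (U ^ i * subst3 U V W G) - Q" using Y.IH by blast
  have "rot_trace (U ^ i * subst3 U V W (Y3 * G)) = V * rot_trace (U ^ i * subst3 U V W G)"
    by (simp add: rot_trace_def crhom.homs[OF crhom_subst3] subst3_simps crhom.homs[OF crhom_rot] rot_simps
        sum_distrib_left ac_simps)
  then have "F dvd rot_trace (U ^ i * subst3 U V W (Y3 * G)) - V * Q"
    using Q(2) by (simp flip: right_diff_distrib)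
  then show ?case using bforms_mult[OF bforms_left Q(1)] by auto
next
  case (Z n G)
  obtain Q where Q: "Q \<in> bforms (n + i) V W" "F dvd rot_trace (U ^ i * subst3 U V W G) - Q" using Z.IH by blast
  have "rot_trace (U ^ i * subst3 U V W (Z3 * G)) = W * rot_trace (U ^ i * subst3 U V W G)"
    by (simp add: rot_trace_def crhom.homs[OF crhom_subst3] subst3_simps crhom.homs[OF crhom_rot] rot_simps
        sum_distrib_left ac_simps)
  then have "F dvd rot_trace (U ^ i * subst3 U V W (Z3 * G)) - W * Q"
    using Q(2) by (simp flip: right_diff_distrib)
  then show ?case using bforms_mult[OF bforms_right Q(1)] by auto
next
  case (add n G H)
  obtain Q where Q: "Q \<in> bforms (n + i) V W" "F dvd rot_trace (U ^ i * subst3 U V W G) - Q" using add.IH(1) by blast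
  obtain R where R: "R \<in> bforms (n + i) V W" "F dvd rot_trace (U ^ i * subst3 U V W H) - R" using add.IH(2) by blast
  have "rot_trace (U ^ i * subst3 U V W (G + H)) - (Q + R) =
    (rot_trace (U ^ i * subst3 U V W G) - Q) + (rot_trace (U ^ i * subst3 U V W H) - R)"
    by (simp add: rot_trace_def crhom.homs[OF crhom_subst3] crhom.homs[OF crhom_rot] distrib_left sum.distrib)
  then have "F dvd rot_trace (U ^ i * subst3 U V W (G + H)) - (Q + R)" using dvd_add[OF Q(2) R(2)] by (simp only:)
  then show ?case using bforms_add[OF Q(1) R(1)] by blast
qed

text \<open>With \<open>T\<^sub>t = \<Sum>\<^bsub>\<zeta>\<^esub> \<zeta>^t rot \<zeta> H\<close>, the sum of \<open>T\<^sub>0, ..., T\<^bsub>d-1\<^esub>\<close> is \<open>d H\<close>, so some \<open>T\<^sub>t\<close> is not divisible by \<open>F\<close>;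
  and \<open>U^t T\<^sub>t\<close> is the trace of \<open>U^t H\<close>.\<close>

lemma trace_nonzero:
  assumes "\<not> F dvd H"
  obtains t where "\<not> F dvd rot_trace (U ^ t * H)"
proof -
  define T where "T t = (\<Sum>\<zeta>\<in>roots1 d. const3 (\<zeta> ^ t) * rot \<zeta> H)" for t
  have fin: "finite (roots1 d :: 'k set)" by (rule finite_roots1[OF d_pos])
  have "(\<Sum>t<d. T t) = (\<Sum>\<zeta>\<in>roots1 d. (\<Sum>t<d. const3 (\<zeta> ^ t) * rot \<zeta> H))"
    unfolding T_def by (rule sum.swap)
  also have "\<dots> = (\<Sum>\<zeta>\<in>(roots1 d :: 'k set). if \<zeta> = 1 then const3 (of_nat d) * H else 0)"
  proof (rule sum.cong[OF refl])
    fix \<zeta> :: 'k assume "\<zeta> \<in> roots1 d"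
    then have z: "\<zeta> ^ d = 1" by simp
    have "(\<Sum>t<d. const3 (\<zeta> ^ t) * rot \<zeta> H) = const3 (\<Sum>t<d. \<zeta> ^ t) * rot \<zeta> H"
      by (simp add: crhom.hom_sum[OF crhom_const3] sum_distrib_right)
    then show "(\<Sum>t<d. const3 (\<zeta> ^ t) * rot \<zeta> H) = (if \<zeta> = 1 then const3 (of_nat d) * H else 0)"
      unfolding sum_powers_root1[OF z] by (simp add: rot_1 const3_simps)
  qed
  also have "\<dots> = const3 (of_nat d) * H" using fin by simp
  finally have sum: "(\<Sum>t<d. T t) = const3 (of_nat d) * H" .
  have "\<not> F dvd const3 (of_nat d) * H" by (rule not_dvd_mult[OF not_dvd_const[OF d_nonzero] assms])
  then obtain t where "\<not> F dvd T t" using dvd_sum[of "{..<d}" F T] sum by auto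
  then have "\<not> F dvd U ^ t * T t" by (intro not_dvd_mult not_dvd_power not_dvd_U)
  moreover have "U ^ t * T t = rot_trace (U ^ t * H)"
    by (simp add: T_def rot_trace_def crhom.homs[OF crhom_rot] rot_simps power_mult_distrib sum_distrib_left
        crhom.homs[OF crhom_const3] ac_simps)
  ultimately show thesis using that by simp
qed

text \<open>A fraction \<open>G/H\<close> fixed by all homologies is the quotient of the traces of \<open>U^t G\<close> and \<open>U^t H\<close>.\<close>

lemma fixed_field:
  "{x \<in> carrier E. \<forall>\<sigma>\<in>field_auts E (bfrac F V W). \<sigma> x = x} = bfrac F V W"
proof (intro equalityI subsetI)
  fix x assume "x \<in> bfrac F V W"
  then show "x \<in> {x \<in> carrier E. \<forall>\<sigma>\<in>field_auts E (bfrac F V W). \<sigma> x = x}"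
    using bfrac_closed[OF homogeneous_UVW(2,3)] by (auto simp: field_auts_def)
next
  fix x assume "x \<in> {x \<in> carrier E. \<forall>\<sigma>\<in>field_auts E (bfrac F V W). \<sigma> x = x}"
  then have x: "x \<in> carrier E" and fixed: "\<And>\<zeta>. \<zeta> ^ d = 1 \<Longrightarrow> induced (rot \<zeta>) x = x"
    using rot_aut by blast+
  obtain G H where GH: "(G, H) \<in> FP" "x = frac F G H" using x by (rule carrierE)
  obtain n where n: "homogeneous3 n G" "homogeneous3 n H" "\<not> F dvd H" using GH(1) by (rule fun_pairsE)
  obtain t where t: "\<not> F dvd rot_trace (U ^ t * H)" by (rule trace_nonzero[OF n(3)])
  let ?G = "U ^ t * G" and ?H = "U ^ t * H"
  have hGH: "homogeneous3 (t + n) ?G" "homogeneous3 (t + n) ?H"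
    by (intro homogeneous3_mult homogeneous3_power1 homogeneous_UVW n)+
  have p: "(?G, ?H) \<in> FP"
    by (rule fun_pairsI[OF hGH not_dvd_mult[OF not_dvd_power[OF not_dvd_U] n(3)]])
  have x': "x = frac F ?G ?H" unfolding GH(2) by (rule frac_eqI[OF GH(1) p]) simp
  have "F dvd rot \<zeta> ?G * ?H - ?G * rot \<zeta> ?H" if "\<zeta> \<in> roots1 d" for \<zeta>
  proof -
    have z: "\<zeta> ^ d = 1" using that by simp
    have "frac F (rot \<zeta> ?G) (rot \<zeta> ?H) = frac F ?G ?H"
      using fixed[OF z] unfolding x' induced_rot(1)[OF z p] .
    then show ?thesis unfolding frac_eq_iff[OF induced_rot(2)[OF z p] p] .
  qed
  then have "F dvd (\<Sum>\<zeta>\<in>roots1 d. rot \<zeta> ?G * ?H - ?G * rot \<zeta> ?H)" by (rule dvd_sum)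
  then have tr: "F dvd rot_trace ?G * ?H - ?G * rot_trace ?H"
    by (simp only: rot_trace_def sum_subtractf sum_distrib_left sum_distrib_right)
  obtain P where P: "P \<in> bforms (n + t) V W" "F dvd rot_trace ?G - P"
    using trace_mod[OF phi_homogeneous[OF n(1)], of t] by (auto simp: subst_phi)
  obtain Q where Q: "Q \<in> bforms (n + t) V W" "F dvd rot_trace ?H - Q"
    using trace_mod[OF phi_homogeneous[OF n(2)], of t] by (auto simp: subst_phi)
  have "\<not> F dvd Q"
  proof
    assume "F dvd Q"
    then have "F dvd (rot_trace ?H - Q) + Q" using Q(2) by (intro dvd_add)
    then show False using t by simp
  qed
  moreover have "F dvd P * ?H - ?G * Q"
  proof -
    have "F dvd (rot_trace ?G * ?H - ?G * rot_trace ?H) - (rot_trace ?G - P) * ?H + ?G * (rot_trace ?H - Q)"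
      by (rule dvd_add[OF dvd_diff[OF tr dvd_mult2[OF P(2)]] dvd_mult[OF Q(2)]])
    then show ?thesis by (simp add: algebra_simps)
  qed
  ultimately have "frac F P Q = x"
    unfolding x' using frac_eq_iff[OF fun_pairsI[OF bforms_VW_homogeneous[OF P(1)] bforms_VW_homogeneous[OF Q(1)]] p]
    by blast
  then show "x \<in> bfrac F V W" using bfracI[OF P(1) Q(1) \<open>\<not> F dvd Q\<close>] by simp
qed

lemma U_power:
  "frac F U W [^]\<^bsub>E\<^esub> d \<in> bfrac F V W"
proof -
  have R: "- (V ^ d + W ^ d) \<in> bforms d V W" "W ^ d \<in> bforms d V W"
    using bforms_power[OF bforms_left[of V W], of d] bforms_power[OF bforms_right[of W V], of d]
    by (simp_all only: mult_1 bforms_uminus bforms_add)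
  have nW: "\<not> F dvd W ^ d" by (rule not_dvd_power[OF not_dvd_VW(2)])
  have "frac F (U ^ d) (W ^ d) = frac F (- (V ^ d + W ^ d)) (W ^ d)"
    unfolding frac_eq_iff[OF fun_pairs_power[OF fun_pairs_UVW(1)]
        fun_pairsI[OF bforms_VW_homogeneous[OF R(1)] bforms_VW_homogeneous[OF R(2)] nW]]
  proof -
    have "U ^ d * W ^ d - - (V ^ d + W ^ d) * W ^ d = F * W ^ d" by (simp add: fermat_eq algebra_simps)
    then show "F dvd U ^ d * W ^ d - - (V ^ d + W ^ d) * W ^ d" by simp
  qed
  then show ?thesis using bfracI[OF R nW] by (simp add: pow_frac fun_pairs_UVW)
qed

text \<open>\<open>U/W\<close> is a root of \<open>T^d - (U/W)^d\<close>, which has its coefficients in \<open>K(V/W)\<close>.\<close>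

lemma algebraic_E:
  assumes "x \<in> carrier E"
  shows "(ring.algebraic E over bfrac F V W) x"
proof -
  let ?L = "bfrac F V W"
  let ?u = "frac F U W"
  let ?A = "{x \<in> carrier E. (ring.algebraic E over ?L) x}"
  have L: "subfield ?L E" by (rule subfield_bfrac[OF homogeneous_UVW(2,3)])
  note sub = subringE[OF subfieldE(1)[OF L]]
  have u: "?u \<in> carrier E" by (rule frac_closed[OF fun_pairs_UVW(1)])
  have self: "y \<in> ?A" if "y \<in> ?L" for y
    using that sub(1) E.algebraic_self[OF subfieldE(1)[OF L]] by auto
  have "(ring.algebraic E over ?L) ?u"
  proof (rule E.algebraicI)
    let ?w = "\<ominus>\<^bsub>E\<^esub> (?u [^]\<^bsub>E\<^esub> d)"
    let ?p = "\<one>\<^bsub>E\<^esub> # replicate (d - 1) \<zero>\<^bsub>E\<^esub> @ [?w]"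
    have w: "?w \<in> ?L" by (rule sub(5)[OF U_power])
    show "?p \<in> carrier (univ_poly E ?L)"
      using w sub(2,3) E.one_not_zero unfolding univ_poly_carrier[symmetric] polynomial_def by auto
    show "?p \<noteq> []" by simp
    have len: "length (replicate (d - 1) \<zero>\<^bsub>E\<^esub> @ [?w]) = d" using d_pos by simp
    have "ring.eval E (replicate (d - 1) \<zero>\<^bsub>E\<^esub> @ [?w]) ?u = ?w"
      using w sub(1) u by (subst E.eval_replicate) auto
    then show "ring.eval E ?p ?u = \<zero>\<^bsub>E\<^esub>"
      using u len by (simp add: E.r_neg)
  qed
  then have "?u \<in> ?A" using u by simp
  moreover have "frac F V W \<in> ?A" by (rule self[OF bfracI[OF bforms_left bforms_right not_dvd_VW(2)]])
  moreover have "constants F \<subseteq> ?A" using constants_subset_bfrac self by blast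
  ultimately have "carrier E \<subseteq> ?A" by (intro generated_by_UV E.subfield_of_algebraics[OF L])
  then show ?thesis using assms by blast
qed

lemma galois_E: "galois_extension E (bfrac F V W)"
  unfolding galois_extension_def
  using field_E subfield_bfrac[OF homogeneous_UVW(2,3)] algebraic_E fixed_field by blast

text \<open>An automorphism over \<open>K(V/W)\<close> multiplies \<open>U/W\<close> by a constant: it fixes \<open>(U/W)^d\<close>, and
  \<open>T^d - 1\<close> splits over \<open>K\<close>.\<close>

lemma aut_U:
  assumes s: "\<sigma> \<in> field_auts E (bfrac F V W)"
  obtains \<zeta> where "\<sigma> (frac F U W) = frac F (const3 \<zeta>) 1 \<otimes>\<^bsub>E\<^esub> frac F U W"
proof -
  note a = field_auts_hom[OF s]
  have u: "frac F U W \<in> carrier E" by (rule frac_closed[OF fun_pairs_UVW(1)])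
  obtain A B where AB: "(A, B) \<in> FP" "\<sigma> (frac F U W) = frac F A B"
    using a(1)[OF u] by (rule carrierE)
  have pow: "\<sigma> (frac F U W [^]\<^bsub>E\<^esub> (n::nat)) = \<sigma> (frac F U W) [^]\<^bsub>E\<^esub> n" for n
    by (induction n) (simp_all add: a u)
  have "frac F (A ^ d) (B ^ d) = frac F (U ^ d) (W ^ d)"
    using a(6)[OF U_power] pow[of d] by (simp add: AB pow_frac fun_pairs_UVW)
  then have "F dvd A ^ d * W ^ d - U ^ d * B ^ d"
    unfolding frac_eq_iff[OF fun_pairs_power[OF AB(1)] fun_pairs_power[OF fun_pairs_UVW(1)]] .
  then have dvd: "F dvd (A * W) ^ d - (B * U) ^ d" by (simp add: power_mult_distrib ac_simps)
  define p where "p = Polynomial.monom (1::'k) d - 1"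
  have co: "Polynomial.coeff p i = (if i = d then 1 else if i = 0 then - 1 else 0)" for i
    using d_pos by (auto simp: p_def coeff_1)
  have deg: "Polynomial.degree p = d"
    by (rule antisym) (auto intro!: degree_le le_degree simp: co)
  then have p0: "p \<noteq> 0" using d_pos by auto
  have "bform const3 d (Polynomial.coeff p) (A * W) (B * U) =
     (\<Sum>i\<le>d. (if i = d then (A * W) ^ d else 0) + (if i = 0 then - ((B * U) ^ d) else 0))"
    unfolding bform_def using d_pos
    by (intro sum.cong refl) (auto simp: co crhom.homs[OF crhom_const3])
  also have "\<dots> = (A * W) ^ d - (B * U) ^ d" by (simp add: sum.distrib)
  finally have "F dvd bform const3 (Polynomial.degree p) (Polynomial.coeff p) (A * W) (B * U)"
    using dvd deg by simp
  then obtain \<zeta> where z: "F dvd A * W - const3 \<zeta> * (B * U)"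
    using dvd_linear_factor[OF alg_closed_imp_poly_has_root p0] by blast
  have pz: "(const3 \<zeta> * U, 1 * W) \<in> FP" by (rule fun_pairs_mult[OF fun_pairs_const fun_pairs_UVW(1)])
  have "frac F A B = frac F (const3 \<zeta> * U) (1 * W)"
    unfolding frac_eq_iff[OF AB(1) pz] using z by (simp add: ac_simps)
  then show thesis using that AB(2) mult_frac[OF fun_pairs_const fun_pairs_UVW(1)] by simp
qed

lemma commuting:
  assumes s: "\<sigma> \<in> field_auts E (bfrac F V W)" and t: "\<tau> \<in> field_auts E (bfrac F U W)"
    and x: "x \<in> carrier E"
  shows "\<sigma> (\<tau> x) = \<tau> (\<sigma> x)"
proof -
  interpret s: fermat_frame F V U W "\<lambda>G. subst3 Y3 X3 Z3 (\<phi> G)" d by (rule fermat_frame_swap)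
  note a = field_auts_hom[OF s] and b = field_auts_hom[OF t]
  let ?S = "{x \<in> carrier E. \<sigma> (\<tau> x) = \<tau> (\<sigma> x)}"
  obtain \<zeta> where z: "\<sigma> (frac F U W) = frac F (const3 \<zeta>) 1 \<otimes>\<^bsub>E\<^esub> frac F U W" by (rule aut_U[OF s])
  obtain \<xi> where x': "\<tau> (frac F V W) = frac F (const3 \<xi>) 1 \<otimes>\<^bsub>E\<^esub> frac F V W" by (rule s.aut_U[OF t])
  have c: "\<sigma> (frac F (const3 k) 1) = frac F (const3 k) 1" "\<tau> (frac F (const3 k) 1) = frac F (const3 k) 1" for k
  proof -
    have m: "frac F (const3 k) 1 \<in> bfrac F A B" for A B
      using constants_subset_bfrac[of A B] unfolding constants_def by blast
    show "\<sigma> (frac F (const3 k) 1) = frac F (const3 k) 1" "\<tau> (frac F (const3 k) 1) = frac F (const3 k) 1"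
      by (rule a(6)[OF m] b(6)[OF m])+
  qed
  have cc: "frac F (const3 k) 1 \<in> carrier E" "frac F U W \<in> carrier E" "frac F V W \<in> carrier E" for k
    by (rule frac_closed[OF fun_pairs_const] frac_closed[OF fun_pairs_UVW(1)] frac_closed[OF fun_pairs_UVW(2)])+
  have uv: "\<tau> (frac F U W) = frac F U W" "\<sigma> (frac F V W) = frac F V W"
    by (rule b(6)[OF bfracI[OF bforms_left bforms_right not_dvd_VW(2)]]
        a(6)[OF bfracI[OF bforms_left bforms_right not_dvd_VW(2)]])+
  have "subfield ?S E"
    by (rule subfield_equalizer) (simp_all add: a b)
  moreover have "constants F \<subseteq> ?S" using cc(1) by (auto simp: constants_def c)
  moreover have "frac F U W \<in> ?S" "frac F V W \<in> ?S" by (simp_all add: cc uv z x' a(2) b(2) c)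
  ultimately have "carrier E \<subseteq> ?S" by (rule generated_by_UV)
  then show ?thesis using x by blast
qed

lemma trivial_intersection:
  assumes s: "\<sigma> \<in> field_auts E (bfrac F V W)" "\<sigma> \<in> field_auts E (bfrac F U W)"
  shows "\<sigma> = (\<lambda>x\<in>carrier E. x)"
proof -
  note a = field_auts_hom[OF s(1)] and b = field_auts_hom(6)[OF s(2)]
  let ?S = "{x \<in> carrier E. \<sigma> x = x}"
  have "subfield ?S E"
    by (rule subfield_equalizer) (simp_all add: a)
  moreover have "constants F \<subseteq> ?S"
    using a(6) constants_subset_bfrac constants_subset by blast
  moreover have "frac F U W \<in> ?S" "frac F V W \<in> ?S"
    using a(6)[OF bfracI[OF bforms_left bforms_right not_dvd_VW(2)]]
      b[OF bfracI[OF bforms_left bforms_right not_dvd_VW(2)]] frac_closed fun_pairs_UVW by auto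
  ultimately have "carrier E \<subseteq> ?S" by (rule generated_by_UV)
  then show ?thesis using a(7) by (intro extensionalityI[of _ "carrier E"]) auto
qed

end

lemma internal_direct_productI:
  assumes G: "group G" and A: "subgroup A G" and B: "subgroup B G"
    and comm: "\<And>a b. a \<in> A \<Longrightarrow> b \<in> B \<Longrightarrow> a \<otimes>\<^bsub>G\<^esub> b = b \<otimes>\<^bsub>G\<^esub> a"
    and triv: "A \<inter> B \<subseteq> {\<one>\<^bsub>G\<^esub>}"
  shows "internal_direct_product G A B"
proof -
  interpret group G by fact
  interpret A: subgroup A G by fact
  interpret B: subgroup B G by fact
  have mem: "x \<in> A <#>\<^bsub>G\<^esub> B \<longleftrightarrow> (\<exists>a\<in>A. \<exists>b\<in>B. x = a \<otimes>\<^bsub>G\<^esub> b)" for x by (auto simp: set_mult_def)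
  have cl: "a \<in> carrier G" "b \<in> carrier G" if "a \<in> A" "b \<in> B" for a b using that by auto
  have rearr: "(a \<otimes>\<^bsub>G\<^esub> b) \<otimes>\<^bsub>G\<^esub> (a' \<otimes>\<^bsub>G\<^esub> b') = (a \<otimes>\<^bsub>G\<^esub> a') \<otimes>\<^bsub>G\<^esub> (b \<otimes>\<^bsub>G\<^esub> b')"
    if "a \<in> A" "a' \<in> A" "b \<in> B" "b' \<in> B" for a a' b b'
  proof -
    have "(a \<otimes>\<^bsub>G\<^esub> b) \<otimes>\<^bsub>G\<^esub> (a' \<otimes>\<^bsub>G\<^esub> b') = a \<otimes>\<^bsub>G\<^esub> (b \<otimes>\<^bsub>G\<^esub> a') \<otimes>\<^bsub>G\<^esub> b'"
      using that by (simp add: m_assoc)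
    also have "\<dots> = a \<otimes>\<^bsub>G\<^esub> (a' \<otimes>\<^bsub>G\<^esub> b) \<otimes>\<^bsub>G\<^esub> b'" using comm[of a' b] that by simp
    finally show ?thesis using that by (simp add: m_assoc)
  qed
  have sub: "subgroup (A <#>\<^bsub>G\<^esub> B) G"
  proof (rule subgroupI)
    show "A <#>\<^bsub>G\<^esub> B \<subseteq> carrier G" by (auto simp: mem)
    have "\<one>\<^bsub>G\<^esub> \<otimes>\<^bsub>G\<^esub> \<one>\<^bsub>G\<^esub> \<in> A <#>\<^bsub>G\<^esub> B" using A.one_closed B.one_closed mem by blast
    then show "A <#>\<^bsub>G\<^esub> B \<noteq> {}" by blast
    show "inv\<^bsub>G\<^esub> x \<in> A <#>\<^bsub>G\<^esub> B" if x: "x \<in> A <#>\<^bsub>G\<^esub> B" for x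
    proof -
      obtain a b where ab: "a \<in> A" "b \<in> B" "x = a \<otimes>\<^bsub>G\<^esub> b" using x mem by blast
      then have "inv\<^bsub>G\<^esub> x = inv\<^bsub>G\<^esub> a \<otimes>\<^bsub>G\<^esub> inv\<^bsub>G\<^esub> b"
        using comm[of "inv\<^bsub>G\<^esub> a" "inv\<^bsub>G\<^esub> b"] by (simp add: inv_mult_group)
      then show ?thesis using ab mem by auto
    qed
    show "x \<otimes>\<^bsub>G\<^esub> y \<in> A <#>\<^bsub>G\<^esub> B" if xy: "x \<in> A <#>\<^bsub>G\<^esub> B" "y \<in> A <#>\<^bsub>G\<^esub> B" for x y
    proof -
      obtain a b where ab: "a \<in> A" "b \<in> B" "x = a \<otimes>\<^bsub>G\<^esub> b" using xy(1) mem by blast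
      obtain a' b' where ab': "a' \<in> A" "b' \<in> B" "y = a' \<otimes>\<^bsub>G\<^esub> b'" using xy(2) mem by blast
      have "x \<otimes>\<^bsub>G\<^esub> y = (a \<otimes>\<^bsub>G\<^esub> a') \<otimes>\<^bsub>G\<^esub> (b \<otimes>\<^bsub>G\<^esub> b')" using rearr ab ab' by simp
      then show ?thesis using ab ab' mem by blast
    qed
  qed
  let ?f = "\<lambda>(a, b). a \<otimes>\<^bsub>G\<^esub> b"
  have "?f \<in> hom (G\<lparr>carrier := A\<rparr> \<times>\<times> G\<lparr>carrier := B\<rparr>) (G\<lparr>carrier := A <#>\<^bsub>G\<^esub> B\<rparr>)"
    by (rule homI) (auto simp: mem rearr[symmetric])
  moreover have "inj_on ?f (A \<times> B)"
  proof (rule inj_onI)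
    fix x y assume xy: "x \<in> A \<times> B" "y \<in> A \<times> B" "?f x = ?f y"
    obtain a b where x: "x = (a, b)" "a \<in> A" "b \<in> B" using xy(1) by blast
    obtain a' b' where y: "y = (a', b')" "a' \<in> A" "b' \<in> B" using xy(2) by blast
    have eq: "a \<otimes>\<^bsub>G\<^esub> b = a' \<otimes>\<^bsub>G\<^esub> b'" using xy(3) x y by simp
    have c: "a \<in> carrier G" "b \<in> carrier G" "a' \<in> carrier G" "b' \<in> carrier G" using x y by auto
    have "inv\<^bsub>G\<^esub> a' \<otimes>\<^bsub>G\<^esub> a = inv\<^bsub>G\<^esub> a' \<otimes>\<^bsub>G\<^esub> (a \<otimes>\<^bsub>G\<^esub> b) \<otimes>\<^bsub>G\<^esub> inv\<^bsub>G\<^esub> b" using c by (simp add: m_assoc)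
    also have "\<dots> = b' \<otimes>\<^bsub>G\<^esub> inv\<^bsub>G\<^esub> b" unfolding eq using c by (simp add: m_assoc[symmetric])
    finally have e: "inv\<^bsub>G\<^esub> a' \<otimes>\<^bsub>G\<^esub> a = b' \<otimes>\<^bsub>G\<^esub> inv\<^bsub>G\<^esub> b" .
    have "inv\<^bsub>G\<^esub> a' \<otimes>\<^bsub>G\<^esub> a \<in> A" using x y by simp
    moreover have "b' \<otimes>\<^bsub>G\<^esub> inv\<^bsub>G\<^esub> b \<in> B" using x y by simp
    ultimately have "inv\<^bsub>G\<^esub> a' \<otimes>\<^bsub>G\<^esub> a = \<one>\<^bsub>G\<^esub>" using triv e by auto
    then have "a = a'" using c by (metis inv_closed inv_equality inv_inv r_inv)
    then show "x = y" using eq c x y by simp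
  qed
  moreover have "?f ` (A \<times> B) = A <#>\<^bsub>G\<^esub> B" by (auto simp: set_mult_def)
  ultimately have "?f \<in> iso (G\<lparr>carrier := A\<rparr> \<times>\<times> G\<lparr>carrier := B\<rparr>) (G\<lparr>carrier := A <#>\<^bsub>G\<^esub> B\<rparr>)"
    by (simp add: iso_def bij_betw_def)
  then show ?thesis using A B sub by (simp add: internal_direct_product_def)
qed

lemma galois_points_of_fermat:
  fixes F :: "'k::alg_closed_field poly3"
  assumes d: "d \<ge> 1" "of_nat d \<noteq> (0::'k)" and F: "plane_curve d F" "proj_equivalent F (fermat d)"
  shows "\<exists>P1 P2. outer_galois_point F P1 \<and> outer_galois_point F P2 \<and> \<not> same_point P1 P2 \<and>
            internal_direct_product (Aut_model F) (galois_group F P1) (galois_group F P2)"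
proof -
  have irr: "Factorial_Ring.irreducible F" and hF: "homogeneous3 d F" using F(1) by (auto simp: plane_curve_def)
  have "d > 0" using d by simp
  obtain N M :: "'k ^ 3 ^ 3" where NM: "N ** M = mat 1" "M ** N = mat 1"
    and Feq: "F = lin_form (N $ 1) ^ d + lin_form (N $ 2) ^ d + lin_form (N $ 3) ^ d"
    using F(2) unfolding proj_equivalent_fermat_iff[OF \<open>d > 0\<close>] by blast
  define U V W where UVW: "U = lin_form (N $ 1)" "V = lin_form (N $ 2)" "W = lin_form (N $ 3)"
  define \<phi> where "\<phi> = subst3 (lin_form (M $ 1)) (lin_form (M $ 2)) (lin_form (M $ 3))"
  interpret prime_curve F by unfold_locales (rule irreducible_imp_prime_poly3[OF irr])
  interpret frame U V W \<phi> unfolding UVW \<phi>_def by (rule frame_of_matrix[OF NM])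
  have Fermat: "F = U ^ d + V ^ d + W ^ d" unfolding UVW by (rule Feq)
  have "\<phi> F = X3 ^ d + Y3 ^ d + Z3 ^ d" by (simp add: Fermat crhom.homs[OF phi_hom] phi_U phi_V phi_W)
  then have val: "eval3 (\<lambda>c. c) (\<phi> F) 1 0 0 = 1" "eval3 (\<lambda>c. c) (\<phi> F) 0 1 0 = 1"
    using \<open>d > 0\<close> by (simp_all add: crhom.homs[OF crhom_eval3[OF crhom_id]] eval3_simps[OF crhom_id] power_0_left)
  interpret fermat_frame F U V W \<phi> d
    by unfold_locales (use hF \<open>d > 0\<close> val Fermat d(2) in auto)
  interpret s: fermat_frame F V U W "\<lambda>G. subst3 Y3 X3 Z3 (\<phi> G)" d by (rule fermat_frame_swap)
  let ?P1 = "column 1 M" and ?P2 = "column 2 M"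
  have ps: "proj_subfield F ?P1 = bfrac F V W" "proj_subfield F ?P2 = bfrac F U W"
    using proj_subfield_column[OF NM, of 1 2 3 F] proj_subfield_column[OF NM, of 2 1 3 F]
    by (simp_all add: UVW)
  have NP: "(N *v ?P1) $ 1 = 1" "(N *v ?P2) $ 2 = 1" "(N *v ?P2) $ 1 = 0"
  proof -
    have "(N *v column j M) $ i = (N ** M) $ i $ j" for i j
      by (simp add: matrix_vector_mult_def matrix_matrix_mult_def column_def)
    then show "(N *v ?P1) $ 1 = 1" "(N *v ?P2) $ 2 = 1" "(N *v ?P2) $ 1 = 0"
      by (simp_all add: NM mat_def)
  qed
  then have nz: "?P1 \<noteq> 0" "?P2 \<noteq> 0" by (metis matrix_vector_mult_0_right zero_index zero_neq_one)+
  have "value_at F ?P1 \<noteq> 0" "value_at F ?P2 \<noteq> 0"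
    using val by (simp_all add: \<phi>_def value_at_columns)
  then have out: "outer_galois_point F ?P1" "outer_galois_point F ?P2"
    using nz galois_E s.galois_E by (simp_all add: outer_galois_point_def galois_point_def ps)
  have diff: "\<not> same_point ?P1 ?P2"
  proof
    assume "same_point ?P1 ?P2"
    then obtain c where c: "c \<noteq> 0" "?P2 = c *s ?P1" by (auto simp: same_point_def)
    have "(N *v ?P2) $ 1 = c * (N *v ?P1) $ 1"
      unfolding c(2) by (simp add: matrix_vector_mult_def sum_distrib_left ac_simps)
    then show False using NP c(1) by simp
  qed
  have "internal_direct_product (Aut_model F) (field_auts E (bfrac F V W)) (field_auts E (bfrac F U W))"
  proof (rule internal_direct_productI[OF group_Aut_model])
    show "subgroup (field_auts E (bfrac F V W)) (Aut_model F)" "subgroup (field_auts E (bfrac F U W)) (Aut_model F)"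
      by (intro subgroup_Aut_model constants_subset_bfrac bfrac_closed homogeneous_UVW)+
    show "\<sigma> \<otimes>\<^bsub>Aut_model F\<^esub> \<tau> = \<tau> \<otimes>\<^bsub>Aut_model F\<^esub> \<sigma>"
      if st: "\<sigma> \<in> field_auts E (bfrac F V W)" "\<tau> \<in> field_auts E (bfrac F U W)" for \<sigma> \<tau>
      unfolding mult_Aut_model[OF st] mult_Aut_model[OF st(2,1)] compose_def
      using commuting[OF st] by (intro restrict_ext)
    show "field_auts E (bfrac F V W) \<inter> field_auts E (bfrac F U W) \<subseteq> {\<one>\<^bsub>Aut_model F\<^esub>}"
    proof
      fix \<sigma> assume s: "\<sigma> \<in> field_auts E (bfrac F V W) \<inter> field_auts E (bfrac F U W)"
      have "\<sigma> = (\<lambda>x\<in>carrier E. x)" by (rule trivial_intersection) (use s in blast)+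
      then show "\<sigma> \<in> {\<one>\<^bsub>Aut_model F\<^esub>}" by (simp add: Aut_model_def BijGroup_def)
    qed
  qed
  then show ?thesis using out diff unfolding galois_group_def by (metis ps)
qed

theorem corollary1p3:
  fixes F :: "'k::alg_closed_field poly3" and d :: nat
  assumes "d \<ge> 3"
    and "plane_curve d F"
    and "CHAR('k) = 0 \<or> coprime d CHAR('k)"
  shows "(\<exists>P1 P2. outer_galois_point F P1 \<and> outer_galois_point F P2 \<and> \<not> same_point P1 P2 \<and>
            internal_direct_product (Aut_model F) (galois_group F P1) (galois_group F P2))
         \<longleftrightarrow> proj_equivalent F (fermat d)"
proof -
  have d: "of_nat d \<noteq> (0::'k)"
  proof
    assume "of_nat d = (0::'k)"
    then have dvd: "CHAR('k) dvd d" by (simp add: of_nat_eq_0_iff_char_dvd)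
    then have "CHAR('k) \<noteq> 0" using assms(1) by (metis dvd_0_left not_numeral_le_zero)
    then have "is_unit CHAR('k)" using assms(3) dvd by (metis coprime_absorb_right coprime_commute)
    then show False by simp
  qed
  have d2: "d \<ge> 2" "d \<ge> 1" using assms(1) by auto
  show ?thesis
    using fermat_of_galois_points[OF d2(1) d assms(2)] galois_points_of_fermat[OF d2(2) d assms(2)] by blast
qed

end
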